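(* Each hyperplane $H_A\subset Q_{1,1}$ with $[A]\in\mathbb{CP}^3$ belongs to one and only one of the following classes: \begin{itemize} \item $[A]\in Q_{1,1}$, i.e. $\Psi(H_A)=\{(w_1,w_2)\in\mathbb{C}^*\times\mathbb{C}^*:w_1=c_1\text{ or }w_2=c_2\}$ for some $c_1,c_2\in\mathbb{C}^*$: (a) $[A]\in Q_{1,1}^+$ if and only if $c_2\neq\bar c_1$; in this case $[A]\sim[(1,i,0,0)]$. (b) $[A]\notin Q_{1,1}^+$ if and only if $c_2=\bar c_1$; in this case $[A]\sim[(0,0,1,1)]$. \item $[A]\notin Q_{1,1}$, i.e. $\Psi(H_A)=\{(w,\mathcal{M}_S(w)):w\in\mathbb{C}^*\}$ for some $S\in SL(2,\mathbb{C})$: (a) $E_S$ is infinite if and only if $[A]\sim[(1,0,0,0)]$. In this case $S\stackrel{conj}{\sim}\begin{pmatrix} 1 & 0 \\ 0 & 1 \end{pmatrix}$ and $H_A^+$ is conformally equivalent to $\mathbb{C}\setminus\mathbb{R}$. (b) $|E_S|=2$ if and only if $H_A$ is a hyperplane of hyperbolic type. In this case, for $u\in(0,+\infty)$, $S\stackrel{conj}{\sim}\begin{pmatrix} e^u & 0 \\ 0 & e^{-u} \end{pmatrix}$ if and only if $[A]\sim[(\sinh u,i\cosh u,0,0)]$, and $H_A^+$ is conformally equivalent to $\mathbb{C}\setminus\{0\}$. (c) $E_S=\emptyset$ if and only if $[A]\sim[(0,0,0,1)]$ (totally real case) or $H_A$ is a hyperplane of elliptic type (non-totally real case). In this case, for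 $\alpha\in(0,\frac{\pi}{2}]$, $S\stackrel{conj}{\sim}\begin{pmatrix} 0 & i e^{-i\alpha} \\ i e^{i\alpha} & 0 \end{pmatrix}$ if and only if $[A]\sim[(0,0,\cos\alpha,i\sin\alpha)]$, and $H_A^+$ is conformally equivalent to $\mathbb{C}^*$. (d) $|E_S|=1$ if and only if $H_A$ is a hyperplane of parabolic type. In this case $S\stackrel{conj}{\sim}\begin{pmatrix} 1 & 1 \\ 0 & 1 \end{pmatrix}$, $[A]\sim[(1,0,i,i)]$, and $H_A^+$ is conformally equivalent to $\mathbb{C}$. \end{itemize}
   Context: On $\mathbb{C}^4$ let $\langle z,w\rangle=z_1w_1+z_2w_2+z_3w_3-z_4w_4$ (complex bilinear), restricting to the Minkowski inner product on $\mathbb{R}^4=\mathbb{R}^{3,1}$. $Q_{1,1}=\{[z]\in\mathbb{CP}^3:\langle z,z\rangle=0\}$, $Q_{1,1}^+=\{[z]\in Q_{1,1}:\langle z,\bar z\rangle>0\}$, $\mathbb{C}^*=\mathbb{C}\cup\{\infty\}$ with $\overline{\infty}=\infty$. $\Psi:Q_{1,1}\to\mathbb{C}^*\times\mathbb{C}^*$ is the biholomorphism with inverse $(w_1,w_2)\mapsto[(w_1+w_2,-i(w_1-w_2),1-w_1w_2,1+w_1w_2)]$ for $w_1,w_2\in\mathbb{C}$, $(w_1,\infty)\mapsto[(1,i,-w_1,w_1)]$, $(\infty,w_2)\mapsto[(1,-i,-w_2,w_2)]$, $(\infty,\infty)\mapsto[(0,0,-1,1)]$; it maps $Q_{1,1}^+$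 onto $\{w_2\ne\bar w_1\}$. For $[A]\in\mathbb{CP}^3$: $H_A=\{[z]\in Q_{1,1}:\langle A,z\rangle=0\}$, $H_A^+=H_A\cap Q_{1,1}^+$. $[A]$ (and $H_A$) is totally real if $[A]=[\mathbf{u}_0]$ with $\mathbf{u}_0$ real; otherwise $P_A=\mathrm{span}_{\mathbb{R}}\{\mathrm{Re}\,A,\mathrm{Im}\,A\}$ is a real $2$-plane and $[A]$, $H_A$ are of hyperbolic, elliptic, parabolic type according to whether $P_A$ is space-like (positive definite), time-like (Lorentzian), or light-like (degenerate). $[A]\sim[B]$ means $[A],[B]$ lie in the same orbit of $SO^+(3,1)$, the group of orientation- and time-orientation-preserving linear isometries of $\mathbb{R}^{3,1}$, acting on $\mathbb{CP}^3$. For $S=\begin{pmatrix} a & b \\ c & d \end{pmatrix}\in SL(2,\mathbb{C})$, $\mathcal{M}_S(w)=\frac{aw+b}{cw+d}$. $S_1\stackrel{conj}{\sim}S_2$ means $S_2=\pm\bar TS_1T^{-1}$ for some $T\in SL(2,\mathbb{C})$. A vector $v\in\mathbb{C}^2\setminus\{0\}$ with $Sv=r\bar v$ for some real $r\geq0$ is a conjugate eigenvector of $S$; $E_S\subset\mathbb{C}^*$ is the set of ratios $v_1/v_2$ over all conjugate eigenvectors $(v_1,v_2)^T$ of $S$. *)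

theory Defs
  imports "HOL-Complex_Analysis.Complex_Analysis"
begin

text \<open>The scalar type is left open: over the complex numbers this is the complex bilinear form on
  \<open>\<complex>\<^sup>4\<close>, over the reals it is the Minkowski inner product on \<open>\<real>\<^sup>3\<^sup>,\<^sup>1\<close>.\<close>

definition mink :: "'a::comm_ring_1 ^ 4 \<Rightarrow> 'a ^ 4 \<Rightarrow> 'a" where
  "mink z w = z$1 * w$1 + z$2 * w$2 + z$3 * w$3 - z$4 * w$4"

definition cnj_vec :: "complex ^ 'n \<Rightarrow> complex ^ 'n" where
  "cnj_vec v = (\<chi> i. cnj (v $ i))"

definition Re_vec :: "complex ^ 'n \<Rightarrow> real ^ 'n" where
  "Re_vec v = (\<chi> i. Re (v $ i))"

definition Im_vec :: "complex ^ 'n \<Rightarrow> real ^ 'n" where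
  "Im_vec v = (\<chi> i. Im (v $ i))"

definition of_real_vec :: "real ^ 'n \<Rightarrow> complex ^ 'n" where
  "of_real_vec v = (\<chi> i. complex_of_real (v $ i))"

definition of_real_mat :: "real ^ 'n ^ 'm \<Rightarrow> complex ^ 'n ^ 'm" where
  "of_real_mat M = (\<chi> i j. complex_of_real (M $ i $ j))"

definition cnj_mat :: "complex ^ 'n ^ 'm \<Rightarrow> complex ^ 'n ^ 'm" where
  "cnj_mat M = (\<chi> i j. cnj (M $ i $ j))"

text \<open>A point of \<open>\<complex>\<P>\<^sup>3\<close> is represented by the set of all its homogeneous coordinate vectors,
  so \<open>pt z\<close> is a point only for \<open>z \<noteq> 0\<close>.\<close>

definition pt :: "complex ^ 4 \<Rightarrow> (complex ^ 4) set" where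
  "pt z = {c *s z | c. c \<noteq> 0}"

definition Q11 :: "(complex ^ 4) set set" where
  "Q11 = {pt z | z. z \<noteq> 0 \<and> mink z z = 0}"

text \<open>The number \<open>mink z (cnj_vec z)\<close> is always real.\<close>

definition Q11_plus :: "(complex ^ 4) set set" where
  "Q11_plus = {pt z | z. z \<noteq> 0 \<and> mink z z = 0 \<and> Re (mink z (cnj_vec z)) > 0}"

definition hyperplane :: "complex ^ 4 \<Rightarrow> (complex ^ 4) set set" where
  "hyperplane A = {pt z | z. z \<noteq> 0 \<and> mink z z = 0 \<and> mink A z = 0}"

definition hyperplane_plus :: "complex ^ 4 \<Rightarrow> (complex ^ 4) set set" where
  "hyperplane_plus A = hyperplane A \<inter> Q11_plus"

definition space_like :: "(real ^ 4) set \<Rightarrow> bool" where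
  "space_like P \<longleftrightarrow> (\<forall>x\<in>P. x \<noteq> 0 \<longrightarrow> mink x x > 0)"

text \<open>For a plane \<open>P\<close>: the restricted form has signature \<open>(1,1)\<close>.\<close>

definition time_like :: "(real ^ 4) set \<Rightarrow> bool" where
  "time_like P \<longleftrightarrow> (\<exists>x y. P = span {x, y} \<and> mink x y = 0 \<and> mink x x > 0 \<and> mink y y < 0)"

definition light_like :: "(real ^ 4) set \<Rightarrow> bool" where
  "light_like P \<longleftrightarrow> (\<exists>x\<in>P. x \<noteq> 0 \<and> (\<forall>y\<in>P. mink x y = 0))"

text \<open>The set \<open>real_plane A\<close> and the predicates below depend only on \<open>pt A\<close>.\<close>

definition real_plane :: "complex ^ 4 \<Rightarrow> (real ^ 4) set" where
  "real_plane A = span {Re_vec A, Im_vec A}"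

definition totally_real :: "complex ^ 4 \<Rightarrow> bool" where
  "totally_real A \<longleftrightarrow> (\<exists>u. pt A = pt (of_real_vec u))"

definition hyperbolic_type :: "complex ^ 4 \<Rightarrow> bool" where
  "hyperbolic_type A \<longleftrightarrow> \<not> totally_real A \<and> space_like (real_plane A)"

definition elliptic_type :: "complex ^ 4 \<Rightarrow> bool" where
  "elliptic_type A \<longleftrightarrow> \<not> totally_real A \<and> time_like (real_plane A)"

definition parabolic_type :: "complex ^ 4 \<Rightarrow> bool" where
  "parabolic_type A \<longleftrightarrow> \<not> totally_real A \<and> light_like (real_plane A)"

text \<open>The last condition says that future-pointing time-like vectors stay future-pointing.\<close>

definition SO_plus :: "(real ^ 4 ^ 4) set" where
  "SO_plus = {g. (\<forall>x y. mink (g *v x) (g *v y) = mink x y) \<and> det g > 0 \<and>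
                 (\<forall>x. mink x x < 0 \<and> x$4 > 0 \<longrightarrow> (g *v x)$4 > 0)}"

definition lorentz_equiv :: "(complex ^ 4) set \<Rightarrow> (complex ^ 4) set \<Rightarrow> bool"
    (infix \<open>\<sim>\<^sub>L\<close> 50) where
  "p \<sim>\<^sub>L q \<longleftrightarrow> (\<exists>g\<in>SO_plus. (\<lambda>z. of_real_mat g *v z) ` p = q)"

text \<open>\<open>None\<close> is the point at infinity.\<close>

type_synonym sphere = "complex option"

definition cnj_sphere :: "sphere \<Rightarrow> sphere" where
  "cnj_sphere = map_option cnj"

fun Psi_inv :: "sphere \<times> sphere \<Rightarrow> (complex ^ 4) set" where
  "Psi_inv (Some w1, Some w2) = pt (vector [w1 + w2, - \<i> * (w1 - w2), 1 - w1 * w2, 1 + w1 * w2])"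
| "Psi_inv (Some w1, None) = pt (vector [1, \<i>, - w1, w1])"
| "Psi_inv (None, Some w2) = pt (vector [1, - \<i>, - w2, w2])"
| "Psi_inv (None, None) = pt (vector [0, 0, -1, 1])"

text \<open>\<open>Psi_inv\<close> is a bijection onto \<open>Q11\<close>; the values of \<open>Psi\<close> outside \<open>Q11\<close> are irrelevant.\<close>

definition Psi :: "(complex ^ 4) set \<Rightarrow> sphere \<times> sphere" where
  "Psi = inv_into UNIV Psi_inv"

definition cross :: "sphere \<Rightarrow> sphere \<Rightarrow> (sphere \<times> sphere) set" where
  "cross c1 c2 = {(w1, w2). w1 = c1 \<or> w2 = c2}"

definition mat2 :: "complex \<Rightarrow> complex \<Rightarrow> complex \<Rightarrow> complex \<Rightarrow> complex ^ 2 ^ 2" where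
  "mat2 a b c d = vector [vector [a, b], vector [c, d]]"

definition SL2 :: "(complex ^ 2 ^ 2) set" where
  "SL2 = {S. det S = 1}"

text \<open>The quotient of two complex numbers, not both zero, as a point of the sphere.\<close>

definition ratio :: "complex \<Rightarrow> complex \<Rightarrow> sphere" where
  "ratio x y = (if y = 0 then None else Some (x / y))"

fun moebius :: "complex ^ 2 ^ 2 \<Rightarrow> sphere \<Rightarrow> sphere" where
  "moebius S (Some w) = ratio (S$1$1 * w + S$1$2) (S$2$1 * w + S$2$2)"
| "moebius S None = ratio (S$1$1) (S$2$1)"

definition graph_of_moebius :: "complex ^ 2 ^ 2 \<Rightarrow> (sphere \<times> sphere) set" where
  "graph_of_moebius S = {(w, moebius S w) | w. True}"

definition conj_similar :: "complex ^ 2 ^ 2 \<Rightarrow> complex ^ 2 ^ 2 \<Rightarrow> bool"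
    (infix \<open>\<sim>\<^sub>c\<close> 50) where
  "S1 \<sim>\<^sub>c S2 \<longleftrightarrow> (\<exists>T\<in>SL2. S2 = cnj_mat T ** S1 ** matrix_inv T \<or>
                                S2 = - (cnj_mat T ** S1 ** matrix_inv T))"

definition conj_eigenvector :: "complex ^ 2 ^ 2 \<Rightarrow> complex ^ 2 \<Rightarrow> bool" where
  "conj_eigenvector S v \<longleftrightarrow> v \<noteq> 0 \<and> (\<exists>r::real. r \<ge> 0 \<and> S *v v = of_real r *s cnj_vec v)"

definition conj_eigenratios :: "complex ^ 2 ^ 2 \<Rightarrow> sphere set" where
  "conj_eigenratios S = {ratio (v$1) (v$2) | v. conj_eigenvector S v}"

text \<open>The two standard parametrizations of the Riemann sphere: near a finite point by \<open>z\<close>,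
  near infinity by \<open>1/z\<close>.\<close>

definition sphere_params :: "(complex \<Rightarrow> sphere) set" where
  "sphere_params = {Some, \<lambda>z. if z = 0 then None else Some (1 / z)}"

text \<open>Holomorphic functions of several variables: Frechet differentiable with complex linear
  derivative.\<close>

definition holomorphic_several :: "(complex ^ 'n \<Rightarrow> complex) \<Rightarrow> (complex ^ 'n) set \<Rightarrow> bool" where
  "holomorphic_several f U \<longleftrightarrow>
     (\<forall>z\<in>U. \<exists>D. (f has_derivative D) (at z) \<and> (\<forall>c v. D (c *s v) = c * D v))"

text \<open>A map from a subset \<open>D\<close> of the sphere (necessarily open, by this definition) to
  \<open>\<complex>\<P>\<^sup>3\<close> is holomorphic if it locally has a holomorphic lift to \<open>\<complex>\<^sup>4 - {0}\<close>.\<close>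

definition holomorphic_to_CP3 :: "(sphere \<Rightarrow> (complex ^ 4) set) \<Rightarrow> sphere set \<Rightarrow> bool" where
  "holomorphic_to_CP3 F D \<longleftrightarrow>
     (\<forall>p\<in>D. \<exists>\<psi>\<in>sphere_params. \<exists>V h. open V \<and> p \<in> \<psi> ` V \<and> \<psi> ` V \<subseteq> D \<and>
        (\<forall>i. (\<lambda>x. h x $ i) holomorphic_on V) \<and>
        (\<forall>x\<in>V. h x \<noteq> (0 :: complex ^ 4) \<and> F (\<psi> x) = pt (h x)))"

text \<open>A map \<open>G\<close> from a complex submanifold \<open>H\<close> of \<open>\<complex>\<P>\<^sup>3\<close> to the sphere is holomorphic if, in
  homogeneous coordinates and in a chart of the sphere, it is locally the restriction of a
  holomorphic function on the ambient space.\<close>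

definition holomorphic_from_CP3 ::
    "((complex ^ 4) set \<Rightarrow> sphere) \<Rightarrow> (complex ^ 4) set set \<Rightarrow> bool" where
  "holomorphic_from_CP3 G H \<longleftrightarrow>
     (\<forall>z. z \<noteq> 0 \<and> pt z \<in> H \<longrightarrow>
        (\<exists>\<psi>\<in>sphere_params. \<exists>U f. open U \<and> z \<in> U \<and> holomorphic_several f U \<and>
           (\<forall>z'\<in>U. z' \<noteq> 0 \<and> pt z' \<in> H \<longrightarrow> G (pt z') = \<psi> (f z'))))"

text \<open>The curve \<open>H\<close> in \<open>\<complex>\<P>\<^sup>3\<close>, with the conformal structure inherited from the ambient complex
  structure, is conformally equivalent (biholomorphic) to the open subset \<open>D\<close> of the sphere.\<close>

definition conformally_equivalent :: "(complex ^ 4) set set \<Rightarrow> sphere set \<Rightarrow> bool" where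
  "conformally_equivalent H D \<longleftrightarrow>
     (\<exists>F. bij_betw F D H \<and> holomorphic_to_CP3 F D \<and> holomorphic_from_CP3 (inv_into D F) H)"

text \<open>Each class is given by the first condition listed for it in the classification. The points
  \<open>c1\<close>, \<open>c2\<close> are determined by the cross; \<open>S\<close> is determined by the graph up to sign, and
  \<open>conj_eigenratios (- S) = conj_eigenratios S\<close>.\<close>

datatype hyperplane_class =
  Cross_Positive | Cross_Nonpositive | Graph_Infinite | Graph_Two | Graph_Empty | Graph_One

fun in_class :: "complex ^ 4 \<Rightarrow> hyperplane_class \<Rightarrow> bool" where
  "in_class A Cross_Positive \<longleftrightarrow> pt A \<in> Q11 \<and> pt A \<in> Q11_plus \<and>
     (\<exists>c1 c2. Psi ` hyperplane A = cross c1 c2 \<and> c2 \<noteq> cnj_sphere c1)"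
| "in_class A Cross_Nonpositive \<longleftrightarrow> pt A \<in> Q11 \<and> pt A \<notin> Q11_plus \<and>
     (\<exists>c1 c2. Psi ` hyperplane A = cross c1 c2 \<and> c2 = cnj_sphere c1)"
| "in_class A Graph_Infinite \<longleftrightarrow> pt A \<notin> Q11 \<and>
     (\<exists>S\<in>SL2. Psi ` hyperplane A = graph_of_moebius S \<and> infinite (conj_eigenratios S))"
| "in_class A Graph_Two \<longleftrightarrow> pt A \<notin> Q11 \<and>
     (\<exists>S\<in>SL2. Psi ` hyperplane A = graph_of_moebius S \<and> card (conj_eigenratios S) = 2)"
| "in_class A Graph_Empty \<longleftrightarrow> pt A \<notin> Q11 \<and>
     (\<exists>S\<in>SL2. Psi ` hyperplane A = graph_of_moebius S \<and> conj_eigenratios S = {})"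
| "in_class A Graph_One \<longleftrightarrow> pt A \<notin> Q11 \<and>
     (\<exists>S\<in>SL2. Psi ` hyperplane A = graph_of_moebius S \<and> card (conj_eigenratios S) = 1)"

end

theory Submission
  imports Defs
begin

text \<open>
  A vector \<open>z\<close> of \<open>\<complex>\<^sup>4\<close> corresponds to a complex two-by-two matrix whose determinant is
  \<open>- \<langle>z, z\<rangle>\<close>; the rank one matrices are the points of the quadric, and \<open>\<langle>A, z\<rangle> = 0\<close> becomes
  \<open>w2 = M\<^sub>S w1\<close>, where \<open>S\<close> depends linearly on \<open>A\<close> and is invertible exactly off the quadric.
  The group \<open>SL(2,\<complex>)\<close> acts on \<open>A\<close> by restricted Lorentz transformations and on \<open>S\<close> by conjugate
  similarity. So it suffices to find normal forms of \<open>S\<close>: a conjugate eigenvector makes \<open>S\<close> triangular,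
  and if there is none then an eigenvector of \<open>cnj S ** S\<close> makes it antidiagonal. That every element
  of \<open>SO\<^sup>+(3,1)\<close> comes from \<open>SL(2,\<complex>)\<close> is never needed, because the normal forms are told apart by
  quantities which are invariant under all of \<open>SO\<^sup>+(3,1)\<close>.
\<close>

section \<open>Two-by-two matrices, conjugate similarity and Moebius maps\<close>

text \<open>\<open>conj_eigenratios S\<close> is the fixed point set of the antiholomorphic map p ->
  cnj (M_S p): a phase put into the vector turns any complex factor into a real r >= 0. Since
  \<open>Psi\<close> takes the positive part of the quadric to w2 \<noteq> cnj w1, the coordinate w1
  identifies H_A^+ with the complement of this fixed point set. One set thus governs both the case
  distinction and the conformal type, and both can be read off from the normal form. The separating
  invariant \<open>kappa\<close> is cosh 2u on the hyperbolic and cos 2\<alpha> on the elliptic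
  normal forms, which recovers the parameters. It is 1 on both (1,0,0,0) and (1,0,i,i); these two
  are kept apart by the degenerate real plane of the second. That SL(2,C) lands in SO^+(3,1) is
  usually a connectedness argument. Here orientation comes from every matrix being a square up to
  sign, and time orientation from future time-like vectors being the positive definite Hermitian
  matrices.\<close>

no_notation fps_nth (infixl "$" 75)

lemma vec4_eqI:
  fixes v w :: "'a ^ 4"
  assumes "v$1 = w$1" "v$2 = w$2" "v$3 = w$3" "v$4 = w$4"
  shows "v = w"
  using assms by (simp add: vec_eq_iff forall_4)

lemma mat2_nth [simp]:
  "mat2 a b c d $ 1 $ 1 = a" "mat2 a b c d $ 1 $ 2 = b"
  "mat2 a b c d $ 2 $ 1 = c" "mat2 a b c d $ 2 $ 2 = d"
  by (simp_all add: mat2_def)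

lemma mat2_eta: "S = mat2 (S$1$1) (S$1$2) (S$2$1) (S$2$2)"
  by (simp add: vec_eq_iff forall_2)

lemma mat2_eq_iff [simp]: "mat2 a b c d = mat2 a' b' c' d' \<longleftrightarrow> a = a' \<and> b = b' \<and> c = c' \<and> d = d'"
  by (metis mat2_nth)

lemma mat2_mult: "mat2 a b c d ** mat2 a' b' c' d' =
    mat2 (a*a' + b*c') (a*b' + b*d') (c*a' + d*c') (c*b' + d*d')"
  by (simp add: vec_eq_iff forall_2 matrix_matrix_mult_def sum_2)

lemma mat2_uminus: "- mat2 a b c d = mat2 (-a) (-b) (-c) (-d)"
  by (simp add: vec_eq_iff forall_2)

lemma mat2_one: "mat 1 = mat2 1 0 0 1"
  by (simp add: vec_eq_iff forall_2 mat_def)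

lemma cnj_mat2: "cnj_mat (mat2 a b c d) = mat2 (cnj a) (cnj b) (cnj c) (cnj d)"
  by (simp add: vec_eq_iff forall_2 cnj_mat_def)

lemma det_mat2: "det (mat2 a b c d) = a * d - b * c"
  by (simp add: det_2)

lemma mat2_mulv: "mat2 a b c d *v v = vector [a * v$1 + b * v$2, c * v$1 + d * v$2]"
  by (simp add: vec_eq_iff forall_2 matrix_vector_mult_def sum_2)

lemma mat2_in_SL2: "mat2 a b c d \<in> SL2 \<longleftrightarrow> a * d - b * c = 1"
  by (simp add: SL2_def det_mat2)

lemma SL2_cases:
  assumes "S \<in> SL2"
  obtains a b c d where "S = mat2 a b c d" "a * d - b * c = 1"
  by (metis assms mat2_eta mat2_in_SL2)

text \<open>\<open>matrix_inv\<close> is a choice, so its value is pinned down only after a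
  two-sided inverse has been exhibited; for square matrices over a field one side gives the
  other.\<close>

lemma matrix_inv_eq:
  fixes A :: "'a::field ^ 'n ^ 'n"
  assumes "A ** B = mat 1"
  shows "matrix_inv A = B"
proof -
  have "B ** A = mat 1" using assms matrix_left_right_inverse by blast
  then have "\<exists>A'. A ** A' = mat 1 \<and> A' ** A = mat 1" using assms by blast
  then have "matrix_inv A ** A = mat 1"
    unfolding matrix_inv_def by (rule someI2_ex) blast
  then show ?thesis
    by (metis assms matrix_mul_assoc matrix_mul_lid matrix_mul_rid)
qed

lemma matrix_inv_mat2:
  assumes "a * d - b * c = 1"
  shows "matrix_inv (mat2 a b c d) = mat2 d (-b) (-c) a"
  using assms by (intro matrix_inv_eq) (simp add: mat2_mult mat2_one algebra_simps)

lemma SL2_mult: "S \<in> SL2 \<Longrightarrow> T \<in> SL2 \<Longrightarrow> S ** T \<in> SL2"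
  by (simp add: SL2_def det_mul)

lemma SL2_inv:
  assumes "T \<in> SL2"
  shows "matrix_inv T \<in> SL2" "T ** matrix_inv T = mat 1" "matrix_inv T ** T = mat 1"
proof -
  obtain a b c d where T: "T = mat2 a b c d" "a * d - b * c = 1"
    using assms by (rule SL2_cases)
  show "matrix_inv T \<in> SL2" "T ** matrix_inv T = mat 1" "matrix_inv T ** T = mat 1"
    using T(2) unfolding T(1) matrix_inv_mat2[OF T(2)] mat2_in_SL2 mat2_mult mat2_one
    by (simp_all add: algebra_simps)
qed

lemma SL2_cnj: "T \<in> SL2 \<Longrightarrow> cnj_mat T \<in> SL2"
  by (auto elim!: SL2_cases simp: cnj_mat2 mat2_in_SL2 simp flip: complex_cnj_mult complex_cnj_diff)

lemma SL2_one: "mat 1 \<in> SL2"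
  by (simp add: SL2_def)

lemma SL2_uminus: "S \<in> SL2 \<Longrightarrow> - S \<in> SL2"
  by (auto elim!: SL2_cases simp: mat2_uminus mat2_in_SL2)

lemma cnj_mat_mult: "cnj_mat (A ** B) = cnj_mat A ** cnj_mat B"
  by (simp add: vec_eq_iff cnj_mat_def matrix_matrix_mult_def)

lemma cnj_mat_one: "cnj_mat (mat 1) = mat 1"
  by (simp add: vec_eq_iff cnj_mat_def mat_def)

lemma mult_uminus_mat:
  fixes A :: "complex ^ 'n ^ 'n"
  shows "A ** (- B) = - (A ** B)" "(- A) ** B = - (A ** B)"
  by (simp_all add: vec_eq_iff matrix_matrix_mult_def sum_negf)

lemma conj_similarI:
  assumes "T \<in> SL2" "S' = cnj_mat T ** S ** matrix_inv T \<or> S' = - (cnj_mat T ** S ** matrix_inv T)"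
  shows "S \<sim>\<^sub>c S'"
  using assms unfolding conj_similar_def by blast

lemma conj_similar_refl: "S \<sim>\<^sub>c S"
proof -
  have "matrix_inv (mat 1 :: complex^2^2) = mat 1" by (simp add: matrix_inv_eq)
  then show ?thesis by (intro conj_similarI[OF SL2_one]) (simp add: cnj_mat_one)
qed

lemma conj_similar_sym:
  assumes "S \<sim>\<^sub>c S'"
  shows "S' \<sim>\<^sub>c S"
proof -
  obtain T where T: "T \<in> SL2" "S' = cnj_mat T ** S ** matrix_inv T \<or> S' = - (cnj_mat T ** S ** matrix_inv T)"
    using assms unfolding conj_similar_def by blast
  have inv: "matrix_inv (matrix_inv T) = T"
    by (simp add: matrix_inv_eq SL2_inv(3)[OF T(1)])
  have c: "cnj_mat (matrix_inv T) ** cnj_mat T = mat 1"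
    by (simp add: SL2_inv(3)[OF T(1)] cnj_mat_one flip: cnj_mat_mult)
  have "cnj_mat (matrix_inv T) ** (cnj_mat T ** S ** matrix_inv T) ** T
      = (cnj_mat (matrix_inv T) ** cnj_mat T) ** S ** (matrix_inv T ** T)"
    by (simp only: matrix_mul_assoc)
  also have "\<dots> = S" by (simp add: c SL2_inv(3)[OF T(1)])
  finally show ?thesis using T(2)
    by (intro conj_similarI[OF SL2_inv(1)[OF T(1)]]) (auto simp: inv mult_uminus_mat)
qed

lemma conj_similar_trans:
  assumes "S1 \<sim>\<^sub>c S2" "S2 \<sim>\<^sub>c S3"
  shows "S1 \<sim>\<^sub>c S3"
proof -
  obtain T where T: "T \<in> SL2" "S2 = cnj_mat T ** S1 ** matrix_inv T \<or> S2 = - (cnj_mat T ** S1 ** matrix_inv T)"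
    using assms(1) unfolding conj_similar_def by blast
  obtain U where U: "U \<in> SL2" "S3 = cnj_mat U ** S2 ** matrix_inv U \<or> S3 = - (cnj_mat U ** S2 ** matrix_inv U)"
    using assms(2) unfolding conj_similar_def by blast
  have "(U ** T) ** (matrix_inv T ** matrix_inv U) = U ** (T ** matrix_inv T) ** matrix_inv U"
    by (simp only: matrix_mul_assoc)
  then have inv: "matrix_inv (U ** T) = matrix_inv T ** matrix_inv U"
    by (intro matrix_inv_eq) (simp add: SL2_inv T U)
  have "cnj_mat (U ** T) ** S1 ** matrix_inv (U ** T)
      = cnj_mat U ** (cnj_mat T ** S1 ** matrix_inv T) ** matrix_inv U"
    by (simp only: inv cnj_mat_mult matrix_mul_assoc)
  then show ?thesis using T(2) U(2)
    by (intro conj_similarI[OF SL2_mult[OF U(1) T(1)]]) (auto simp: mult_uminus_mat)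
qed

lemma conj_similar_SL2:
  assumes "S \<sim>\<^sub>c S'" "S \<in> SL2"
  shows "S' \<in> SL2"
  using assms unfolding conj_similar_def
  by (auto intro!: SL2_mult SL2_cnj SL2_inv SL2_uminus)

lemma conj_similar_uminus: "S \<sim>\<^sub>c - S"
  using conj_similar_refl[of "- S"] unfolding conj_similar_def
  by (auto simp: mult_uminus_mat)

text \<open>Reduces similarity to an identity between entries, once T = \<open>mat2 x y z w\<close>
  is named. Explicit instantiations list its entries in the order x, w, y, z.\<close>

lemma conj_similar_mat2I:
  assumes "x * w - y * z = 1"
    "mat2 a' b' c' d' = mat2 (cnj x) (cnj y) (cnj z) (cnj w) ** mat2 a b c d ** mat2 w (-y) (-z) x \<or>
     mat2 a' b' c' d' = - (mat2 (cnj x) (cnj y) (cnj z) (cnj w) ** mat2 a b c d ** mat2 w (-y) (-z) x)"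
  shows "mat2 a b c d \<sim>\<^sub>c mat2 a' b' c' d'"
  using assms by (intro conj_similarI[of "mat2 x y z w"]) (auto simp: mat2_in_SL2 cnj_mat2 matrix_inv_mat2)

section \<open>Moebius maps in homogeneous coordinates, where infinity is no special case\<close>

lemma sphere_cases:
  obtains x y where "p = ratio x y" "x \<noteq> 0 \<or> y \<noteq> 0"
proof (cases p)
  case None
  then show ?thesis using that[of 1 0] by (simp add: ratio_def)
next
  case (Some w)
  then show ?thesis using that[of w 1] by (simp add: ratio_def)
qed

lemma ratio_eq_iff:
  assumes "x \<noteq> 0 \<or> y \<noteq> 0" "x' \<noteq> 0 \<or> y' \<noteq> 0"
  shows "ratio x y = ratio x' y' \<longleftrightarrow> x * y' = x' * y"
  using assms by (auto simp: ratio_def frac_eq_eq)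

lemma ratio_scale: "k \<noteq> 0 \<Longrightarrow> ratio (k * x) (k * y) = ratio x y"
  by (simp add: ratio_def)

lemma moebius_ratio:
  assumes "x \<noteq> 0 \<or> y \<noteq> 0"
  shows "moebius (mat2 a b c d) (ratio x y) = ratio (a * x + b * y) (c * x + d * y)"
proof (cases "y = 0")
  case True
  with assms show ?thesis using ratio_scale[of x a c] by (simp add: ratio_def mult.commute)
next
  case False
  then have "a * x + b * y = y * (a * (x/y) + b)" "c * x + d * y = y * (c * (x/y) + d)"
    by (simp_all add: distrib_left)
  then show ?thesis using False ratio_scale[of y] by (simp add: ratio_def)
qed

text \<open>Multiplication by the adjugate matrix. It is what keeps the image of a pair of
  homogeneous coordinates a legitimate pair.\<close>

lemma mat2_kernel:
  fixes x y :: complex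
  assumes "a * d - b * c \<noteq> 0" "x \<noteq> 0 \<or> y \<noteq> 0"
  shows "a * x + b * y \<noteq> 0 \<or> c * x + d * y \<noteq> 0"
proof (rule ccontr)
  assume "\<not> ?thesis"
  then have e: "a * x + b * y = 0" "c * x + d * y = 0" by auto
  have "(a * d - b * c) * x = d * (a * x + b * y) - b * (c * x + d * y)"
       "(a * d - b * c) * y = a * (c * x + d * y) - c * (a * x + b * y)" by algebra+
  with e assms show False by auto
qed

lemma cnj_sphere_ratio: "cnj_sphere (ratio x y) = ratio (cnj x) (cnj y)"
  by (simp add: cnj_sphere_def ratio_def)

lemma moebius_mult:
  assumes "T \<in> SL2"
  shows "moebius (S ** T) p = moebius S (moebius T p)"
proof -
  obtain a b c d where T: "T = mat2 a b c d" "a * d - b * c = 1" using assms by (rule SL2_cases)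
  obtain a' b' c' d' where S: "S = mat2 a' b' c' d'" by (metis mat2_eta)
  obtain x y where p: "p = ratio x y" "x \<noteq> 0 \<or> y \<noteq> 0" by (rule sphere_cases)
  have "a * x + b * y \<noteq> 0 \<or> c * x + d * y \<noteq> 0" using T(2) p(2) by (intro mat2_kernel) auto
  then show ?thesis using p(2)
    by (simp add: p(1) T(1) S mat2_mult moebius_ratio algebra_simps)
qed

lemma moebius_cnj: "cnj_sphere (moebius T p) = moebius (cnj_mat T) (cnj_sphere p)"
proof -
  obtain a b c d where T: "T = mat2 a b c d" by (metis mat2_eta)
  obtain x y where p: "p = ratio x y" "x \<noteq> 0 \<or> y \<noteq> 0" by (rule sphere_cases)
  then show ?thesis by (simp add: T cnj_mat2 cnj_sphere_ratio moebius_ratio)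
qed

lemma moebius_scale:
  assumes "k \<noteq> 0"
  shows "moebius (mat2 (k * a) (k * b) (k * c) (k * d)) p = moebius (mat2 a b c d) p"
proof -
  obtain x y where p: "p = ratio x y" "x \<noteq> 0 \<or> y \<noteq> 0" by (rule sphere_cases)
  show ?thesis using p(2) ratio_scale[OF assms, of "a * x + b * y" "c * x + d * y"]
    by (simp add: p(1) moebius_ratio algebra_simps)
qed

lemma moebius_uminus: "moebius (- S) p = moebius S p"
  using moebius_scale[of "-1" "S$1$1" "S$1$2" "S$2$1" "S$2$2" p]
  by (metis mat2_eta mat2_uminus mult_minus1 zero_neq_neg_one)

lemma moebius_one: "moebius (mat 1) p = p"
  by (cases p) (simp_all add: mat2_one ratio_def)

lemma moebius_inv:
  assumes "T \<in> SL2"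
  shows "moebius (matrix_inv T) (moebius T p) = p" "moebius T (moebius (matrix_inv T) p) = p"
  by (metis SL2_inv assms moebius_mult moebius_one)+

lemma bij_moebius: "T \<in> SL2 \<Longrightarrow> bij (moebius T)"
  by (rule bij_betw_byWitness[where f' = "moebius (matrix_inv T)"]) (auto simp: moebius_inv)

lemma moebius_inj:
  assumes S: "S \<in> SL2" "S' \<in> SL2" and eqm: "\<And>p. moebius S p = moebius S' p"
  shows "S' = S \<or> S' = - S"
proof -
  define R where "R = matrix_inv S ** S'"
  obtain a b c d where R: "R = mat2 a b c d" "a * d - b * c = 1"
    using S unfolding R_def by (meson SL2_cases SL2_inv(1) SL2_mult)
  have fixed: "moebius R p = p" for p
    unfolding R_def by (simp add: moebius_mult S moebius_inv flip: eqm)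
  \<comment> \<open>The fixed points infinity, 0 and 1 give c = 0, b = 0 and a = d in turn; the
    determinant then leaves only 1 and -1.\<close>
  have "c = 0" using fixed[of None] by (auto simp: R(1) ratio_def split: if_splits)
  moreover have "b = 0" using fixed[of "Some 0"] by (auto simp: R(1) ratio_def split: if_splits)
  moreover have "a = d" using fixed[of "Some 1"] calculation by (auto simp: R(1) ratio_def split: if_splits)
  ultimately have "R = mat 1 \<or> R = - mat 1"
    using R(2) by (auto simp: R(1) mat2_one mat2_uminus square_eq_1_iff)
  moreover have "S' = S ** R" by (simp add: R_def matrix_mul_assoc SL2_inv S)
  ultimately show ?thesis by (auto simp: mult_uminus_mat)
qed

text \<open>A fixed point of p -> cnj (M_S p) gives S v = k cnj v with k complex. Replacing v by s v
  multiplies k by s / cnj s, an arbitrary phase, so k can be made real and nonnegative.\<close>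

lemma conj_eigenratios_eq:
  assumes "S \<in> SL2"
  shows "conj_eigenratios S = {p. moebius S p = cnj_sphere p}"
proof -
  obtain a b c d where S: "S = mat2 a b c d" "a * d - b * c = 1" using assms by (rule SL2_cases)
  have "p \<in> conj_eigenratios S \<longleftrightarrow> moebius S p = cnj_sphere p" for p
  proof
    assume "p \<in> conj_eigenratios S"
    then obtain v r where v: "v \<noteq> 0" "S *v v = of_real r *s cnj_vec v" and p: "p = ratio (v$1) (v$2)"
      unfolding conj_eigenratios_def conj_eigenvector_def by auto
    have nz: "v$1 \<noteq> 0 \<or> v$2 \<noteq> 0" using v(1) by (simp add: vec_eq_iff forall_2)
    have e: "a * v$1 + b * v$2 = of_real r * cnj (v$1)" "c * v$1 + d * v$2 = of_real r * cnj (v$2)"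
      using v(2) by (simp_all add: S(1) mat2_mulv vec_eq_iff forall_2 cnj_vec_def)
    \<comment> \<open>The definition of a conjugate eigenvector admits r = 0; invertibility of S
      excludes it.\<close>
    have "r \<noteq> 0" using mat2_kernel[of a d b c, OF _ nz] S(2) e by auto
    then show "moebius S p = cnj_sphere p"
      using nz e ratio_scale[of "of_real r" "cnj (v$1)" "cnj (v$2)"]
      by (simp add: p S(1) moebius_ratio cnj_sphere_ratio)
  next
    assume eq: "moebius S p = cnj_sphere p"
    obtain x y where p: "p = ratio x y" "x \<noteq> 0 \<or> y \<noteq> 0" by (rule sphere_cases)
    have nz: "a * x + b * y \<noteq> 0 \<or> c * x + d * y \<noteq> 0" using S(2) p(2) by (intro mat2_kernel) auto
    have cr: "(a * x + b * y) * cnj y = cnj x * (c * x + d * y)"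
      using eq p nz by (simp add: S(1) moebius_ratio cnj_sphere_ratio ratio_eq_iff)
    obtain k where k: "a * x + b * y = k * cnj x" "c * x + d * y = k * cnj y"
    proof (cases "x = 0")
      case True
      then show ?thesis using that[of "(c * x + d * y) / cnj y"] p(2) cr by (auto simp: field_simps)
    next
      case False
      then show ?thesis using that[of "(a * x + b * y) / cnj x"] p(2) cr by (auto simp: field_simps)
    qed
    \<comment> \<open>Half the argument, because s enters both as s and as cnj s: s k and |k| cnj s
      both have argument Arg k / 2.\<close>
    define s where "s = exp (- (\<i> * of_real (Arg k) / 2))"
    have s: "s \<noteq> 0" "s * k = of_real (norm k) * cnj s"
    proof -
      show "s \<noteq> 0" by (simp add: s_def)
      have "cnj s = exp (\<i> * of_real (Arg k) / 2)" by (simp add: s_def exp_cnj)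
      moreover have "k = of_real (norm k) * exp (\<i> * of_real (Arg k))"
        by (metis Arg_eq Arg_zero mult_zero_left norm_zero of_real_0)
      moreover have "s * exp (\<i> * of_real (Arg k)) = exp (\<i> * of_real (Arg k) / 2)"
        unfolding s_def exp_add[symmetric] by (rule arg_cong[of _ _ exp]) (simp add: field_simps)
      ultimately show "s * k = of_real (norm k) * cnj s"
        by (metis mult.left_commute)
    qed
    define v where "v = (vector [s * x, s * y] :: complex ^ 2)"
    have "a * (s * x) + b * (s * y) = (s * k) * cnj x" "c * (s * x) + d * (s * y) = (s * k) * cnj y"
      using k by (simp_all add: mult.assoc distrib_left mult.left_commute flip: k)
    then have "a * (s * x) + b * (s * y) = of_real (norm k) * cnj (s * x)"
      "c * (s * x) + d * (s * y) = of_real (norm k) * cnj (s * y)"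
      by (simp_all add: s(2) mult.assoc)
    then have "conj_eigenvector S v"
      unfolding conj_eigenvector_def using s(1) p(2)
      by (intro conjI exI[of _ "norm k"])
        (auto simp: v_def S(1) mat2_mulv vec_eq_iff forall_2 cnj_vec_def)
    then show "p \<in> conj_eigenratios S"
      unfolding conj_eigenratios_def using p(1) ratio_scale[OF s(1), of x y]
      by (auto simp: v_def intro!: exI[of _ v])
  qed
  then show ?thesis by blast
qed

text \<open>S' after T is cnj T after S, and conjugation after T is cnj T after conjugation. The
  conjugate on the left factor of the similarity is exactly what makes these two match.\<close>

lemma moebius_conj_similar:
  assumes "T \<in> SL2" "S' = cnj_mat T ** S ** matrix_inv T \<or> S' = - (cnj_mat T ** S ** matrix_inv T)" "S \<in> SL2"
  shows "moebius S' (moebius T p) = cnj_sphere (moebius T q) \<longleftrightarrow> moebius S p = cnj_sphere q"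
proof -
  have "moebius S' (moebius T p) = moebius (cnj_mat T) (moebius S p)"
    using assms by (auto simp: moebius_uminus moebius_mult SL2_mult SL2_inv SL2_cnj moebius_inv)
  then show ?thesis
    using bij_moebius[OF SL2_cnj[OF assms(1)]] by (auto simp: moebius_cnj bij_def inj_eq)
qed

text \<open>The Moebius map of T carries one fixed point set onto the other, so finiteness and
  cardinality can be computed on normal forms.\<close>

lemma conj_eigenratios_conj_similar:
  assumes "S \<sim>\<^sub>c S'" "S \<in> SL2"
  obtains f where "bij_betw f (conj_eigenratios S) (conj_eigenratios S')"
proof -
  obtain T where T: "T \<in> SL2" "S' = cnj_mat T ** S ** matrix_inv T \<or> S' = - (cnj_mat T ** S ** matrix_inv T)"
    using assms(1) unfolding conj_similar_def by blast
  have "moebius T ` conj_eigenratios S = conj_eigenratios S'"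
    unfolding conj_eigenratios_eq[OF assms(2)] conj_eigenratios_eq[OF conj_similar_SL2[OF assms]]
  proof (intro set_eqI iffI)
    fix q assume "q \<in> {p. moebius S' p = cnj_sphere p}"
    then show "q \<in> moebius T ` {p. moebius S p = cnj_sphere p}"
      using moebius_conj_similar[OF T assms(2), of "moebius (matrix_inv T) q" "moebius (matrix_inv T) q"]
      by (intro image_eqI[of _ _ "moebius (matrix_inv T) q"]) (auto simp: moebius_inv[OF T(1)])
  qed (auto simp: moebius_conj_similar[OF T assms(2)])
  then show ?thesis
    using that bij_moebius[OF T(1)] by (metis bij_betw_def bij_def inj_on_subset subset_UNIV)
qed

section \<open>The quadric and the hyperplanes in homogeneous coordinates\<close>

lemma vector_4 [simp]:
  "(vector [w, x, y, z] :: 'a::zero ^ 4) $ 1 = w"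
  "(vector [w, x, y, z] :: 'a::zero ^ 4) $ 2 = x"
  "(vector [w, x, y, z] :: 'a::zero ^ 4) $ 3 = y"
  "(vector [w, x, y, z] :: 'a::zero ^ 4) $ 4 = z"
  unfolding vector_def by simp_all

lemma pt_mem: "z \<in> pt z"
  unfolding pt_def by (auto intro!: exI[of _ 1])

lemma pt_scale: "c \<noteq> 0 \<Longrightarrow> pt (c *s z) = pt z"
proof -
  assume c: "c \<noteq> 0"
  have "\<exists>d. e *s z = d *s (c *s z) \<and> d \<noteq> 0" if "e \<noteq> 0" for e
    using that c by (intro exI[of _ "e / c"]) (simp add: vector_smult_assoc)
  then show ?thesis using c unfolding pt_def by (auto simp: vector_smult_assoc)
qed

lemma pt_eqE:
  assumes "pt z = pt w"
  obtains c where "c \<noteq> 0" "z = c *s w"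
  using assms pt_mem[of z] unfolding pt_def by auto

lemma mink_scale: "mink (c *s z) (d *s w) = c * d * mink z w"
  by (simp add: mink_def algebra_simps)

lemma mink_scale_left: "mink (c *s z) w = c * mink z w"
  by (simp add: mink_def algebra_simps)

lemma mink_scale_right: "mink z (c *s w) = c * mink z w"
  by (simp add: mink_def algebra_simps)

lemma cnj_vec_scale: "cnj_vec (c *s z) = cnj c *s cnj_vec z"
  by (simp add: cnj_vec_def vec_eq_iff)

lemma pt_in_Q11: "z \<noteq> 0 \<Longrightarrow> pt z \<in> Q11 \<longleftrightarrow> mink z z = 0"
  unfolding Q11_def by (auto elim!: pt_eqE simp: mink_scale)

lemma pt_in_Q11_plus:
  "z \<noteq> 0 \<Longrightarrow> pt z \<in> Q11_plus \<longleftrightarrow> mink z z = 0 \<and> Re (mink z (cnj_vec z)) > 0"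
proof -
  assume z: "z \<noteq> 0"
  have "Re (mink (c *s w) (cnj_vec (c *s w))) > 0 \<longleftrightarrow> Re (mink w (cnj_vec w)) > 0" if "c \<noteq> 0" for c and w :: "complex^4"
  proof -
    \<comment> \<open>The scalar enters as |c|^2, so the sign does not depend on the representative
      of the point.\<close>
    have "mink (c *s w) (cnj_vec (c *s w)) = of_real ((norm c)\<^sup>2) * mink w (cnj_vec w)"
      by (simp add: cnj_vec_scale mink_scale complex_norm_square del: of_real_power)
    then have "Re (mink (c *s w) (cnj_vec (c *s w))) = (norm c)\<^sup>2 * Re (mink w (cnj_vec w))"
      by (simp only: Re_complex_of_real Im_complex_of_real times_complex.sel)
    then show ?thesis using that by (simp add: zero_less_mult_iff)
  qed
  then show ?thesis using z unfolding Q11_plus_def by (auto elim!: pt_eqE simp: mink_scale)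
qed

lemma pt_in_hyperplane:
  "z \<noteq> 0 \<Longrightarrow> pt z \<in> hyperplane A \<longleftrightarrow> mink z z = 0 \<and> mink A z = 0"
  unfolding hyperplane_def by (auto elim!: pt_eqE simp: mink_scale mink_scale_left mink_scale_right)

text \<open>\<open>Psi_inv\<close> in homogeneous coordinates, with \<open>w1 = p1 / q1\<close> and \<open>w2 = p2 / q2\<close>.\<close>

definition segre :: "complex \<Rightarrow> complex \<Rightarrow> complex \<Rightarrow> complex \<Rightarrow> complex ^ 4" where
  "segre p1 q1 p2 q2 =
     vector [p1 * q2 + p2 * q1, - \<i> * (p1 * q2 - p2 * q1), q1 * q2 - p1 * p2, q1 * q2 + p1 * p2]"

lemma segre_nth [simp]:
  "segre p1 q1 p2 q2 $ 1 = p1 * q2 + p2 * q1"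
  "segre p1 q1 p2 q2 $ 2 = - \<i> * (p1 * q2 - p2 * q1)"
  "segre p1 q1 p2 q2 $ 3 = q1 * q2 - p1 * p2"
  "segre p1 q1 p2 q2 $ 4 = q1 * q2 + p1 * p2"
  by (simp_all add: segre_def)

text \<open>The null coordinates z1 + i z2, z1 - i z2, z3 + z4, z4 - z3 are, up to the factor 2, the
  four products of the Segre embedding; the quadratic form is their two-by-two determinant up to
  sign.\<close>

lemma segre_entries:
  fixes p1 q1 p2 q2 :: complex
  defines "z \<equiv> segre p1 q1 p2 q2"
  shows "z$1 + \<i> * z$2 = 2 * (p1 * q2)" "z$1 - \<i> * z$2 = 2 * (q1 * p2)"
    "z$3 + z$4 = 2 * (q1 * q2)" "z$4 - z$3 = 2 * (p1 * p2)"
  by (simp_all add: z_def algebra_simps)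

lemma segre_scale: "segre (k * p1) (k * q1) (l * p2) (l * q2) = (k * l) *s segre p1 q1 p2 q2"
  by (rule vec4_eqI) (simp_all add: algebra_simps)

lemma segre_nonzero:
  assumes "p1 \<noteq> 0 \<or> q1 \<noteq> 0" "p2 \<noteq> 0 \<or> q2 \<noteq> 0"
  shows "segre p1 q1 p2 q2 \<noteq> 0"
proof
  assume "segre p1 q1 p2 q2 = 0"
  then show False using segre_entries[of p1 q1 p2 q2] assms by auto
qed

lemma mink_segre_self: "mink (segre p1 q1 p2 q2) (segre p1 q1 p2 q2) = 0"
  by (simp add: mink_def algebra_simps)

text \<open>A squared norm, so this form is never negative on the quadric, and it vanishes exactly
  where w1 = cnj w2.\<close>

lemma mink_segre_cnj:
  "mink (segre p1 q1 p2 q2) (cnj_vec (segre p1 q1 p2 q2)) =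
     of_real (2 * (norm (p1 * cnj q2 - q1 * cnj p2))\<^sup>2)"
  unfolding of_real_mult complex_norm_square
  by (simp add: mink_def cnj_vec_def algebra_simps)

lemma Psi_inv_ratio:
  assumes "p1 \<noteq> 0 \<or> q1 \<noteq> 0" "p2 \<noteq> 0 \<or> q2 \<noteq> 0"
  shows "Psi_inv (ratio p1 q1, ratio p2 q2) = pt (segre p1 q1 p2 q2)"
proof -
  have eq: "pt (segre p1 q1 p2 q2) = pt (segre (k * p1) (k * q1) (l * p2) (l * q2))"
    if "k \<noteq> 0" "l \<noteq> 0" for k l using that by (simp add: segre_scale pt_scale)
  consider "q1 = 0" "q2 = 0" | "q1 = 0" "q2 \<noteq> 0" | "q1 \<noteq> 0" "q2 = 0" | "q1 \<noteq> 0" "q2 \<noteq> 0" by blast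
  then show ?thesis
  proof cases
    case 1
    then show ?thesis using assms eq[of "1/p1" "1/p2"] by (simp add: ratio_def) (simp add: segre_def)
  next
    case 2
    then show ?thesis using assms eq[of "1/p1" "1/q2"] by (simp add: ratio_def) (simp add: segre_def)
  next
    case 3
    then show ?thesis using assms eq[of "1/q1" "1/p2"] by (simp add: ratio_def) (simp add: segre_def)
  next
    case 4
    then show ?thesis using assms eq[of "1/q1" "1/q2"] by (simp add: ratio_def) (simp add: segre_def)
  qed
qed

lemma pair_proportional:
  fixes x y x' y' :: complex
  assumes "x \<noteq> 0 \<or> y \<noteq> 0" "x * y' = x' * y"
  obtains k where "x' = k * x" "y' = k * y"
proof (cases "x = 0")
  case True
  then show ?thesis using that[of "y' / y"] assms by auto
next
  case False
  then show ?thesis using that[of "x' / x"] assms by (simp add: field_simps)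
qed

text \<open>The point w1 is the ratio along either of two parallel lines of the rank one matrix. One
  of them degenerates to (0, 0) when q2 = 0, the other when p2 = 0, so both formulas are
  wanted.\<close>

lemma ratio_segre:
  assumes "p1 \<noteq> 0 \<or> q1 \<noteq> 0" "z = c *s segre p1 q1 p2 q2"
  shows "z$1 + \<i> * z$2 \<noteq> 0 \<or> z$3 + z$4 \<noteq> 0 \<Longrightarrow> ratio (z$1 + \<i> * z$2) (z$3 + z$4) = ratio p1 q1"
    and "z$4 - z$3 \<noteq> 0 \<or> z$1 - \<i> * z$2 \<noteq> 0 \<Longrightarrow> ratio (z$4 - z$3) (z$1 - \<i> * z$2) = ratio p1 q1"
proof -
  have "z$1 + \<i> * z$2 = (2 * c * q2) * p1" "z$3 + z$4 = (2 * c * q2) * q1"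
       "z$4 - z$3 = (2 * c * p2) * p1" "z$1 - \<i> * z$2 = (2 * c * p2) * q1"
    by (simp_all add: assms(2) algebra_simps)
  then show "z$1 + \<i> * z$2 \<noteq> 0 \<or> z$3 + z$4 \<noteq> 0 \<Longrightarrow> ratio (z$1 + \<i> * z$2) (z$3 + z$4) = ratio p1 q1"
    and "z$4 - z$3 \<noteq> 0 \<or> z$1 - \<i> * z$2 \<noteq> 0 \<Longrightarrow> ratio (z$4 - z$3) (z$1 - \<i> * z$2) = ratio p1 q1"
    by (auto simp: ratio_scale)
qed

lemma segre_inj:
  assumes nz: "p1 \<noteq> 0 \<or> q1 \<noteq> 0" "p2 \<noteq> 0 \<or> q2 \<noteq> 0" "p1' \<noteq> 0 \<or> q1' \<noteq> 0" "p2' \<noteq> 0 \<or> q2' \<noteq> 0"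
    and eq: "pt (segre p1 q1 p2 q2) = pt (segre p1' q1' p2' q2')"
  shows "ratio p1 q1 = ratio p1' q1' \<and> ratio p2 q2 = ratio p2' q2'"
proof -
  obtain c where "c \<noteq> 0" and c: "segre p1 q1 p2 q2 = c *s segre p1' q1' p2' q2'"
    using eq by (rule pt_eqE)
  have e: "p1 * q2 = c * (p1' * q2')" "q1 * p2 = c * (q1' * p2')"
    "q1 * q2 = c * (q1' * q2')" "p1 * p2 = c * (p1' * p2')"
    using segre_entries[of p1 q1 p2 q2] segre_entries[of p1' q1' p2' q2'] unfolding c
    by (auto simp: algebra_simps)
  \<comment> \<open>Cross multiplication eliminates c. In each pair of equations one of the two
    cofactors is nonzero, which leaves equality of ratios.\<close>
  have "(p1 * q1' - p1' * q1) * p2 = 0" "(p1 * q1' - p1' * q1) * q2 = 0"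
       "(p2 * q2' - p2' * q2) * p1 = 0" "(p2 * q2' - p2' * q2) * q1 = 0"
    using e by algebra+
  then show ?thesis using nz by (auto simp: ratio_eq_iff)
qed

lemma inj_Psi_inv: "inj Psi_inv"
proof (rule injI)
  fix x y assume eq: "Psi_inv x = Psi_inv y"
  obtain x1 x2 y1 y2 where xy: "x = (x1, x2)" "y = (y1, y2)" by (metis surj_pair)
  obtain a b where 1: "x1 = ratio a b" "a \<noteq> 0 \<or> b \<noteq> 0" by (rule sphere_cases)
  obtain a' b' where 2: "x2 = ratio a' b'" "a' \<noteq> 0 \<or> b' \<noteq> 0" by (rule sphere_cases)
  obtain c d where 3: "y1 = ratio c d" "c \<noteq> 0 \<or> d \<noteq> 0" by (rule sphere_cases)
  obtain c' d' where 4: "y2 = ratio c' d'" "c' \<noteq> 0 \<or> d' \<noteq> 0" by (rule sphere_cases)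
  show "x = y" using eq segre_inj[OF 1(2) 2(2) 3(2) 4(2)] 1 2 3 4 by (simp add: xy Psi_inv_ratio)
qed

text \<open>A singular two-by-two matrix is a product of a column and a row: (b, d) is a multiple k
  of (a, c) unless the latter vanishes. The halves in the witnesses cancel the factor 2 of
  \<open>segre_entries\<close>.\<close>

lemma Q11_segre:
  assumes "z \<noteq> 0" "mink z z = 0"
  obtains p1 q1 p2 q2 where "p1 \<noteq> 0 \<or> q1 \<noteq> 0" "p2 \<noteq> 0 \<or> q2 \<noteq> 0" "z = segre p1 q1 p2 q2"
proof -
  define a b c d where n: "a = z$4 - z$3" "b = z$1 + \<i> * z$2" "c = z$1 - \<i> * z$2" "d = z$3 + z$4"
  have z: "z$1 = (b + c) / 2" "z$2 = - \<i> * (b - c) / 2" "z$3 = (d - a) / 2" "z$4 = (a + d) / 2"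
    by (simp_all add: n field_simps)
  have det: "a * d = b * c" using assms(2) by (simp add: mink_def n algebra_simps)
  show ?thesis
  proof (cases "a = 0 \<and> c = 0")
    case True
    have nz: "b \<noteq> 0 \<or> d \<noteq> 0"
    proof (rule ccontr)
      assume "\<not> (b \<noteq> 0 \<or> d \<noteq> 0)"
      then have "z = 0" by (intro vec4_eqI) (simp_all add: z True)
      then show False using assms(1) by simp
    qed
    have "z = segre b d 0 (1/2)" by (rule vec4_eqI) (simp_all add: z True)
    then show ?thesis using that[of b d 0 "1/2"] nz by simp
  next
    case False
    obtain k where k: "b = k * a" "d = k * c" using pair_proportional[of a c d b] False det by (auto simp: mult.commute)
    have "z = segre a c (1/2) (k/2)" by (rule vec4_eqI) (simp_all add: z k field_simps)
    then show ?thesis using that[of a c "1/2" "k/2"] False by auto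
  qed
qed

lemma range_Psi_inv: "range Psi_inv = Q11"
proof (intro equalityI subsetI)
  fix p assume "p \<in> range Psi_inv"
  then obtain x1 x2 where p: "p = Psi_inv (x1, x2)" by auto
  obtain a b where 1: "x1 = ratio a b" "a \<noteq> 0 \<or> b \<noteq> 0" by (rule sphere_cases)
  obtain a' b' where 2: "x2 = ratio a' b'" "a' \<noteq> 0 \<or> b' \<noteq> 0" by (rule sphere_cases)
  show "p \<in> Q11" using 1 2 by (simp add: p Psi_inv_ratio pt_in_Q11 segre_nonzero mink_segre_self)
next
  fix p assume "p \<in> Q11"
  then obtain z where z: "p = pt z" "z \<noteq> 0" "mink z z = 0" unfolding Q11_def by auto
  then obtain p1 q1 p2 q2 where "p1 \<noteq> 0 \<or> q1 \<noteq> 0" "p2 \<noteq> 0 \<or> q2 \<noteq> 0" "z = segre p1 q1 p2 q2"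
    using Q11_segre by blast
  then have "p = Psi_inv (ratio p1 q1, ratio p2 q2)" using z(1) by (simp add: Psi_inv_ratio)
  then show "p \<in> range Psi_inv" by (rule range_eqI)
qed

lemma Psi_Psi_inv: "Psi (Psi_inv x) = x"
  unfolding Psi_def using inj_Psi_inv by simp

lemma Psi_inv_Psi: "p \<in> Q11 \<Longrightarrow> Psi_inv (Psi p) = p"
  unfolding Psi_def range_Psi_inv[symmetric] by (rule f_inv_into_f)

lemma hyperplane_subset: "hyperplane A \<subseteq> Q11"
  unfolding hyperplane_def Q11_def by auto

lemma Psi_hyperplane_iff: "w \<in> Psi ` hyperplane A \<longleftrightarrow> Psi_inv w \<in> hyperplane A"
  using hyperplane_subset[of A] by (metis (no_types, opaque_lifting) Psi_Psi_inv Psi_inv_Psi image_iff subsetD)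

lemma Psi_inv_in_Q11_plus: "Psi_inv (w1, w2) \<in> Q11_plus \<longleftrightarrow> w2 \<noteq> cnj_sphere w1"
proof -
  obtain a b where 1: "w1 = ratio a b" "a \<noteq> 0 \<or> b \<noteq> 0" by (rule sphere_cases)
  obtain c d where 2: "w2 = ratio c d" "c \<noteq> 0 \<or> d \<noteq> 0" by (rule sphere_cases)
  have iff: "w2 = cnj_sphere w1 \<longleftrightarrow> c * cnj b = cnj a * d"
    using 1 2 by (simp add: cnj_sphere_ratio ratio_eq_iff)
  also have "\<dots> \<longleftrightarrow> cnj (c * cnj b) = cnj (cnj a * d)" by (metis complex_cnj_cnj)
  also have "\<dots> \<longleftrightarrow> a * cnj d - b * cnj c = 0" by (auto simp: mult.commute)
  finally show ?thesis
    using 1 2 by (simp add: Psi_inv_ratio pt_in_Q11_plus segre_nonzero mink_segre_self mink_segre_cnj)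
qed

text \<open>In homogeneous coordinates the equation of \<open>H\<^sub>A\<close> says that \<open>Smat A\<close> maps \<open>w1\<close> to \<open>w2\<close>,
  see \<open>mink_segre\<close>.\<close>

definition Smat :: "complex ^ 4 \<Rightarrow> complex ^ 2 ^ 2" where
  "Smat A = mat2 (A$1 - \<i> * A$2) (A$3 - A$4) (A$3 + A$4) (- A$1 - \<i> * A$2)"

text \<open>The linear inverse of \<open>Smat\<close>; it turns normal forms of matrices into normal
  forms of vectors.\<close>

definition Avec :: "complex ^ 2 ^ 2 \<Rightarrow> complex ^ 4" where
  "Avec S = vector [(S$1$1 - S$2$2) / 2, \<i> * (S$1$1 + S$2$2) / 2,
                    (S$1$2 + S$2$1) / 2, (S$2$1 - S$1$2) / 2]"

lemma Avec_mat2: "Avec (mat2 a b c d) = vector [(a - d) / 2, \<i> * (a + d) / 2, (b + c) / 2, (c - b) / 2]"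
  by (simp add: Avec_def)

lemma Avec_scale: "Avec (mat2 (k * a) (k * b) (k * c) (k * d)) = k *s Avec (mat2 a b c d)"
  by (rule vec4_eqI) (simp_all add: Avec_mat2 field_simps)

lemma pt_Avec_uminus: "pt (Avec (- S)) = pt (Avec S)"
  using Avec_scale[of "-1" "S$1$1" "S$1$2" "S$2$1" "S$2$2"] pt_scale[of "-1" "Avec S"]
  by (simp flip: mat2_eta mat2_uminus)

lemma Avec_Smat: "Avec (Smat A) = A"
  by (rule vec4_eqI) (simp_all add: Smat_def Avec_def)

lemma Smat_Avec: "Smat (Avec S) = S"
  by (subst (2) mat2_eta) (simp add: Smat_def Avec_def field_simps)

lemma det_Smat: "det (Smat A) = - mink A A"
  by (simp add: Smat_def det_mat2 mink_def algebra_simps)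

lemma mink_segre:
  assumes "Smat A = mat2 a b c d"
  shows "mink A (segre p1 q1 p2 q2) = q2 * (a * p1 + b * q1) - p2 * (c * p1 + d * q1)"
proof -
  have e: "a = A$1 - \<i> * A$2" "b = A$3 - A$4" "c = A$3 + A$4" "d = - A$1 - \<i> * A$2"
    using assms by (simp_all add: Smat_def)
  show ?thesis by (simp add: e mink_def algebra_simps)
qed

lemma ratio_in_Psi_hyperplane:
  assumes "p1 \<noteq> 0 \<or> q1 \<noteq> 0" "p2 \<noteq> 0 \<or> q2 \<noteq> 0" "Smat A = mat2 a b c d"
  shows "(ratio p1 q1, ratio p2 q2) \<in> Psi ` hyperplane A \<longleftrightarrow>
    q2 * (a * p1 + b * q1) = p2 * (c * p1 + d * q1)"
  using assms by (simp add: Psi_hyperplane_iff Psi_inv_ratio pt_in_hyperplane segre_nonzero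
      mink_segre_self mink_segre)

lemma Psi_hyperplane_graph:
  assumes "mink A A \<noteq> 0"
  shows "Psi ` hyperplane A = graph_of_moebius (Smat A)"
proof -
  obtain a b c d where S: "Smat A = mat2 a b c d" by (metis mat2_eta)
  have det: "a * d - b * c \<noteq> 0" using assms det_Smat[of A] by (simp add: S det_mat2)
  have "(w1, w2) \<in> Psi ` hyperplane A \<longleftrightarrow> w2 = moebius (Smat A) w1" for w1 w2
  proof -
    obtain p1 q1 where 1: "w1 = ratio p1 q1" "p1 \<noteq> 0 \<or> q1 \<noteq> 0" by (rule sphere_cases)
    obtain p2 q2 where 2: "w2 = ratio p2 q2" "p2 \<noteq> 0 \<or> q2 \<noteq> 0" by (rule sphere_cases)
    show ?thesis using mat2_kernel[OF det 1(2)] 1 2 ratio_in_Psi_hyperplane[OF 1(2) 2(2) S]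
      by (auto simp: S moebius_ratio ratio_eq_iff mult.commute)
  qed
  then show ?thesis unfolding graph_of_moebius_def by auto
qed

lemma graph_of_moebius_inj:
  "graph_of_moebius S = graph_of_moebius S' \<Longrightarrow> moebius S p = moebius S' p"
  unfolding graph_of_moebius_def by blast

lemma SL2_representative:
  assumes "mink A A \<noteq> 0"
  obtains S c where "S \<in> SL2" "Psi ` hyperplane A = graph_of_moebius S" "c \<noteq> 0" "A = c *s Avec S"
proof -
  obtain a b c d where S: "Smat A = mat2 a b c d" by (metis mat2_eta)
  have det: "a * d - b * c \<noteq> 0" using assms det_Smat[of A] by (simp add: S det_mat2)
  define k where "k = 1 / csqrt (a * d - b * c)"
  have k: "k \<noteq> 0" "k * k * (a * d - b * c) = 1"
    using det by (simp_all add: k_def power_divide flip: power2_eq_square)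
  define T where "T = mat2 (k * a) (k * b) (k * c) (k * d)"
  have "T \<in> SL2" using k(2) by (simp add: T_def mat2_in_SL2 algebra_simps)
  moreover have "Psi ` hyperplane A = graph_of_moebius T"
    using moebius_scale[OF k(1)] by (simp add: Psi_hyperplane_graph[OF assms] graph_of_moebius_def S T_def)
  moreover have "A = (1/k) *s Avec T"
    using Avec_Smat[of A] k(1) by (simp add: T_def S Avec_scale vector_smult_assoc)
  ultimately show ?thesis using that[of T "1/k"] k(1) by auto
qed

text \<open>The graph determines the Moebius map, hence S up to sign, and \<open>Avec\<close> is
  linear. So every SL(2,C) matrix with the given graph recovers the point, not only the
  representative obtained by normalizing \<open>Smat A\<close>.\<close>

lemma pt_eq_pt_Avec:
  assumes "mink A A \<noteq> 0" "S \<in> SL2" "Psi ` hyperplane A = graph_of_moebius S"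
  shows "pt A = pt (Avec S)"
proof -
  obtain T c where T: "T \<in> SL2" "Psi ` hyperplane A = graph_of_moebius T" "c \<noteq> 0" "A = c *s Avec T"
    using SL2_representative[OF assms(1)] by blast
  have "T = S \<or> T = - S"
    using moebius_inj[OF assms(2) T(1)] graph_of_moebius_inj assms(3) T(2) by metis
  then show ?thesis using T(3,4) by (auto simp: pt_scale pt_Avec_uminus)
qed

lemma cross_inj: "cross c1 c2 = cross d1 d2 \<Longrightarrow> c1 = d1 \<and> c2 = d2"
proof -
  assume eq: "cross c1 c2 = cross d1 d2"
  have m: "w1 = c1 \<or> w2 = c2 \<longleftrightarrow> w1 = d1 \<or> w2 = d2" for w1 w2
  proof -
    have "(w1, w2) \<in> cross c1 c2 \<longleftrightarrow> (w1, w2) \<in> cross d1 d2" by (simp only: eq)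
    then show ?thesis by (simp add: cross_def)
  qed
  \<comment> \<open>Probing with a coordinate that misses both centres isolates one arm of the
    cross.\<close>
  have ex: "\<exists>x. x \<noteq> a \<and> x \<noteq> b" for a b :: sphere
    using ex_new_if_finite[of "{a, b}"] by (simp add: infinite_UNIV_char_0)
  obtain x where "x \<noteq> c2" "x \<noteq> d2" using ex by blast
  moreover obtain y where "y \<noteq> c1" "y \<noteq> d1" using ex by blast
  ultimately show ?thesis using m[of c1 x] m[of y c2] by blast
qed

text \<open>A cross contains a whole line over c1, whereas a graph has one point there.\<close>

lemma cross_neq_graph: "cross c1 c2 \<noteq> graph_of_moebius S"
proof
  assume eq: "cross c1 c2 = graph_of_moebius S"
  have "(c1, None) \<in> graph_of_moebius S" "(c1, Some 0) \<in> graph_of_moebius S"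
    unfolding eq[symmetric] by (simp_all add: cross_def)
  then show False by (auto simp: graph_of_moebius_def)
qed

text \<open>If A itself is a Segre vector, the bilinear form splits into two factors, one for each
  coordinate. Hence the centre of the cross is the image of [A] under \<open>Psi\<close>, and
  positivity of [A] becomes a condition on c1 and c2.\<close>

lemma Psi_hyperplane_cross:
  assumes "A \<noteq> 0" "mink A A = 0"
  obtains c1 c2 where "pt A = Psi_inv (c1, c2)" "Psi ` hyperplane A = cross c1 c2"
proof -
  obtain p1 q1 p2 q2 where nz: "p1 \<noteq> 0 \<or> q1 \<noteq> 0" "p2 \<noteq> 0 \<or> q2 \<noteq> 0" and A: "A = segre p1 q1 p2 q2"
    using Q11_segre[OF assms] by blast
  have S: "Smat A = mat2 (2 * (q1 * p2)) (-2 * (p1 * p2)) (2 * (q1 * q2)) (-2 * (p1 * q2))"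
    by (simp add: Smat_def A algebra_simps)
  have "(w1, w2) \<in> Psi ` hyperplane A \<longleftrightarrow> w1 = ratio p1 q1 \<or> w2 = ratio p2 q2" for w1 w2
  proof -
    obtain x y where 1: "w1 = ratio x y" "x \<noteq> 0 \<or> y \<noteq> 0" by (rule sphere_cases)
    obtain x' y' where 2: "w2 = ratio x' y'" "x' \<noteq> 0 \<or> y' \<noteq> 0" by (rule sphere_cases)
    have "y' * (2 * (q1 * p2) * x + -2 * (p1 * p2) * y) - x' * (2 * (q1 * q2) * x + -2 * (p1 * q2) * y)
      = - 2 * ((x * q1 - p1 * y) * (x' * q2 - p2 * y'))" by algebra
    moreover have "- 2 * ((x * q1 - p1 * y) * (x' * q2 - p2 * y')) = 0 \<longleftrightarrow> x * q1 = p1 * y \<or> x' * q2 = p2 * y'"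
      by simp
    ultimately have "y' * (2 * (q1 * p2) * x + -2 * (p1 * p2) * y) = x' * (2 * (q1 * q2) * x + -2 * (p1 * q2) * y)
      \<longleftrightarrow> x * q1 = p1 * y \<or> x' * q2 = p2 * y'" by (metis eq_iff_diff_eq_0)
    then show ?thesis using 1 2 nz ratio_in_Psi_hyperplane[OF 1(2) 2(2) S]
      by (auto simp: ratio_eq_iff)
  qed
  then have "Psi ` hyperplane A = cross (ratio p1 q1) (ratio p2 q2)" unfolding cross_def by auto
  then show ?thesis using that[of "ratio p1 q1" "ratio p2 q2"] nz by (simp add: A Psi_inv_ratio)
qed

section \<open>The Lorentz action of SL(2,C)\<close>

text \<open>The twisted conjugation behind \<open>conj_similar\<close>, transported to vectors. On
  the quadric it moves w1 by T and w2 by cnj T, see \<open>lact_segre\<close>.\<close>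

definition lact :: "complex ^ 2 ^ 2 \<Rightarrow> complex ^ 4 \<Rightarrow> complex ^ 4" where
  "lact T z = Avec (cnj_mat T ** Smat z ** matrix_inv T)"

lemma Smat_lact: "Smat (lact T z) = cnj_mat T ** Smat z ** matrix_inv T"
  by (simp add: lact_def Smat_Avec)

lemma lact_Avec: "lact T (Avec S) = Avec (cnj_mat T ** S ** matrix_inv T)"
  by (simp add: lact_def Smat_Avec)

lemma lact_mat2:
  assumes "a * d - b * c = 1"
  shows "lact (mat2 a b c d) z = Avec (mat2 (cnj a) (cnj b) (cnj c) (cnj d) ** Smat z ** mat2 d (- b) (- c) a)"
  using assms by (simp add: lact_def cnj_mat2 matrix_inv_mat2)

lemma lact_add: "lact T (x + y) = lact T x + lact T y"
proof -
  obtain a b c d where 1: "cnj_mat T = mat2 a b c d" by (metis mat2_eta)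
  obtain a' b' c' d' where 2: "matrix_inv T = mat2 a' b' c' d'" by (metis mat2_eta)
  show ?thesis unfolding lact_def 1 2 Smat_def mat2_mult Avec_mat2
    by (rule vec4_eqI) (simp_all add: field_simps)
qed

lemma lact_scale: "lact T (k *s x) = k *s lact T x"
proof -
  obtain a b c d where 1: "cnj_mat T = mat2 a b c d" by (metis mat2_eta)
  obtain a' b' c' d' where 2: "matrix_inv T = mat2 a' b' c' d'" by (metis mat2_eta)
  show ?thesis unfolding lact_def 1 2 Smat_def mat2_mult Avec_mat2
    by (rule vec4_eqI) (simp_all add: algebra_simps)
qed

text \<open>Commuting with conjugation makes \<open>lact T\<close> the complexification of a real
  linear map. This is a feature of the twist: T and cnj T exchange roles together with w1 and
  w2.\<close>

lemma lact_cnj: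
  assumes "T \<in> SL2"
  shows "lact T (cnj_vec z) = cnj_vec (lact T z)"
proof -
  obtain a b c d where T: "T = mat2 a b c d" "a * d - b * c = 1" using assms by (rule SL2_cases)
  show ?thesis unfolding T(1) lact_mat2[OF T(2)] Smat_def mat2_mult Avec_mat2
    by (rule vec4_eqI) (simp_all add: cnj_vec_def algebra_simps)
qed

lemma mink_lact_self:
  assumes "T \<in> SL2"
  shows "mink (lact T z) (lact T z) = mink z z"
proof -
  have "det (Smat (lact T z)) = det (Smat z)"
    using SL2_cnj[OF assms] SL2_inv(1)[OF assms] by (simp add: Smat_lact det_mul SL2_def)
  then show ?thesis by (simp add: det_Smat)
qed

lemma mink_add:
  "mink (x + y) z = mink x z + mink y z" "mink z (x + y) = mink z x + mink z y"
  by (simp_all add: mink_def algebra_simps)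

lemma mink_commute: "mink x y = mink y x"
  by (simp add: mink_def mult.commute)

lemma mink_lact:
  assumes "T \<in> SL2"
  shows "mink (lact T z) (lact T w) = mink z w"
proof -
  have "2 * mink u v = mink (u + v) (u + v) - mink u u - mink v v" for u v :: "complex ^ 4"
    by (simp add: mink_add mink_commute[of v u])
  from this[of z w] this[of "lact T z" "lact T w"]
  have "2 * mink (lact T z) (lact T w) = 2 * mink z w"
    using assms by (simp add: mink_lact_self flip: lact_add)
  then show ?thesis by simp
qed

lemma lact_mult:
  assumes "S \<in> SL2" "T \<in> SL2"
  shows "lact (S ** T) z = lact S (lact T z)"
proof -
  have "(S ** T) ** (matrix_inv T ** matrix_inv S) = S ** (T ** matrix_inv T) ** matrix_inv S"
    by (simp only: matrix_mul_assoc)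
  then have "matrix_inv (S ** T) = matrix_inv T ** matrix_inv S"
    by (intro matrix_inv_eq) (simp add: SL2_inv assms)
  then show ?thesis by (simp add: lact_def Smat_Avec cnj_mat_mult matrix_mul_assoc)
qed

lemma lact_one: "lact (mat 1) z = z"
proof -
  have "matrix_inv (mat 1 :: complex ^ 2 ^ 2) = mat 1" by (simp add: matrix_inv_eq)
  then show ?thesis by (simp add: lact_def cnj_mat_one Avec_Smat)
qed

lemma lact_uminus:
  assumes "T \<in> SL2"
  shows "lact (- T) z = lact T z"
proof -
  obtain a b c d where T: "T = mat2 a b c d" "a * d - b * c = 1" using assms by (rule SL2_cases)
  have "(-a) * (-d) - (-b) * (-c) = 1" using T(2) by simp
  then show ?thesis
    unfolding T(1) mat2_uminus lact_mat2[OF T(2)] lact_mat2[OF \<open>(-a) * (-d) - (-b) * (-c) = 1\<close>]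
    by (intro arg_cong[of _ _ Avec]) (simp add: Smat_def mat2_mult algebra_simps)
qed

section \<open>The real matrix of the action and its membership in SO^+(3,1)\<close>

definition lorentz :: "complex ^ 2 ^ 2 \<Rightarrow> real ^ 4 ^ 4" where
  "lorentz T = (\<chi> i j. Re (lact T (axis j 1) $ i))"

lemma of_real_mat_lorentz:
  assumes "T \<in> SL2"
  shows "of_real_mat (lorentz T) *v z = lact T z"
proof -
  have "cnj_vec (axis j 1) = axis j 1" for j :: 4
    by (simp add: cnj_vec_def axis_def vec_eq_iff)
  then have "cnj (lact T (axis j 1) $ i) = lact T (axis j 1) $ i" for i j
    using lact_cnj[OF assms, of "axis j 1"] by (simp add: cnj_vec_def vec_eq_iff)
  then have re: "complex_of_real (Re (lact T (axis j 1) $ i)) = lact T (axis j 1) $ i" for i j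
    by (metis Reals_cnj_iff of_real_Re)
  have "z = (\<Sum>j\<in>UNIV. z $ j *s axis j 1)" by (rule basis_expansion[symmetric])
  then have "lact T z = (\<Sum>j\<in>UNIV. z $ j *s lact T (axis j 1))"
    unfolding sum_4 by (metis lact_add lact_scale)
  then show ?thesis
    by (simp add: vec_eq_iff matrix_vector_mult_def of_real_mat_def lorentz_def re mult.commute)
qed

lemma of_real_vec_mult: "of_real_vec (M *v x) = of_real_mat M *v of_real_vec x"
  by (simp add: of_real_vec_def of_real_mat_def matrix_vector_mult_def vec_eq_iff)

lemma of_real_vec_inj: "of_real_vec x = of_real_vec y \<longleftrightarrow> x = y"
  by (simp add: of_real_vec_def vec_eq_iff)

lemma mink_of_real_vec: "mink (of_real_vec x) (of_real_vec y) = complex_of_real (mink x y)"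
  by (simp add: mink_def of_real_vec_def)

lemma lorentz_vec: "T \<in> SL2 \<Longrightarrow> of_real_vec (lorentz T *v x) = lact T (of_real_vec x)"
  by (simp add: of_real_vec_mult of_real_mat_lorentz)

lemma lorentz_mink: "T \<in> SL2 \<Longrightarrow> mink (lorentz T *v x) (lorentz T *v y) = mink x y"
  using mink_lact[of T "of_real_vec x" "of_real_vec y"]
  by (simp add: mink_of_real_vec flip: lorentz_vec)

lemma lorentz_mult:
  assumes "S \<in> SL2" "T \<in> SL2"
  shows "lorentz (S ** T) = lorentz S ** lorentz T"
proof -
  have "of_real_vec (lorentz (S ** T) *v x) = of_real_vec (lorentz S *v (lorentz T *v x))" for x
    using assms by (simp add: lorentz_vec SL2_mult lact_mult)
  then show ?thesis by (simp add: matrix_eq of_real_vec_inj matrix_vector_mul_assoc)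
qed

lemma lorentz_one: "lorentz (mat 1) = mat 1"
  by (simp add: lorentz_def lact_one) (simp add: mat_def axis_def vec_eq_iff)

lemma lorentz_uminus: "T \<in> SL2 \<Longrightarrow> lorentz (- T) = lorentz T"
  by (simp add: lorentz_def lact_uminus)

text \<open>An algebraic substitute for connectedness of SL(2,C). The sign cannot be dropped: a
  nontrivial Jordan block with eigenvalue -1 has no square root of determinant 1. It covers the case
  of trace -2, where the negated matrix has trace 2.\<close>

lemma SL2_square_root:
  assumes "T \<in> SL2"
  obtains R where "R \<in> SL2" "R ** R = T \<or> R ** R = - T"
proof -
  \<comment> \<open>By Cayley--Hamilton, \<open>(T + 1)\<^sup>2 = (tr T + 2) T\<close>.\<close>
  have sqrt: "\<exists>R\<in>SL2. R ** R = mat2 a b c d" if det: "a * d - b * c = 1" and tr: "a + d + 2 \<noteq> 0" for a b c d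
  proof -
    define k where "k = 1 / csqrt (a + d + 2)"
    have k: "k * k * (a + d + 2) = 1"
      using tr by (simp add: k_def power_divide flip: power2_eq_square)
    define R where "R = mat2 (k * (a + 1)) (k * b) (k * c) (k * (d + 1))"
    have "(k * (a + 1)) * (k * (d + 1)) - (k * b) * (k * c) = k * k * (a + d + 1 + (a * d - b * c))"
      by algebra
    then have "R \<in> SL2" using k by (simp add: R_def mat2_in_SL2 det algebra_simps)
    moreover have "k * (a + 1) * (k * (a + 1)) + k * b * (k * c) = k * k * (a + d + 2) * a - k * k * (a * d - b * c - 1)"
      "k * (a + 1) * (k * b) + k * b * (k * (d + 1)) = k * k * (a + d + 2) * b"
      "k * c * (k * (a + 1)) + k * (d + 1) * (k * c) = k * k * (a + d + 2) * c"
      "k * c * (k * b) + k * (d + 1) * (k * (d + 1)) = k * k * (a + d + 2) * d - k * k * (a * d - b * c - 1)"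
      by algebra+
    then have "R ** R = mat2 a b c d" by (simp add: R_def mat2_mult k det)
    ultimately show ?thesis by blast
  qed
  obtain a b c d where T: "T = mat2 a b c d" "a * d - b * c = 1" using assms by (rule SL2_cases)
  show ?thesis
  proof (cases "a + d + 2 = 0")
    case False
    then show ?thesis using sqrt[OF T(2)] that T(1) by blast
  next
    case True
    then have "-a + -d + 2 = 4" by (simp add: algebra_simps add_eq_0_iff)
    then have "-a + -d + 2 \<noteq> 0" by simp
    then show ?thesis using sqrt[of "-a" "-d" "-b" "-c"] that T by (auto simp: mat2_uminus)
  qed
qed

text \<open>The sign lost in the square root is invisible to \<open>lorentz\<close>, so the
  determinant is the square of a nonzero real number.\<close>

lemma det_lorentz_pos:
  assumes "T \<in> SL2"
  shows "det (lorentz T) > 0"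
proof -
  obtain R where R: "R \<in> SL2" "R ** R = T \<or> R ** R = - T" using SL2_square_root[OF assms] .
  have "lorentz T = lorentz (R ** R)" using R(2) lorentz_uminus[OF assms] by auto
  then have sq: "det (lorentz T) = det (lorentz R) * det (lorentz R)"
    by (simp add: lorentz_mult R(1) det_mul)
  have "lorentz (matrix_inv R) ** lorentz R = mat 1"
    using R(1) by (simp add: SL2_inv lorentz_one flip: lorentz_mult)
  then have "det (lorentz R) \<noteq> 0" by (metis det_I det_mul mult_zero_right zero_neq_one)
  then show ?thesis by (auto simp: sq zero_less_mult_iff)
qed

text \<open>Positive definiteness of a Hermitian two-by-two matrix with diagonal \<alpha>, \<delta>
  and off-diagonal entry \<beta>, by completing the square after multiplication by \<alpha>.\<close>

lemma hermitian_form_pos: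
  fixes \<beta> r s :: complex and \<alpha> \<delta> :: real
  assumes "\<alpha> > 0" "(norm \<beta>)\<^sup>2 < \<alpha> * \<delta>" "r \<noteq> 0 \<or> s \<noteq> 0"
  shows "\<alpha> * (norm r)\<^sup>2 + \<delta> * (norm s)\<^sup>2 + 2 * Re (cnj r * s * \<beta>) > 0"
proof -
  have id: "\<alpha> * (\<alpha> * (norm r)\<^sup>2 + \<delta> * (norm s)\<^sup>2 + 2 * Re (cnj r * s * \<beta>)) =
      (norm (\<alpha> * r + \<beta> * s))\<^sup>2 + (\<alpha> * \<delta> - (norm \<beta>)\<^sup>2) * (norm s)\<^sup>2"
    unfolding cmod_power2 by (simp add: power2_eq_square algebra_simps)
  have "\<dots> > 0"
  proof (cases "s = 0")
    case True
    then show ?thesis using assms by simp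
  next
    case False
    then show ?thesis using assms(2) by (intro add_nonneg_pos) auto
  qed
  then show ?thesis using assms(1) by (simp flip: id add: zero_less_mult_iff)
qed

text \<open>A future time-like x is a positive definite Hermitian matrix with diagonal x4 - x3, x4 +
  x3 and determinant -<x,x>. Twice the new fourth coordinate is a trace, the sum of the form
  evaluated at the two rows of T.\<close>

lemma lorentz_future:
  assumes "T \<in> SL2" "mink x x < 0" "x $ 4 > 0"
  shows "(lorentz T *v x) $ 4 > 0"
proof -
  obtain a b c d where T: "T = mat2 a b c d" "a * d - b * c = 1" using assms(1) by (rule SL2_cases)
  define \<beta> where "\<beta> = Complex (x$1) (- (x$2))"
  have q: "(x$1)\<^sup>2 + (x$2)\<^sup>2 + (x$3)\<^sup>2 < (x$4)\<^sup>2"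
    using assms(2) by (simp add: mink_def power2_eq_square)
  then have "(x$3)\<^sup>2 < (x$4)\<^sup>2" by (smt (verit) zero_le_power2)
  then have "\<bar>x$3\<bar> < x$4" using assms(3) by (metis abs_le_square_iff abs_of_pos linorder_not_less)
  then have pos: "x$4 - x$3 > 0" by simp
  have disc: "(norm \<beta>)\<^sup>2 < (x$4 - x$3) * (x$4 + x$3)"
    using q unfolding cmod_power2 by (simp add: \<beta>_def power2_eq_square algebra_simps)
  have "a \<noteq> 0 \<or> b \<noteq> 0" "c \<noteq> 0 \<or> d \<noteq> 0" using T(2) by auto
  then have "(x$4 - x$3) * (norm a)\<^sup>2 + (x$4 + x$3) * (norm b)\<^sup>2 + 2 * Re (cnj a * b * \<beta>) > 0"
    "(x$4 - x$3) * (norm c)\<^sup>2 + (x$4 + x$3) * (norm d)\<^sup>2 + 2 * Re (cnj c * d * \<beta>) > 0"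
    using hermitian_form_pos[OF pos disc] by blast+
  moreover have "2 * Re (lact T (of_real_vec x) $ 4) =
      ((x$4 - x$3) * (norm a)\<^sup>2 + (x$4 + x$3) * (norm b)\<^sup>2 + 2 * Re (cnj a * b * \<beta>)) +
      ((x$4 - x$3) * (norm c)\<^sup>2 + (x$4 + x$3) * (norm d)\<^sup>2 + 2 * Re (cnj c * d * \<beta>))"
    unfolding T(1) lact_mat2[OF T(2)] Smat_def mat2_mult Avec_mat2
    unfolding cmod_power2 by (simp add: of_real_vec_def \<beta>_def power2_eq_square field_simps)
  ultimately have "Re (of_real_vec (lorentz T *v x) $ 4) > 0"
    unfolding lorentz_vec[OF assms(1)] by linarith
  then show ?thesis by (simp add: of_real_vec_def)
qed

lemma lorentz_in_SO_plus: "T \<in> SL2 \<Longrightarrow> lorentz T \<in> SO_plus"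
  by (simp add: SO_plus_def lorentz_mink det_lorentz_pos lorentz_future)

lemma image_pt: "(\<lambda>z. M *v z) ` pt z = pt (M *v z)"
  by (auto simp: pt_def vector_scalar_commute image_iff) (metis vector_scalar_commute)

lemma lorentz_equivI: "T \<in> SL2 \<Longrightarrow> pt (lact T A) = pt B \<Longrightarrow> pt A \<sim>\<^sub>L pt B"
  unfolding lorentz_equiv_def
  by (rule bexI[OF _ lorentz_in_SO_plus[of T]]) (simp_all only: image_pt of_real_mat_lorentz)

lemma lorentz_equivE:
  assumes "pt A \<sim>\<^sub>L pt B"
  obtains g c where "g \<in> SO_plus" "c \<noteq> 0" "B = c *s (of_real_mat g *v A)"
  using assms unfolding lorentz_equiv_def by (metis image_pt pt_eqE)

lemma conj_similar_lorentz_equiv: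
  assumes "S \<sim>\<^sub>c S'"
  shows "pt (Avec S) \<sim>\<^sub>L pt (Avec S')"
proof -
  obtain T where T: "T \<in> SL2" "S' = cnj_mat T ** S ** matrix_inv T \<or> S' = - (cnj_mat T ** S ** matrix_inv T)"
    using assms unfolding conj_similar_def by blast
  then show ?thesis by (intro lorentz_equivI[OF T(1)]) (auto simp: lact_Avec pt_Avec_uminus)
qed

text \<open>A Lorentz invariant that recovers the parameter of a normal form.\<close>

definition kappa :: "complex ^ 4 \<Rightarrow> real" where
  "kappa A = Re (mink A (cnj_vec A)) / norm (mink A A)"

section \<open>Invariance of kappa and of the types under all of SO^+(3,1)\<close>

lemma Re_Im_vec_mult:
  "Re_vec (of_real_mat g *v z) = g *v Re_vec z" "Im_vec (of_real_mat g *v z) = g *v Im_vec z"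
  by (simp_all add: Re_vec_def Im_vec_def of_real_mat_def matrix_vector_mult_def vec_eq_iff)

text \<open>Everything in \<open>kappa\<close> is thereby expressed by real Minkowski products,
  which is all that an element of \<open>SO_plus\<close> is known to preserve.\<close>

lemma mink_Re_Im:
  "mink z z = Complex (mink (Re_vec z) (Re_vec z) - mink (Im_vec z) (Im_vec z)) (2 * mink (Re_vec z) (Im_vec z))"
  "Re (mink z (cnj_vec z)) = mink (Re_vec z) (Re_vec z) + mink (Im_vec z) (Im_vec z)"
  by (simp_all add: mink_def Re_vec_def Im_vec_def cnj_vec_def complex_eq_iff)

lemma kappa_scale: "c \<noteq> 0 \<Longrightarrow> kappa (c *s z) = kappa z"
proof -
  assume c: "c \<noteq> 0"
  have "mink (c *s z) (cnj_vec (c *s z)) = of_real ((norm c)\<^sup>2) * mink z (cnj_vec z)"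
    by (simp add: cnj_vec_scale mink_scale complex_norm_square del: of_real_power)
  then show ?thesis using c
    by (simp add: kappa_def mink_scale norm_mult power2_eq_square)
qed

lemma SO_plus_mink: "g \<in> SO_plus \<Longrightarrow> mink (g *v x) (g *v y) = mink x y"
  by (simp add: SO_plus_def)

lemma kappa_lorentz_equiv:
  assumes "pt A \<sim>\<^sub>L pt B"
  shows "kappa A = kappa B"
proof -
  obtain g c where g: "g \<in> SO_plus" and c: "c \<noteq> 0" "B = c *s (of_real_mat g *v A)"
    using assms by (rule lorentz_equivE)
  have "kappa (of_real_mat g *v A) = kappa A"
    by (simp add: kappa_def mink_Re_Im Re_Im_vec_mult SO_plus_mink[OF g])
  then show ?thesis using c by (simp add: kappa_scale)
qed

lemma real_plane_scale_subset: "real_plane (c *s z) \<subseteq> real_plane z"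
proof -
  have "Re_vec (c *s z) = Re c *\<^sub>R Re_vec z + (- Im c) *\<^sub>R Im_vec z"
    "Im_vec (c *s z) = Im c *\<^sub>R Re_vec z + Re c *\<^sub>R Im_vec z"
    by (simp_all add: Re_vec_def Im_vec_def vec_eq_iff)
  moreover have "x *\<^sub>R Re_vec z + y *\<^sub>R Im_vec z \<in> real_plane z" for x y
    unfolding real_plane_def by (intro span_add span_scale span_base) auto
  ultimately have "{Re_vec (c *s z), Im_vec (c *s z)} \<subseteq> real_plane z"
    by (simp only: insert_subset empty_subsetI simp_thms)
  then show ?thesis
    unfolding real_plane_def by (intro span_minimal) auto
qed

lemma real_plane_scale: "c \<noteq> 0 \<Longrightarrow> real_plane (c *s z) = real_plane z"
  using real_plane_scale_subset[of c z] real_plane_scale_subset[of "1/c" "c *s z"]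
  by (auto simp: vector_smult_assoc)

lemma real_plane_mult: "real_plane (of_real_mat g *v z) = (\<lambda>x. g *v x) ` real_plane z"
  unfolding real_plane_def Re_Im_vec_mult
  using linear_span_image[OF matrix_vector_mul_linear[of g], of "{Re_vec z, Im_vec z}"] by simp

lemma SO_plus_zero_iff:
  assumes "g \<in> SO_plus"
  shows "g *v x = 0 \<longleftrightarrow> x = 0"
proof -
  have "invertible g" using assms by (simp add: SO_plus_def invertible_det_nz)
  then show ?thesis by (metis matrix_inv_def inj_def matrix_vector_mult_0_right inj_matrix_vector_mult)
qed

lemma types_lorentz_equiv:
  assumes eq: "pt A \<sim>\<^sub>L pt B"
  shows "totally_real A \<Longrightarrow> totally_real B"
    and "space_like (real_plane A) \<Longrightarrow> space_like (real_plane B)"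
    and "time_like (real_plane A) \<Longrightarrow> time_like (real_plane B)"
    and "light_like (real_plane A) \<Longrightarrow> light_like (real_plane B)"
proof -
  obtain g c where g: "g \<in> SO_plus" and c: "c \<noteq> 0" "B = c *s (of_real_mat g *v A)"
    using eq by (rule lorentz_equivE)
  have P: "real_plane B = (\<lambda>x. g *v x) ` real_plane A"
    by (simp add: c real_plane_scale real_plane_mult)
  show "totally_real A \<Longrightarrow> totally_real B"
  proof -
    assume "totally_real A"
    then obtain u where "pt A = pt (of_real_vec u)" unfolding totally_real_def by blast
    then obtain k where "k \<noteq> 0" "A = k *s of_real_vec u" by (rule pt_eqE)
    then have "pt B = pt (of_real_vec (g *v u))"
      by (simp add: c pt_scale of_real_vec_mult vector_scalar_commute)
    then show ?thesis unfolding totally_real_def by blast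
  qed
  show "space_like (real_plane A) \<Longrightarrow> space_like (real_plane B)"
    unfolding space_like_def P by (auto simp: SO_plus_mink[OF g] SO_plus_zero_iff[OF g])
  show "light_like (real_plane A) \<Longrightarrow> light_like (real_plane B)"
    unfolding light_like_def P using SO_plus_mink[OF g] SO_plus_zero_iff[OF g] by fastforce
  show "time_like (real_plane A) \<Longrightarrow> time_like (real_plane B)"
  proof -
    assume "time_like (real_plane A)"
    then obtain x y where xy: "real_plane A = span {x, y}" "mink x y = 0" "mink x x > 0" "mink y y < 0"
      unfolding time_like_def by blast
    have "real_plane B = span {g *v x, g *v y}"
      unfolding P xy(1) using linear_span_image[OF matrix_vector_mul_linear[of g], of "{x, y}"] by simp
    then show ?thesis unfolding time_like_def using xy
      by (intro exI[of _ "g *v x"] exI[of _ "g *v y"]) (simp add: SO_plus_mink[OF g])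
  qed
qed

lemma space_like_not_time_like: "space_like P \<Longrightarrow> \<not> time_like P"
proof
  assume "space_like P" "time_like P"
  then obtain x y where "P = span {x, y}" "mink y y < 0" unfolding time_like_def by blast
  then have "y \<in> P" "mink y y < 0" "y \<noteq> 0" by (auto simp: span_base mink_def)
  with \<open>space_like P\<close> show False unfolding space_like_def by force
qed

lemma space_like_not_light_like: "space_like P \<Longrightarrow> \<not> light_like P"
  unfolding space_like_def light_like_def by (metis less_irrefl)

lemma time_like_not_light_like: "time_like P \<Longrightarrow> \<not> light_like P"
proof
  assume "time_like P" "light_like P"
  then obtain x y z where xy: "P = span {x, y}" "mink x y = 0" "mink x x > 0" "mink y y < 0"
    and z: "z \<in> P" "z \<noteq> 0" "\<forall>w\<in>P. mink z w = 0" unfolding time_like_def light_like_def by blast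
  obtain a b where zab: "z = a *\<^sub>R x + b *\<^sub>R y"
    using z(1) unfolding xy(1) by (auto simp: span_insert span_singleton) (metis diff_add_cancel add.commute)
  have "mink z x = a * mink x x + b * mink x y" "mink z y = a * mink x y + b * mink y y"
    by (simp_all add: zab mink_def algebra_simps)
  moreover have "mink z x = 0" "mink z y = 0" using z(3) by (simp_all add: xy(1) span_base)
  ultimately have "a = 0" "b = 0" using xy by auto
  with zab z(2) show False by simp
qed

section \<open>Classification under conjugate similarity\<close>

lemma SL2_diagonalize:
  fixes r :: real and b :: complex
  assumes "r > 0" "r \<noteq> 1"
  shows "mat2 (of_real r) b 0 (1 / of_real r) \<sim>\<^sub>c mat2 (of_real r) 0 0 (1 / of_real r)"
proof -
  \<comment> \<open>A shear T with entry t subtracts r t - cnj t / r from b. This real linear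
    equation decouples: the factor is r - 1/r on real parts and r + 1/r on imaginary parts, and only
    the first needs r \<noteq> 1.\<close>
  define t where "t = Complex (Re b / (r - 1 / r)) (Im b / (r + 1 / r))"
  have "r * r \<noteq> 1" using assms by (auto simp: square_eq_1_iff)
  then have nz: "r - 1 / r \<noteq> 0" using assms by (simp add: field_simps)
  have "r * (Re b / (r - 1 / r)) - (Re b / (r - 1 / r)) / r = (r - 1 / r) * (Re b / (r - 1 / r))"
    by (simp only: left_diff_distrib times_divide_eq_left mult_1_left)
  also have "\<dots> = Re b" using nz by simp
  finally have 1: "r * (Re b / (r - 1 / r)) - (Re b / (r - 1 / r)) / r = Re b" .
  have "r + 1 / r > 0" using assms by (simp add: add_pos_pos)
  then have nz': "r + 1 / r \<noteq> 0" by simp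
  have "r * (Im b / (r + 1 / r)) + (Im b / (r + 1 / r)) / r = (r + 1 / r) * (Im b / (r + 1 / r))"
    by (simp only: distrib_right times_divide_eq_left mult_1_left)
  also have "\<dots> = Im b" using nz' by simp
  finally have 2: "r * (Im b / (r + 1 / r)) + (Im b / (r + 1 / r)) / r = Im b" .
  have t: "of_real r * t - cnj t / of_real r = b"
    using 1 2 by (simp add: complex_eq_iff t_def)
  then show ?thesis using assms(1)
    by (intro conj_similar_mat2I[of 1 1 t 0]) (auto simp: mat2_mult t[symmetric] field_simps)
qed

lemma SL2_triangular_classification:
  fixes r :: real and b :: complex
  assumes "r > 0"
  defines "S \<equiv> mat2 (of_real r) b 0 (1 / of_real r)"
  shows "S \<sim>\<^sub>c mat2 1 0 0 1 \<or> S \<sim>\<^sub>c mat2 1 1 0 1 \<or>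
    (\<exists>u>0. S \<sim>\<^sub>c mat2 (of_real (exp u)) 0 0 (of_real (exp (- u))))"
proof (cases "r = 1")
  case False
  then have S: "S \<sim>\<^sub>c mat2 (of_real r) 0 0 (1 / of_real r)"
    unfolding S_def using assms(1) by (rule SL2_diagonalize[rotated])
  have "\<exists>u>0. S \<sim>\<^sub>c mat2 (of_real (exp u)) 0 0 (of_real (exp (- u)))"
  proof (cases "r > 1")
    case True
    then show ?thesis using S
      by (intro exI[of _ "ln r"]) (simp add: exp_minus inverse_eq_divide)
  next
    case less: False
    \<comment> \<open>The matrix with rows (0, -1) and (1, 0) exchanges the diagonal entries, so
      that the larger one comes first.\<close>
    have "mat2 (of_real r) 0 0 (1 / of_real r) \<sim>\<^sub>c mat2 (1 / of_real r) 0 0 (of_real r)"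
      by (intro conj_similar_mat2I[of 0 0 "-1" 1]) (auto simp: mat2_mult)
    then show ?thesis using conj_similar_trans[OF S] False less assms(1)
      by (intro exI[of _ "- ln r"]) (simp add: exp_minus inverse_eq_divide)
  qed
  then show ?thesis by blast
next
  case True
  \<comment> \<open>For r = 1 a shear changes b only by t - cnj t, which is imaginary: the imaginary
    part of b can be removed, the real part only rescaled.\<close>
  have S: "S \<sim>\<^sub>c mat2 1 (of_real (Re b)) 0 1"
    unfolding S_def True
    by (intro conj_similar_mat2I[of 1 1 "Complex 0 (Im b / 2)" 0]) (auto simp: mat2_mult complex_eq_iff)
  consider "Re b = 0" | "Re b > 0" | "Re b < 0" by linarith
  then show ?thesis
  proof cases
    case 1
    then show ?thesis using S by simp
  next
    case 2
    define s where "s = complex_of_real (sqrt (Re b))"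
    have s: "s \<noteq> 0" "s * s = of_real (Re b)" "cnj s = s" using 2 by (simp_all add: s_def flip: of_real_mult)
    have "mat2 1 (of_real (Re b)) 0 1 \<sim>\<^sub>c mat2 1 1 0 1"
      by (intro conj_similar_mat2I[of "1/s" s 0 0]) (auto simp: mat2_mult s(1,3) s(2)[symmetric])
    then show ?thesis using conj_similar_trans[OF S] by blast
  next
    case 3
    define s where "s = complex_of_real (sqrt (- Re b))"
    have "s * s = of_real (- Re b)" using 3 unfolding s_def of_real_mult[symmetric] by simp
    then have s: "s \<noteq> 0" "of_real (Re b) = - (s * s)" "cnj s = s" using 3 by (auto simp: s_def)
    have "mat2 1 (of_real (Re b)) 0 1 \<sim>\<^sub>c mat2 1 1 0 1"
      \<comment> \<open>The imaginary diagonal T produces -\<open>mat2 1 1 0 1\<close>; the sign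
        permitted in conjugate similarity is what brings a negative real part to the same normal
        form.\<close>
      by (intro conj_similar_mat2I[of "\<i> / s" "- \<i> * s" 0 0]) (auto simp: mat2_mult s mat2_uminus)
    then show ?thesis using conj_similar_trans[OF S] by blast
  qed
qed

lemma SL2_conj_eigenvector_classification:
  assumes "S \<in> SL2" "conj_eigenratios S \<noteq> {}"
  shows "S \<sim>\<^sub>c mat2 1 0 0 1 \<or> S \<sim>\<^sub>c mat2 1 1 0 1 \<or>
    (\<exists>u>0. S \<sim>\<^sub>c mat2 (of_real (exp u)) 0 0 (of_real (exp (- u))))"
proof -
  obtain a b c d where S: "S = mat2 a b c d" "a * d - b * c = 1" using assms(1) by (rule SL2_cases)
  obtain v r where v: "v \<noteq> 0" and "r \<ge> 0" and ev: "S *v v = of_real r *s cnj_vec v"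
    using assms(2) unfolding conj_eigenratios_def conj_eigenvector_def by auto
  define x y where "x = v$1" and "y = v$2"
  have nz: "x \<noteq> 0 \<or> y \<noteq> 0" using v by (simp add: vec_eq_iff forall_2 x_def y_def)
  have e: "a * x + b * y = of_real r * cnj x" "c * x + d * y = of_real r * cnj y"
    using ev by (simp_all add: S(1) mat2_mulv vec_eq_iff forall_2 cnj_vec_def x_def y_def)
  have "r \<noteq> 0" using mat2_kernel[of a d b c, OF _ nz] S(2) e by auto
  with \<open>r \<ge> 0\<close> have "r > 0" by simp
  \<comment> \<open>Completes v to a determinant one matrix with first column v, the inverse of T.
    Then S' maps the first basis vector to r times itself, since cnj T sends cnj v to that
    vector.\<close>
  obtain x' y' where xy: "x' * x - y' * y = 1"
  proof (cases "x = 0")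
    case True
    then show ?thesis using that[of 0 "-1/y"] nz by simp
  next
    case False
    then show ?thesis using that[of "1/x" 0] by simp
  qed
  have cxy: "cnj x' * cnj x - cnj y' * cnj y = 1" using arg_cong[OF xy, of cnj] by simp
  define T where "T = mat2 x' (- y') (- y) x"
  have T: "T \<in> SL2" using xy by (simp add: T_def mat2_in_SL2)
  have inv: "matrix_inv T = mat2 x y' y x'" using xy by (simp add: T_def matrix_inv_mat2)
  define S' where "S' = cnj_mat T ** S ** matrix_inv T"
  have "S' \<in> SL2" unfolding S'_def using T assms(1) by (intro SL2_mult SL2_cnj SL2_inv)
  have sim: "S \<sim>\<^sub>c S'" by (rule conj_similarI[OF T]) (simp add: S'_def)
  have "S' $ 1 $ 1 = cnj x' * (a * x + b * y) - cnj y' * (c * x + d * y)"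
    "S' $ 2 $ 1 = cnj x * (c * x + d * y) - cnj y * (a * x + b * y)"
    unfolding S'_def inv unfolding S(1) T_def cnj_mat2 mat2_mult by (simp_all add: algebra_simps)
  then have "S' $ 1 $ 1 = of_real r * (cnj x' * cnj x - cnj y' * cnj y)" "S' $ 2 $ 1 = 0"
    unfolding e by (simp_all add: algebra_simps)
  then have "S' $ 1 $ 1 = of_real r" "S' $ 2 $ 1 = 0" by (simp_all add: cxy)
  moreover have "S' $ 1 $ 1 * S' $ 2 $ 2 - S' $ 1 $ 2 * S' $ 2 $ 1 = 1"
    using \<open>S' \<in> SL2\<close> by (metis mat2_eta mat2_in_SL2)
  ultimately have "S' = mat2 (of_real r) (S' $ 1 $ 2) 0 (1 / of_real r)"
    using \<open>r > 0\<close> by (subst mat2_eta) (simp add: field_simps)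
  with SL2_triangular_classification[OF \<open>r > 0\<close>, of "S' $ 1 $ 2"] show ?thesis
    using conj_similar_trans[OF sim] by auto
qed

text \<open>The root l of the characteristic polynomial comes from the quadratic formula, and (q, l
  - p) is an eigenvector unless q = 0.\<close>

lemma mat2_eigenvector:
  fixes p q r s :: complex
  obtains l x y where "x \<noteq> 0 \<or> y \<noteq> 0" "p * x + q * y = l * x" "r * x + s * y = l * y"
proof (cases "q = 0")
  case True
  then show ?thesis using that[of 0 1 s] by simp
next
  case False
  define D where "D = csqrt ((p + s) * (p + s) - 4 * (p * s - q * r))"
  have D: "D * D = (p + s) * (p + s) - 4 * (p * s - q * r)"
    by (simp add: D_def flip: power2_eq_square)
  define l where "l = (p + s + D) / 2"
  have l: "2 * l = p + s + D" by (simp add: l_def)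
  have "4 * (l * l - (p + s) * l + (p * s - q * r)) = (2 * l) * (2 * l) - 2 * (p + s) * (2 * l) + 4 * (p * s - q * r)"
    by algebra
  also have "\<dots> = 0" unfolding l using D by algebra
  finally have "l * l - (p + s) * l + (p * s - q * r) = 0"
    by (metis mult_eq_0_iff zero_neq_numeral)
  then have "r * q + s * (l - p) = l * (l - p)" by algebra
  then show ?thesis using that[of q "l - p" l] False by (simp add: algebra_simps)
qed

text \<open>The inverse of T gets the columns \<alpha> v and \<beta> w. As S exchanges the two lines
  up to conjugation, the diagonal of S' vanishes; determinant 1 then fixes the upper right entry as
  -1/X, which is -cnj X on the unit circle.\<close>

lemma SL2_antidiagonal_representative:
  assumes "S \<in> SL2" "conj_eigenratios S = {}"
  obtains X where "norm X = 1" "S \<sim>\<^sub>c mat2 0 (- cnj X) X 0"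
proof -
  obtain a b c d where S: "S = mat2 a b c d" "a * d - b * c = 1" using assms(1) by (rule SL2_cases)
  obtain l x y where nz: "x \<noteq> 0 \<or> y \<noteq> 0"
    and ev: "(cnj a * a + cnj b * c) * x + (cnj a * b + cnj b * d) * y = l * x"
      "(cnj c * a + cnj d * c) * x + (cnj c * b + cnj d * d) * y = l * y"
    by (rule mat2_eigenvector)
  \<comment> \<open>With \<open>v = (x, y)\<close> and \<open>w = cnj (S v)\<close>, \<open>S\<close> maps \<open>v\<close> to \<open>cnj w\<close> and \<open>w\<close> to a multiple of \<open>cnj v\<close>;
    \<open>\<delta> = det (v, w)\<close> vanishes only if \<open>v\<close> is a conjugate eigenvector up to phase.\<close>
  define m n where "m = a * x + b * y" and "n = c * x + d * y"
  have mn: "cnj a * m + cnj b * n = l * x" "cnj c * m + cnj d * n = l * y"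
    using ev by (simp_all add: m_def n_def algebra_simps)
  have mn': "a * cnj m + b * cnj n = cnj l * cnj x" "c * cnj m + d * cnj n = cnj l * cnj y"
    using mn[THEN arg_cong[of _ _ cnj]] by simp_all
  define \<delta> where "\<delta> = x * cnj n - y * cnj m"
  have cd: "cnj \<delta> = cnj x * n - cnj y * m" by (simp add: \<delta>_def)
  have "moebius S (ratio x y) \<noteq> cnj_sphere (ratio x y)"
    using assms conj_eigenratios_eq by blast
  moreover have "m \<noteq> 0 \<or> n \<noteq> 0" unfolding m_def n_def using S(2) nz by (intro mat2_kernel) auto
  ultimately have "m * cnj y \<noteq> cnj x * n"
    using nz by (simp add: S(1) moebius_ratio cnj_sphere_ratio ratio_eq_iff m_def n_def)
  then have "cnj \<delta> \<noteq> 0" by (auto simp: cd mult.commute)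
  then have "\<delta> \<noteq> 0" by simp
  \<comment> \<open>The scale of v is chosen so that the lower left entry, which is \<alpha>^2 cnj
    \<delta>, has modulus 1; \<beta> then restores determinant 1.\<close>
  define \<alpha> where "\<alpha> = complex_of_real (1 / sqrt (norm \<delta>))"
  have \<alpha>: "\<alpha> \<noteq> 0" "cnj \<alpha> = \<alpha>" "\<alpha> * \<alpha> = 1 / of_real (norm \<delta>)"
    using \<open>\<delta> \<noteq> 0\<close> by (simp_all add: \<alpha>_def flip: of_real_mult)
  define \<beta> where "\<beta> = 1 / (\<alpha> * \<delta>)"
  have "\<alpha> * \<beta> * \<delta> = 1" using \<alpha>(1) \<open>\<delta> \<noteq> 0\<close> by (simp add: \<beta>_def)
  then have det: "(\<beta> * cnj n) * (\<alpha> * x) - (- \<beta> * cnj m) * (- \<alpha> * y) = 1"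
    unfolding \<delta>_def by (simp add: algebra_simps)
  define T where "T = mat2 (\<beta> * cnj n) (- \<beta> * cnj m) (- \<alpha> * y) (\<alpha> * x)"
  have T: "T \<in> SL2" using det by (simp add: T_def mat2_in_SL2)
  have inv: "matrix_inv T = mat2 (\<alpha> * x) (\<beta> * cnj m) (\<alpha> * y) (\<beta> * cnj n)"
    using matrix_inv_mat2[OF det] by (simp add: T_def)
  define S' where "S' = cnj_mat T ** S ** matrix_inv T"
  have "S' \<in> SL2" unfolding S'_def using T assms(1) by (intro SL2_mult SL2_cnj SL2_inv)
  have sim: "S \<sim>\<^sub>c S'" by (rule conj_similarI[OF T]) (simp add: S'_def)
  have "S' $ 1 $ 1 = cnj \<beta> * \<alpha> * (n * (a * x + b * y) - m * (c * x + d * y))"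
    "S' $ 2 $ 1 = cnj \<alpha> * \<alpha> * (cnj x * (c * x + d * y) - cnj y * (a * x + b * y))"
    "S' $ 2 $ 2 = cnj \<alpha> * \<beta> * (cnj x * (c * cnj m + d * cnj n) - cnj y * (a * cnj m + b * cnj n))"
    unfolding S'_def inv unfolding S(1) T_def cnj_mat2 mat2_mult by (simp_all add: algebra_simps)
  then have e: "S' $ 1 $ 1 = 0" "S' $ 2 $ 1 = cnj \<delta> / of_real (norm \<delta>)" "S' $ 2 $ 2 = 0"
    unfolding mn' m_def[symmetric] n_def[symmetric] cd[symmetric] \<alpha>(2) \<alpha>(3) by (simp_all add: mult.commute)
  define X where "X = cnj \<delta> / of_real (norm \<delta>)"
  have X: "norm X = 1" using \<open>\<delta> \<noteq> 0\<close> by (simp add: X_def norm_divide)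
  then have XX: "cnj X * X = 1" by (simp add: complex_norm_square[symmetric] mult.commute)
  have "S' $ 1 $ 1 * S' $ 2 $ 2 - S' $ 1 $ 2 * S' $ 2 $ 1 = 1"
    using \<open>S' \<in> SL2\<close> by (metis mat2_eta mat2_in_SL2)
  then have "S' $ 1 $ 2 * X = - 1" unfolding e X_def[symmetric] by algebra
  then have "S' $ 1 $ 2 = - cnj X" using XX
    by (metis mult.commute mult.left_commute mult.right_neutral mult_minus_right)
  then have "S' = mat2 0 (- cnj X) X 0" using e by (subst mat2_eta) (simp add: X_def)
  then show ?thesis using that X sim by simp
qed

text \<open>The remaining unit number X matters only up to X -> -X (the sign of S) and X -> cnj X
  (exchange of the basis vectors). These reflections bring it to the quadrant Re \<le> 0, Im \<ge>
  0, one quarter of the circle.\<close>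

lemma SL2_no_conj_eigenvector_classification:
  assumes "S \<in> SL2" "conj_eigenratios S = {}"
  shows "\<exists>\<alpha>. 0 < \<alpha> \<and> \<alpha> \<le> pi / 2 \<and>
    S \<sim>\<^sub>c mat2 0 (\<i> * exp (- (\<i> * of_real \<alpha>))) (\<i> * exp (\<i> * of_real \<alpha>)) 0"
proof -
  obtain X where X: "norm X = 1" "S \<sim>\<^sub>c mat2 0 (- cnj X) X 0"
    using SL2_antidiagonal_representative[OF assms] .
  have neg: "S \<sim>\<^sub>c mat2 0 (- cnj (- Y)) (- Y) 0" if "S \<sim>\<^sub>c mat2 0 (- cnj Y) Y 0" for Y
    using conj_similar_trans[OF that conj_similar_uminus] by (simp add: mat2_uminus)
  have conj: "S \<sim>\<^sub>c mat2 0 (- cnj (cnj Y)) (cnj Y) 0" if "S \<sim>\<^sub>c mat2 0 (- cnj Y) Y 0" for Y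
    using conj_similar_trans[OF that, of "mat2 0 (- cnj (cnj Y)) (cnj Y) 0"]
    by (rule meta_mp) (intro conj_similar_mat2I[of 0 0 "-1" 1], auto simp: mat2_mult)
  obtain Y where Y: "norm Y = 1" "Re Y \<le> 0" "Im Y \<ge> 0" "S \<sim>\<^sub>c mat2 0 (- cnj Y) Y 0"
  proof -
    obtain Z where Z: "norm Z = 1" "Re Z \<le> 0" "S \<sim>\<^sub>c mat2 0 (- cnj Z) Z 0"
      using that[of X] that[of "- X"] X neg[OF X(2)] by (cases "Re X \<le> 0") auto
    then show ?thesis using that[of Z] that[of "cnj Z"] conj[OF Z(3)] by (cases "Im Z \<ge> 0") auto
  qed
  \<comment> \<open>Chosen so that Y = i exp (i \<alpha>), that is Im Y = cos \<alpha> and Re Y = -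
    sin \<alpha>.\<close>
  define \<alpha> where "\<alpha> = arccos (Im Y)"
  have "\<bar>Im Y\<bar> \<le> 1" using Y(1) abs_Im_le_cmod[of Y] by simp
  then have cos: "cos \<alpha> = Im Y" and "0 \<le> \<alpha>"
    using Y(3) by (simp_all add: \<alpha>_def cos_arccos_abs arccos_lbound)
  moreover have "\<alpha> \<le> pi / 2"
    unfolding \<alpha>_def using Y(3) \<open>\<bar>Im Y\<bar> \<le> 1\<close> by (intro arccos_le_pi2) auto
  ultimately have range: "0 \<le> \<alpha>" "\<alpha> \<le> pi / 2" by auto
  have "sin \<alpha> \<ge> 0" using range by (intro sin_ge_zero) auto
  moreover have "(sin \<alpha>)\<^sup>2 = (Re Y)\<^sup>2"
    using Y(1) cmod_power2[of Y] sin_cos_squared_add[of \<alpha>] cos by simp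
  ultimately have sin: "sin \<alpha> = - Re Y" using Y(2) by (auto simp: power2_eq_iff)
  have exps: "\<i> * exp (\<i> * of_real \<alpha>) = Y" "\<i> * exp (- (\<i> * of_real \<alpha>)) = - cnj Y"
    using cis_conv_exp[of \<alpha>] cis_conv_exp[of "- \<alpha>"] by (simp_all add: complex_eq_iff sin cos flip: cis_conv_exp)
  \<comment> \<open>The endpoint \<alpha> = 0 gives a matrix for which 1 is a conjugate eigenratio,
    against the assumption on S.\<close>
  have "\<alpha> \<noteq> 0"
  proof
    assume "\<alpha> = 0"
    then have "Y = \<i>" using sin cos by (simp add: complex_eq_iff)
    then have sim: "S \<sim>\<^sub>c mat2 0 \<i> \<i> 0" using Y(4) by simp
    have "Some 1 \<in> conj_eigenratios (mat2 0 \<i> \<i> 0)"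
      by (subst conj_eigenratios_eq) (simp_all add: mat2_in_SL2 ratio_def cnj_sphere_def)
    moreover obtain f where "bij_betw f (conj_eigenratios S) (conj_eigenratios (mat2 0 \<i> \<i> 0))"
      using conj_eigenratios_conj_similar[OF sim assms(1)] .
    ultimately show False using assms(2) by (auto simp: bij_betw_def)
  qed
  then show ?thesis using range Y(4) exps by (intro exI[of _ \<alpha>]) auto
qed

section \<open>Conjugate eigenratios of the four normal forms\<close>

lemma conj_eigenratios_identity: "conj_eigenratios (mat2 1 0 0 1) = insert None (Some ` \<real>)"
proof -
  have "(moebius (mat2 1 0 0 1) p = cnj_sphere p) \<longleftrightarrow> p \<in> insert None (Some ` \<real>)" for p
    by (cases p) (auto simp: ratio_def cnj_sphere_def Reals_cnj_iff)
  then show ?thesis by (subst conj_eigenratios_eq) (auto simp: mat2_in_SL2)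
qed

lemma conj_eigenratios_parabolic: "conj_eigenratios (mat2 1 1 0 1) = {None}"
proof -
  have "(moebius (mat2 1 1 0 1) p = cnj_sphere p) \<longleftrightarrow> p = None" for p
    by (cases p) (auto simp: ratio_def cnj_sphere_def complex_eq_iff)
  then show ?thesis by (subst conj_eigenratios_eq) (auto simp: mat2_in_SL2)
qed

lemma conj_eigenratios_hyperbolic:
  fixes u :: real
  assumes "u > 0"
  shows "conj_eigenratios (mat2 (of_real (exp u)) 0 0 (of_real (exp (- u)))) = {None, Some 0}"
proof -
  let ?S = "mat2 (of_real (exp u)) 0 0 (of_real (exp (- u)))"
  have "(moebius ?S p = cnj_sphere p) \<longleftrightarrow> p \<in> {None, Some 0}" for p
  proof (cases p)
    case (Some w)
    have "w = 0" if "of_real (exp u) * w / of_real (exp (- u)) = cnj w"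
    proof -
      \<comment> \<open>Taking norms removes the conjugation: a dilation by a factor other than 1
        moves every finite nonzero point to another modulus.\<close>
      from that have "norm (of_real (exp u) * w / of_real (exp (- u))) = norm w" by simp
      then have "exp u * norm w = exp (- u) * norm w" by (simp add: norm_mult norm_divide field_simps)
      then show ?thesis using assms by simp
    qed
    then show ?thesis by (auto simp: Some ratio_def cnj_sphere_def)
  qed (auto simp: ratio_def cnj_sphere_def)
  then show ?thesis by (subst conj_eigenratios_eq) (auto simp: mat2_in_SL2 simp flip: of_real_mult exp_add)
qed

lemma conj_eigenratios_elliptic:
  fixes \<alpha> :: real
  assumes "0 < \<alpha>" "\<alpha> \<le> pi / 2"
  defines "S \<equiv> mat2 0 (\<i> * exp (- (\<i> * of_real \<alpha>))) (\<i> * exp (\<i> * of_real \<alpha>)) 0"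
  shows "S \<in> SL2" "conj_eigenratios S = {}"
proof -
  show SL: "S \<in> SL2" by (simp add: S_def mat2_in_SL2 exp_minus field_simps)
  have "moebius S p \<noteq> cnj_sphere p" for p
  proof (cases p)
    case (Some w)
    show ?thesis
    proof
      assume "moebius S p = cnj_sphere p"
      then have w: "w \<noteq> 0" "\<i> * exp (- (\<i> * of_real \<alpha>)) / (\<i> * exp (\<i> * of_real \<alpha>) * w) = cnj w"
        by (auto simp: S_def Some ratio_def cnj_sphere_def split: if_splits)
      then have "exp (- (\<i> * of_real \<alpha>)) = exp (\<i> * of_real \<alpha>) * (w * cnj w)" by (simp add: field_simps)
      then have "exp (- (\<i> * of_real \<alpha>)) = exp (\<i> * of_real \<alpha>) * of_real ((norm w)\<^sup>2)"
        by (simp add: complex_norm_square del: of_real_power)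
      then have e: "cis (- \<alpha>) = cis \<alpha> * of_real ((norm w)\<^sup>2)" by (simp add: cis_conv_exp)
      \<comment> \<open>Imaginary parts: a nonnegative multiple of cis \<alpha> cannot lie in the
        lower half plane when sin \<alpha> > 0.\<close>
      then have "- sin \<alpha> = sin \<alpha> * (norm w)\<^sup>2" by (simp add: complex_eq_iff)
      moreover have "sin \<alpha> > 0" using assms(1,2) by (intro sin_gt_zero) auto
      moreover have "sin \<alpha> * (norm w)\<^sup>2 \<ge> 0" using calculation by simp
      ultimately show False by linarith
    qed
  qed (auto simp: S_def ratio_def cnj_sphere_def)
  then show "conj_eigenratios S = {}" by (simp add: conj_eigenratios_eq[OF SL])
qed

section \<open>Types and invariants of the normal forms\<close>

lemma totally_real_Im:
  assumes "totally_real A"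
  shows "Im (A $ i * cnj (A $ j)) = 0"
proof -
  obtain u where "pt A = pt (of_real_vec u)" using assms unfolding totally_real_def by blast
  then obtain c where "A = c *s of_real_vec u" by (rule pt_eqE)
  \<comment> \<open>The common complex factor c enters only as |c|^2, so a single product with
    nonzero imaginary part refutes total reality.\<close>
  then have "A $ i * cnj (A $ j) = (c * cnj c) * of_real (u $ i * u $ j)"
    by (simp add: of_real_vec_def)
  then show ?thesis by (simp add: complex_mult_cnj del: of_real_power)
qed

lemma hyperbolic_type_normal_form:
  fixes u :: real
  assumes "u > 0"
  shows "hyperbolic_type (vector [of_real (sinh u), \<i> * of_real (cosh u), 0, 0])"
proof -
  define B :: "complex ^ 4" where "B = vector [of_real (sinh u), \<i> * of_real (cosh u), 0, 0]"
  have "Im (B $ 1 * cnj (B $ 2)) \<noteq> 0" using assms by (simp add: B_def)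
  then have "\<not> totally_real B" using totally_real_Im by blast
  moreover have "real_plane B \<subseteq> {x. x $ 3 = 0 \<and> x $ 4 = 0}"
    unfolding real_plane_def
    by (rule span_minimal) (auto simp: subspace_def B_def Re_vec_def Im_vec_def)
  then have "space_like (real_plane B)"
    unfolding space_like_def
    by (auto simp: mink_def vec_eq_iff forall_4 sum_power2_gt_zero_iff simp flip: power2_eq_square)
  ultimately show ?thesis by (simp add: hyperbolic_type_def B_def)
qed

lemma elliptic_type_normal_form:
  fixes \<alpha> :: real
  assumes "0 < \<alpha>" "\<alpha> < pi / 2"
  shows "elliptic_type (vector [0, 0, of_real (cos \<alpha>), \<i> * of_real (sin \<alpha>)])"
proof -
  define B :: "complex ^ 4" where "B = vector [0, 0, of_real (cos \<alpha>), \<i> * of_real (sin \<alpha>)]"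
  have pos: "sin \<alpha> > 0" "cos \<alpha> > 0" using assms by (auto intro: sin_gt_zero cos_gt_zero)
  then have "Im (B $ 3 * cnj (B $ 4)) \<noteq> 0" by (simp add: B_def)
  then have "\<not> totally_real B" using totally_real_Im by blast
  moreover have "time_like (real_plane B)"
    unfolding time_like_def real_plane_def using pos
    by (intro exI[of _ "Re_vec B"] exI[of _ "Im_vec B"]) (simp add: B_def Re_vec_def Im_vec_def mink_def)
  ultimately show ?thesis by (simp add: elliptic_type_def B_def)
qed

lemma parabolic_type_normal_form: "parabolic_type (vector [1, 0, \<i>, \<i>])"
proof -
  define B :: "complex ^ 4" where "B = vector [1, 0, \<i>, \<i>]"
  have "Im (B $ 1 * cnj (B $ 3)) \<noteq> 0" by (simp add: B_def)
  then have "\<not> totally_real B" using totally_real_Im by blast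
  moreover have "real_plane B \<subseteq> {x. x $ 3 = x $ 4}"
    unfolding real_plane_def
    by (rule span_minimal) (auto simp: subspace_def B_def Re_vec_def Im_vec_def)
  then have "light_like (real_plane B)"
    unfolding light_like_def
    by (intro bexI[of _ "Im_vec B"])
      (auto simp: real_plane_def span_base mink_def B_def Im_vec_def vec_eq_iff forall_4)
  ultimately show ?thesis by (simp add: parabolic_type_def B_def)
qed

lemma totally_real_of_real_vec: "totally_real (of_real_vec u)"
  unfolding totally_real_def by blast

lemma totally_real_normal_forms:
  "totally_real (vector [1, 0, 0, 0])" "totally_real (vector [0, 0, 0, 1])"
proof -
  have "vector [1, 0, 0, 0] = (of_real_vec (vector [1, 0, 0, 0]) :: complex ^ 4)"
    "vector [0, 0, 0, 1] = (of_real_vec (vector [0, 0, 0, 1]) :: complex ^ 4)"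
    by (simp_all add: of_real_vec_def vec_eq_iff forall_4)
  then show "totally_real (vector [1, 0, 0, 0])" "totally_real (vector [0, 0, 0, 1])"
    by (metis totally_real_of_real_vec)+
qed

lemma kappa_normal_forms:
  fixes u \<alpha> :: real
  shows "kappa (vector [1, 0, 0, 0]) = 1" "kappa (vector [0, 0, 0, 1]) = -1"
    "kappa (vector [1, 0, \<i>, \<i>]) = 1"
    "kappa (vector [of_real (sinh u), \<i> * of_real (cosh u), 0, 0]) = 1 + 2 * (sinh u)\<^sup>2"
    "kappa (vector [0, 0, of_real (cos \<alpha>), \<i> * of_real (sin \<alpha>)]) = 1 - 2 * (sin \<alpha>)\<^sup>2"
proof -
  show "kappa (vector [1, 0, 0, 0]) = 1" "kappa (vector [0, 0, 0, 1]) = -1"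
    "kappa (vector [1, 0, \<i>, \<i>]) = 1"
    by (simp_all add: kappa_def mink_def cnj_vec_def)
  have "(sinh u)\<^sup>2 - (cosh u)\<^sup>2 = -1" "(cos \<alpha>)\<^sup>2 + (sin \<alpha>)\<^sup>2 = 1"
    by (simp_all add: cosh_square_eq)
  then have "complex_of_real (sinh u) * of_real (sinh u) - of_real (cosh u) * of_real (cosh u) = -1"
    "complex_of_real (cos \<alpha>) * of_real (cos \<alpha>) + of_real (sin \<alpha>) * of_real (sin \<alpha>) = 1"
    by (simp_all flip: of_real_mult of_real_diff of_real_add add: power2_eq_square)
  then have m: "mink (vector [of_real (sinh u), \<i> * of_real (cosh u), 0, 0]) (vector [of_real (sinh u), \<i> * of_real (cosh u), 0, 0]) = (-1 :: complex)"
    "mink (vector [0, 0, of_real (cos \<alpha>), \<i> * of_real (sin \<alpha>)]) (vector [0, 0, of_real (cos \<alpha>), \<i> * of_real (sin \<alpha>)]) = (1 :: complex)"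
    by (simp_all add: mink_def algebra_simps)
  have "cosh u * cosh u = sinh u * sinh u + 1" "cos \<alpha> * cos \<alpha> = 1 - sin \<alpha> * sin \<alpha>"
    using cosh_square_eq[of u] cos_squared_eq[of \<alpha>] by (simp_all only: power2_eq_square)
  then show "kappa (vector [of_real (sinh u), \<i> * of_real (cosh u), 0, 0]) = 1 + 2 * (sinh u)\<^sup>2"
    "kappa (vector [0, 0, of_real (cos \<alpha>), \<i> * of_real (sin \<alpha>)]) = 1 - 2 * (sin \<alpha>)\<^sup>2"
    unfolding kappa_def m by (simp_all add: mink_def cnj_vec_def power2_eq_square)
qed

lemma pt_Avec_hyperbolic:
  fixes u :: real
  shows "pt (Avec (mat2 (of_real (exp u)) 0 0 (of_real (exp (- u))))) =
    pt (vector [of_real (sinh u), \<i> * of_real (cosh u), 0, 0])"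
  by (rule arg_cong[of _ _ pt], rule vec4_eqI) (simp_all add: Avec_mat2 sinh_field_def cosh_field_def)

lemma pt_Avec_elliptic:
  fixes \<alpha> :: real
  shows "pt (Avec (mat2 0 (\<i> * exp (- (\<i> * of_real \<alpha>))) (\<i> * exp (\<i> * of_real \<alpha>)) 0)) =
    pt (vector [0, 0, of_real (cos \<alpha>), \<i> * of_real (sin \<alpha>)])"
proof -
  have e: "exp (\<i> * of_real \<alpha>) = of_real (cos \<alpha>) + \<i> * of_real (sin \<alpha>)"
    "exp (- (\<i> * of_real \<alpha>)) = of_real (cos \<alpha>) - \<i> * of_real (sin \<alpha>)"
    using exp_Euler[of "of_real \<alpha>"] exp_minus_Euler[of "of_real \<alpha>"]
    by (simp_all add: cos_of_real sin_of_real)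
  have "Avec (mat2 0 (\<i> * exp (- (\<i> * of_real \<alpha>))) (\<i> * exp (\<i> * of_real \<alpha>)) 0) =
    \<i> *s vector [0, 0, of_real (cos \<alpha>), \<i> * of_real (sin \<alpha>)]"
    unfolding e by (rule vec4_eqI) (simp_all add: Avec_mat2 algebra_simps)
  then show ?thesis by (simp add: pt_scale)
qed

text \<open>\<open>Avec\<close> of the identity is (0, i, 0, 0), not the stated representative. The
  similarity realizes the rotation that brings it to the first axis; the factor i disappears in
  projective space.\<close>

lemma conj_similar_identity:
  "mat2 1 0 0 1 \<sim>\<^sub>c mat2 \<i> 0 0 (- \<i>)" "pt (Avec (mat2 \<i> 0 0 (- \<i>))) = pt (vector [1, 0, 0, 0])"
proof -
  show "mat2 1 0 0 1 \<sim>\<^sub>c mat2 \<i> 0 0 (- \<i>)"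
    by (intro conj_similar_mat2I[of 0 0 "-(1 - \<i>) / 2" "1 + \<i>"]) (auto simp: mat2_mult field_simps)
  have "Avec (mat2 \<i> 0 0 (- \<i>)) = \<i> *s vector [1, 0, 0, 0]"
    by (rule vec4_eqI) (simp_all add: Avec_mat2)
  then show "pt (Avec (mat2 \<i> 0 0 (- \<i>))) = pt (vector [1, 0, 0, 0])" by (simp add: pt_scale)
qed

text \<open>The same T as for the identity, now applied to the Jordan block.\<close>

lemma conj_similar_parabolic:
  "mat2 1 1 0 1 \<sim>\<^sub>c mat2 \<i> 0 (- 2) (- \<i>)"
  "pt (Avec (mat2 \<i> 0 (- 2) (- \<i>))) = pt (vector [1, 0, \<i>, \<i>])"
proof -
  show "mat2 1 1 0 1 \<sim>\<^sub>c mat2 \<i> 0 (- 2) (- \<i>)"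
    by (intro conj_similar_mat2I[of 0 0 "-(1 - \<i>) / 2" "1 + \<i>"]) (auto simp: mat2_mult field_simps)
  have "Avec (mat2 \<i> 0 (- 2) (- \<i>)) = \<i> *s vector [1, 0, \<i>, \<i>]"
    by (rule vec4_eqI) (simp_all add: Avec_mat2)
  then show "pt (Avec (mat2 \<i> 0 (- 2) (- \<i>))) = pt (vector [1, 0, \<i>, \<i>])" by (simp add: pt_scale)
qed

section \<open>Conformal structure\<close>

text \<open>Complex homogeneity is demanded separately because \<open>bounded_linear\<close> only
  means real linear.\<close>

definition complex_functional :: "(complex ^ 'n \<Rightarrow> complex) \<Rightarrow> bool" where
  "complex_functional \<phi> \<longleftrightarrow> bounded_linear \<phi> \<and> (\<forall>c v. \<phi> (c *s v) = c * \<phi> v)"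

lemma complex_functional_nth: "complex_functional (\<lambda>z. z $ i)"
  by (simp add: complex_functional_def bounded_linear_vec_nth)

lemma complex_functional_comb:
  "complex_functional \<phi> \<Longrightarrow> complex_functional \<eta> \<Longrightarrow> complex_functional (\<lambda>z. a * \<phi> z + b * \<eta> z)"
  unfolding complex_functional_def
  by (auto intro!: bounded_linear_add bounded_linear_const_mult simp: algebra_simps)

lemma complex_functional_open: "complex_functional \<eta> \<Longrightarrow> open {z. \<eta> z \<noteq> 0}"
  unfolding complex_functional_def
  by (intro open_Collect_neq continuous_on_const) (auto intro: linear_continuous_on)

lemma holomorphic_several_quotient:
  assumes "complex_functional \<phi>" "complex_functional \<eta>"
  shows "holomorphic_several (\<lambda>z. \<phi> z / \<eta> z) {z. \<eta> z \<noteq> 0}"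
  unfolding holomorphic_several_def
proof
  fix z assume "z \<in> {z. \<eta> z \<noteq> 0}"
  then have z: "\<eta> z \<noteq> 0" by simp
  have "(\<phi> has_derivative \<phi>) (at z)" "(\<eta> has_derivative \<eta>) (at z)"
    using assms unfolding complex_functional_def by (auto intro: bounded_linear_imp_has_derivative)
  from has_derivative_divide'[OF this z]
  have "((\<lambda>z. \<phi> z / \<eta> z) has_derivative (\<lambda>h. (\<phi> h * \<eta> z - \<phi> z * \<eta> h) / (\<eta> z * \<eta> z))) (at z)" .
  moreover have "(\<phi> (c *s v) * \<eta> z - \<phi> z * \<eta> (c *s v)) / (\<eta> z * \<eta> z) =
      c * ((\<phi> v * \<eta> z - \<phi> z * \<eta> v) / (\<eta> z * \<eta> z))" for c v
    using assms unfolding complex_functional_def by (simp add: algebra_simps)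
  ultimately show "\<exists>D. ((\<lambda>z. \<phi> z / \<eta> z) has_derivative D) (at z) \<and> (\<forall>c v. D (c *s v) = c * D v)"
    by blast
qed

lemma hyperplane_plus_graph:
  assumes "Psi ` hyperplane A = graph_of_moebius S"
  shows "hyperplane_plus A = {Psi_inv (w, moebius S w) | w. moebius S w \<noteq> cnj_sphere w}"
proof (intro set_eqI iffI)
  fix p assume "p \<in> hyperplane_plus A"
  then have p: "p \<in> hyperplane A" "p \<in> Q11_plus" by (auto simp: hyperplane_plus_def)
  then have "p = Psi_inv (Psi p)" using hyperplane_subset Psi_inv_Psi by force
  moreover obtain w where "Psi p = (w, moebius S w)"
    using p(1) assms unfolding graph_of_moebius_def by blast
  ultimately show "p \<in> {Psi_inv (w, moebius S w) | w. moebius S w \<noteq> cnj_sphere w}"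
    using p(2) Psi_inv_in_Q11_plus by fastforce
next
  fix p assume "p \<in> {Psi_inv (w, moebius S w) | w. moebius S w \<noteq> cnj_sphere w}"
  then obtain w where p: "p = Psi_inv (w, moebius S w)" "moebius S w \<noteq> cnj_sphere w" by blast
  have "(w, moebius S w) \<in> Psi ` hyperplane A" unfolding assms graph_of_moebius_def by blast
  then show "p \<in> hyperplane_plus A"
    using p by (simp add: hyperplane_plus_def Psi_hyperplane_iff Psi_inv_in_Q11_plus)
qed

text \<open>The sphere parametrizes the curve by t -> (T t, S (T t)) followed by
  \<open>Psi_inv\<close>, which lifts to polynomials in homogeneous coordinates. The inverse reads
  w1 off linear coordinates of z and applies the inverse of T. The free T allows the domain to be
  put into normal form.\<close>

lemma conformally_equivalent_graph:
  assumes S: "S \<in> SL2" and T: "T \<in> SL2" and graph: "Psi ` hyperplane A = graph_of_moebius S"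
  shows "conformally_equivalent (hyperplane_plus A)
    {t. moebius S (moebius T t) \<noteq> cnj_sphere (moebius T t)}"
proof -
  obtain a b c d where S': "S = mat2 a b c d" "a * d - b * c = 1" using S by (rule SL2_cases)
  obtain e f g h where T': "T = mat2 e f g h" "e * h - f * g = 1" using T by (rule SL2_cases)
  define D where "D = {t. moebius S (moebius T t) \<noteq> cnj_sphere (moebius T t)}"
  define F where "F t = Psi_inv (moebius T t, moebius S (moebius T t))" for t
  \<comment> \<open>(p : q) are homogeneous coordinates of T t and (u1 : u2) those of S (T t), for t
    = (x : y).\<close>
  define p q where "p x y = e * x + f * y" and "q x y = g * x + h * y" for x y
  define u1 u2 where "u1 x y = a * p x y + b * q x y" and "u2 x y = c * p x y + d * q x y" for x y
  have pq: "p x y \<noteq> 0 \<or> q x y \<noteq> 0" if "x \<noteq> 0 \<or> y \<noteq> 0" for x y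
    unfolding p_def q_def using T'(2) that by (intro mat2_kernel) auto
  have u: "u1 x y \<noteq> 0 \<or> u2 x y \<noteq> 0" if "x \<noteq> 0 \<or> y \<noteq> 0" for x y
    unfolding u1_def u2_def using S'(2) pq[OF that] by (intro mat2_kernel) auto
  have Tr: "moebius T (ratio x y) = ratio (p x y) (q x y)" if "x \<noteq> 0 \<or> y \<noteq> 0" for x y
    using that by (simp add: T'(1) moebius_ratio p_def q_def)
  have Sr: "moebius S (moebius T (ratio x y)) = ratio (u1 x y) (u2 x y)" if "x \<noteq> 0 \<or> y \<noteq> 0" for x y
    using pq[OF that] by (simp add: Tr[OF that] S'(1) moebius_ratio u1_def u2_def)
  have F_ratio: "F (ratio x y) = pt (segre (p x y) (q x y) (u1 x y) (u2 x y))" if "x \<noteq> 0 \<or> y \<noteq> 0" for x y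
    using pq[OF that] u[OF that] unfolding F_def Sr[OF that] unfolding Tr[OF that] by (rule Psi_inv_ratio)
  have D_ratio: "ratio x y \<in> D \<longleftrightarrow> u1 x y * cnj (q x y) \<noteq> cnj (p x y) * u2 x y" if "x \<noteq> 0 \<or> y \<noteq> 0" for x y
    using pq[OF that] u[OF that] unfolding D_def mem_Collect_eq Sr[OF that] unfolding Tr[OF that] cnj_sphere_ratio
    by (subst ratio_eq_iff) auto

  have inj: "inj F"
  proof (rule injI)
    fix x y assume "F x = F y"
    then have "moebius T x = moebius T y" unfolding F_def by (auto dest: injD[OF inj_Psi_inv])
    then show "x = y" using bij_moebius[OF T] by (auto simp: bij_def dest: injD)
  qed
  have image: "F ` D = hyperplane_plus A"
  proof (intro set_eqI iffI)
    fix z assume "z \<in> hyperplane_plus A"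
    then obtain w where w: "z = Psi_inv (w, moebius S w)" "moebius S w \<noteq> cnj_sphere w"
      unfolding hyperplane_plus_graph[OF graph] by blast
    then show "z \<in> F ` D"
      by (intro image_eqI[of _ _ "moebius (matrix_inv T) w"]) (simp_all add: F_def D_def moebius_inv T)
  qed (auto simp: hyperplane_plus_graph[OF graph] F_def D_def)
  have bij: "bij_betw F D (hyperplane_plus A)"
    using inj image by (auto simp: bij_betw_def intro: inj_on_subset)

  \<comment> \<open>Serves both charts of the sphere: (X : Y) will be (x : 1) near finite points and
    (1 : x) near infinity.\<close>
  have to: "\<exists>V k. open V \<and> \<psi> x0 \<in> \<psi> ` V \<and> \<psi> ` V \<subseteq> D \<and> (\<forall>i. (\<lambda>x. k x $ i) holomorphic_on V) \<and>
      (\<forall>x\<in>V. k x \<noteq> (0 :: complex ^ 4) \<and> F (\<psi> x) = pt (k x))"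
    if X: "X holomorphic_on UNIV" and Y: "Y holomorphic_on UNIV" and nz: "\<And>x. X x \<noteq> 0 \<or> Y x \<noteq> 0"
      and \<psi>: "\<And>x. \<psi> x = ratio (X x) (Y x)" and x0: "\<psi> x0 \<in> D" for \<psi> X Y x0
  proof -
    define V where "V = {x. u1 (X x) (Y x) * cnj (q (X x) (Y x)) \<noteq> cnj (p (X x) (Y x)) * u2 (X x) (Y x)}"
    define k where "k x = segre (p (X x) (Y x)) (q (X x) (Y x)) (u1 (X x) (Y x)) (u2 (X x) (Y x))" for x
    have V: "x \<in> V \<longleftrightarrow> \<psi> x \<in> D" for x unfolding V_def \<psi> D_ratio[OF nz] by simp
    note cont = holomorphic_on_imp_continuous_on[OF X] holomorphic_on_imp_continuous_on[OF Y]
    have "open V"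
      unfolding V_def u1_def u2_def p_def q_def by (intro open_Collect_neq continuous_intros cont)
    moreover have "(\<lambda>x. k x $ i) holomorphic_on V" for i
      using exhaust_4[of i] holomorphic_on_subset[OF X, of V] holomorphic_on_subset[OF Y, of V]
      unfolding k_def u1_def u2_def p_def q_def by (auto intro!: holomorphic_intros)
    moreover have "k x \<noteq> 0" "F (\<psi> x) = pt (k x)" for x
      using pq[OF nz] u[OF nz] by (simp_all add: k_def segre_nonzero \<psi> F_ratio[OF nz])
    ultimately show ?thesis using V x0 by (intro exI[of _ V] exI[of _ k]) auto
  qed
  have "holomorphic_to_CP3 F D"
    unfolding holomorphic_to_CP3_def
  proof
    fix t assume t: "t \<in> D"
    show "\<exists>\<psi>\<in>sphere_params. \<exists>V k. open V \<and> t \<in> \<psi> ` V \<and> \<psi> ` V \<subseteq> D \<and> (\<forall>i. (\<lambda>x. k x $ i) holomorphic_on V) \<and>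
      (\<forall>x\<in>V. k x \<noteq> 0 \<and> F (\<psi> x) = pt (k x))"
    proof (cases t)
      case None
      show ?thesis
        using to[of "\<lambda>x. 1" "\<lambda>x. x" "\<lambda>z. if z = 0 then None else Some (1 / z)" 0] t
        by (intro bexI[of _ "\<lambda>z. if z = 0 then None else Some (1 / z)"])
          (auto simp: sphere_params_def ratio_def None fun_eq_iff)
    next
      case (Some w)
      show ?thesis
        using to[of "\<lambda>x. x" "\<lambda>x. 1" Some w] t
        by (intro bexI[of _ Some]) (auto simp: sphere_params_def ratio_def Some)
    qed
  qed
  moreover have "holomorphic_from_CP3 (inv_into D F) (hyperplane_plus A)"
  proof -
    \<comment> \<open>(X1 : Y1) and (X2 : Y2) are the two ways of \<open>ratio_segre\<close> to read
      off w1; for z \<noteq> 0 at least one pair is nonzero. The coefficients 1 are written out to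
      fit \<open>complex_functional_comb\<close>.\<close>
    define X1 Y1 X2 Y2 :: "complex ^ 4 \<Rightarrow> complex" where
      "X1 z = 1 * z $ 1 + \<i> * z $ 2" and "Y1 z = 1 * z $ 3 + 1 * z $ 4" and
      "X2 z = 1 * z $ 4 + (- 1) * z $ 3" and "Y2 z = 1 * z $ 1 + (- \<i>) * z $ 2" for z
    have lin: "complex_functional X1" "complex_functional Y1" "complex_functional X2" "complex_functional Y2"
      unfolding X1_def Y1_def X2_def Y2_def
      by (intro complex_functional_comb complex_functional_nth)+
    have G: "(X1 z \<noteq> 0 \<or> Y1 z \<noteq> 0 \<longrightarrow> inv_into D F (pt z) = ratio (h * X1 z + (- f) * Y1 z) ((- g) * X1 z + e * Y1 z)) \<and>
        (X2 z \<noteq> 0 \<or> Y2 z \<noteq> 0 \<longrightarrow> inv_into D F (pt z) = ratio (h * X2 z + (- f) * Y2 z) ((- g) * X2 z + e * Y2 z))"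
      if z: "pt z \<in> hyperplane_plus A" for z
    proof -
      obtain t where t: "t \<in> D" "pt z = F t" using z image by blast
      obtain x y where xy: "t = ratio x y" "x \<noteq> 0 \<or> y \<noteq> 0" by (rule sphere_cases)
      obtain k where "k \<noteq> 0" "z = k *s segre (p x y) (q x y) (u1 x y) (u2 x y)"
        using t(2) unfolding xy(1) F_ratio[OF xy(2)] by (rule pt_eqE)
      note r = ratio_segre[OF pq[OF xy(2)] this(2)]
      have inv: "inv_into D F (pt z) = t"
        unfolding t(2) using inj t(1) by (meson inj_on_subset inv_into_f_f subset_UNIV)
      have "t = moebius (matrix_inv T) (ratio (p x y) (q x y))"
        unfolding xy(1) Tr[OF xy(2), symmetric] by (rule moebius_inv(1)[OF T, symmetric])
      then have t': "t = ratio (h * X + (- f) * Y) ((- g) * X + e * Y)"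
        if "ratio X Y = ratio (p x y) (q x y)" "X \<noteq> 0 \<or> Y \<noteq> 0" for X Y
        unfolding T'(1) matrix_inv_mat2[OF T'(2)] that(1)[symmetric] moebius_ratio[OF that(2)] .
      have "X1 z = z $ 1 + \<i> * z $ 2" "Y1 z = z $ 3 + z $ 4" "X2 z = z $ 4 - z $ 3" "Y2 z = z $ 1 - \<i> * z $ 2"
        by (simp_all add: X1_def Y1_def X2_def Y2_def)
      then show ?thesis unfolding inv using r t' by metis
    qed
    have chart: "\<exists>\<psi>\<in>sphere_params. \<exists>U \<phi>. open U \<and> z \<in> U \<and> holomorphic_several \<phi> U \<and>
        (\<forall>z'\<in>U. z' \<noteq> 0 \<and> pt z' \<in> hyperplane_plus A \<longrightarrow> inv_into D F (pt z') = \<psi> (\<phi> z'))"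
      if lin: "complex_functional X" "complex_functional Y" and nz: "X z \<noteq> 0 \<or> Y z \<noteq> 0"
        and G: "\<And>z'. pt z' \<in> hyperplane_plus A \<Longrightarrow> X z' \<noteq> 0 \<or> Y z' \<noteq> 0 \<Longrightarrow>
          inv_into D F (pt z') = ratio (h * X z' + (- f) * Y z') ((- g) * X z' + e * Y z')" for X Y z
    proof -
      \<comment> \<open>(N : M) is the inverse of T applied to (X : Y); where M \<noteq> 0 the
        finite chart N / M is used, otherwise the chart M / N at infinity.\<close>
      define N M where "N z = h * X z + (- f) * Y z" and "M z = (- g) * X z + e * Y z" for z
      have NM: "complex_functional N" "complex_functional M"
        unfolding N_def M_def by (intro complex_functional_comb lin)+
      have G': "inv_into D F (pt z') = ratio (N z') (M z')"
        if "pt z' \<in> hyperplane_plus A" "N z' \<noteq> 0 \<or> M z' \<noteq> 0" for z'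
      proof -
        have "X z' \<noteq> 0 \<or> Y z' \<noteq> 0" using that(2) by (auto simp: N_def M_def)
        then show ?thesis unfolding N_def M_def by (rule G[OF that(1)])
      qed
      have "N z \<noteq> 0 \<or> M z \<noteq> 0"
        unfolding N_def M_def using T'(2) nz by (intro mat2_kernel) (auto simp: algebra_simps)
      then show ?thesis
      proof (cases "M z = 0")
        case False
        then show ?thesis
          using complex_functional_open[OF NM(2)] holomorphic_several_quotient[OF NM] G'
          by (intro bexI[of _ Some] exI[of _ "{z. M z \<noteq> 0}"] exI[of _ "\<lambda>z. N z / M z"])
            (auto simp: sphere_params_def ratio_def)
      next
        case True
        with \<open>N z \<noteq> 0 \<or> M z \<noteq> 0\<close> have "N z \<noteq> 0" by simp
        then show ?thesis
          using complex_functional_open[OF NM(1)] holomorphic_several_quotient[OF NM(2,1)] G'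
          by (intro bexI[of _ "\<lambda>z. if z = 0 then None else Some (1 / z)"]
              exI[of _ "{z. N z \<noteq> 0}"] exI[of _ "\<lambda>z. M z / N z"])
            (auto simp: sphere_params_def ratio_def)
      qed
    qed
    show ?thesis
      unfolding holomorphic_from_CP3_def
    proof (intro allI impI)
      fix z :: "complex ^ 4"
      assume z: "z \<noteq> 0 \<and> pt z \<in> hyperplane_plus A"
      have "z = 0" if "X1 z = 0" "Y1 z = 0" "X2 z = 0" "Y2 z = 0"
      proof (rule vec4_eqI)
        have "2 * z $ 1 = X1 z + Y2 z" "2 * \<i> * z $ 2 = X1 z - Y2 z" "2 * z $ 3 = Y1 z - X2 z" "2 * z $ 4 = Y1 z + X2 z"
          by (simp_all add: X1_def Y1_def X2_def Y2_def)
        then show "z $ 1 = 0 $ 1" "z $ 2 = 0 $ 2" "z $ 3 = 0 $ 3" "z $ 4 = 0 $ 4"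
          using that by simp_all
      qed
      then consider "X1 z \<noteq> 0 \<or> Y1 z \<noteq> 0" | "X2 z \<noteq> 0 \<or> Y2 z \<noteq> 0" using z by blast
      then show "\<exists>\<psi>\<in>sphere_params. \<exists>U \<phi>. open U \<and> z \<in> U \<and> holomorphic_several \<phi> U \<and>
        (\<forall>z'\<in>U. z' \<noteq> 0 \<and> pt z' \<in> hyperplane_plus A \<longrightarrow> inv_into D F (pt z') = \<psi> (\<phi> z'))"
      proof cases
        case 1
        then show ?thesis by (rule chart[OF lin(1,2)]) (use G in blast)
      next
        case 2
        then show ?thesis by (rule chart[OF lin(3,4)]) (use G in blast)
      qed
    qed
  qed
  ultimately show ?thesis
    using bij unfolding conformally_equivalent_def D_def[symmetric] by blast
qed

text \<open>Taking the inverse of the similarity matrix as parameter change turns the domain into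
  the complement of the eigenratios of the normal form, whose conformal type is visible.\<close>

lemma conformally_equivalent_conj_similar:
  assumes "S \<in> SL2" "Psi ` hyperplane A = graph_of_moebius S" "S \<sim>\<^sub>c S'"
  shows "conformally_equivalent (hyperplane_plus A) (- conj_eigenratios S')"
proof -
  obtain T where T: "T \<in> SL2" "S' = cnj_mat T ** S ** matrix_inv T \<or> S' = - (cnj_mat T ** S ** matrix_inv T)"
    using assms(3) unfolding conj_similar_def by blast
  have "moebius S (moebius (matrix_inv T) t) = cnj_sphere (moebius (matrix_inv T) t) \<longleftrightarrow>
      moebius S' t = cnj_sphere t" for t
    using moebius_conj_similar[OF T assms(1), of "moebius (matrix_inv T) t" "moebius (matrix_inv T) t"]
    by (simp add: moebius_inv T(1))
  then have "{t. moebius S (moebius (matrix_inv T) t) \<noteq> cnj_sphere (moebius (matrix_inv T) t)} =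
      - conj_eigenratios S'"
    by (auto simp: conj_eigenratios_eq[OF conj_similar_SL2[OF assms(3,1)]])
  then show ?thesis
    using conformally_equivalent_graph[OF assms(1) SL2_inv(1)[OF T(1)] assms(2)] by simp
qed

section \<open>The classes of hyperplanes\<close>

text \<open>Twisted conjugation acts on the rank one matrix factor by factor: T on (p1, q1) and cnj
  T on (p2, q2).\<close>

lemma lact_segre:
  assumes "a * d - b * c = 1"
  shows "lact (mat2 a b c d) (segre p1 q1 p2 q2) =
    segre (a * p1 + b * q1) (c * p1 + d * q1) (cnj a * p2 + cnj b * q2) (cnj c * p2 + cnj d * q2)"
  unfolding lact_mat2[OF assms] Smat_def mat2_mult Avec_mat2
  by (rule vec4_eqI) (simp_all add: field_simps)

lemma Psi_inv_lorentz_equiv: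
  assumes T: "T \<in> SL2" and A: "pt A = Psi_inv (w1, w2)"
    and B: "pt B = Psi_inv (moebius T w1, moebius (cnj_mat T) w2)"
  shows "pt A \<sim>\<^sub>L pt B"
proof -
  obtain a b c d where T': "T = mat2 a b c d" "a * d - b * c = 1" using T by (rule SL2_cases)
  have cdet: "cnj a * cnj d - cnj b * cnj c = 1" using arg_cong[OF T'(2), of cnj] by simp
  obtain p1 q1 where 1: "w1 = ratio p1 q1" "p1 \<noteq> 0 \<or> q1 \<noteq> 0" by (rule sphere_cases)
  obtain p2 q2 where 2: "w2 = ratio p2 q2" "p2 \<noteq> 0 \<or> q2 \<noteq> 0" by (rule sphere_cases)
  have "pt A = pt (segre p1 q1 p2 q2)" using A 1 2 by (simp add: Psi_inv_ratio)
  moreover have "pt (lact T (segre p1 q1 p2 q2)) = pt B"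
    unfolding B T'(1) lact_segre[OF T'(2)] cnj_mat2
    using 1 2 mat2_kernel[of a d b c p1 q1] mat2_kernel[of "cnj a" "cnj d" "cnj b" "cnj c" p2 q2] T'(2) cdet
    by (simp add: moebius_ratio Psi_inv_ratio)
  ultimately show ?thesis using lorentz_equivI[OF T] by metis
qed

text \<open>Since w2 moves by cnj T, the points c1 and cnj c2 both move by T. Distinct ones go to 0
  and infinity, equal ones to 0; the vectors in the conclusion are \<open>Psi_inv\<close> at (0,
  infinity) and at (0, 0).\<close>

lemma cross_lorentz_equiv:
  assumes A: "pt A = Psi_inv (c1, c2)"
  shows "c2 \<noteq> cnj_sphere c1 \<Longrightarrow> pt A \<sim>\<^sub>L pt (vector [1, \<i>, 0, 0])"
    and "c2 = cnj_sphere c1 \<Longrightarrow> pt A \<sim>\<^sub>L pt (vector [0, 0, 1, 1])"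
proof -
  obtain p q where 1: "c1 = ratio p q" "p \<noteq> 0 \<or> q \<noteq> 0" by (rule sphere_cases)
  show "pt A \<sim>\<^sub>L pt (vector [1, \<i>, 0, 0])" if ne: "c2 \<noteq> cnj_sphere c1"
  proof -
    obtain x y where 2: "cnj_sphere c2 = ratio x y" "x \<noteq> 0 \<or> y \<noteq> 0" by (rule sphere_cases)
    have c2: "c2 = cnj_sphere (ratio x y)"
      unfolding 2(1)[symmetric] by (simp add: cnj_sphere_def option.map_comp comp_def option.map_ident)
    have "ratio x y \<noteq> ratio p q" using ne by (auto simp: c2 1(1))
    then have nz: "p * y - x * q \<noteq> 0" using 1(2) 2(2) by (simp add: ratio_eq_iff)
    \<comment> \<open>Normalizes the determinant of the matrix sending (p : q) to 0 and (x : y) to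
      infinity.\<close>
    define k where "k = 1 / (p * y - x * q)"
    have k: "k \<noteq> 0" "k * (p * y - x * q) = 1" using nz by (simp_all add: k_def)
    define T where "T = mat2 (k * q) (- k * p) y (- x)"
    have T: "T \<in> SL2" using k(2) by (simp add: T_def mat2_in_SL2 algebra_simps)
    have "y * p + - x * q \<noteq> 0" "k * q * x + - k * p * y \<noteq> 0"
      using nz k by (simp_all add: algebra_simps)
    then have "moebius T c1 = Some 0" "moebius T (ratio x y) = None"
      using 1 2(2) by (simp_all add: T_def moebius_ratio) (simp_all add: ratio_def algebra_simps)
    then have "pt (vector [1, \<i>, 0, 0]) = Psi_inv (moebius T c1, moebius (cnj_mat T) c2)"
      unfolding c2 moebius_cnj[symmetric] by (simp add: cnj_sphere_def)
    then show ?thesis by (rule Psi_inv_lorentz_equiv[OF T A])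
  qed
  show "pt A \<sim>\<^sub>L pt (vector [0, 0, 1, 1])" if eq: "c2 = cnj_sphere c1"
  proof -
    obtain m n where mn: "q * n + p * m = 1"
    proof (cases "p = 0")
      case True
      then show ?thesis using that[of "1/q" 0] 1(2) by simp
    next
      case False
      then show ?thesis using that[of 0 "1/p"] by simp
    qed
    define T where "T = mat2 q (- p) m n"
    have T: "T \<in> SL2" using mn by (simp add: T_def mat2_in_SL2)
    have "m * p + n * q = 1" using mn by (simp add: algebra_simps)
    then have "moebius T c1 = Some 0"
      using 1 by (simp add: T_def moebius_ratio) (simp add: ratio_def algebra_simps)
    then have "pt (vector [0, 0, 1, 1]) = Psi_inv (moebius T c1, moebius (cnj_mat T) c2)"
      unfolding eq moebius_cnj[symmetric] by (simp add: cnj_sphere_def)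
    then show ?thesis by (rule Psi_inv_lorentz_equiv[OF T A])
  qed
qed

lemma lorentz_equiv_Avec:
  assumes "pt A = pt (Avec S)" "S \<sim>\<^sub>c S'" "pt (Avec S') = pt B"
  shows "pt A \<sim>\<^sub>L pt B" "pt B \<sim>\<^sub>L pt A"
  using conj_similar_lorentz_equiv[OF assms(2)] conj_similar_lorentz_equiv[OF conj_similar_sym[OF assms(2)]]
  by (simp_all add: assms(1,3))

lemma types_iff:
  assumes "pt A \<sim>\<^sub>L pt B" "pt B \<sim>\<^sub>L pt A"
  shows "totally_real A \<longleftrightarrow> totally_real B" "hyperbolic_type A \<longleftrightarrow> hyperbolic_type B"
    "elliptic_type A \<longleftrightarrow> elliptic_type B" "parabolic_type A \<longleftrightarrow> parabolic_type B"
  using types_lorentz_equiv[OF assms(1)] types_lorentz_equiv[OF assms(2)]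
  unfolding hyperbolic_type_def elliptic_type_def parabolic_type_def by blast+

lemma types_exclusive:
  "hyperbolic_type A \<Longrightarrow> \<not> elliptic_type A \<and> \<not> parabolic_type A \<and> \<not> totally_real A"
  "elliptic_type A \<Longrightarrow> \<not> hyperbolic_type A \<and> \<not> parabolic_type A \<and> \<not> totally_real A"
  "parabolic_type A \<Longrightarrow> \<not> hyperbolic_type A \<and> \<not> elliptic_type A \<and> \<not> totally_real A"
  "totally_real A \<Longrightarrow> \<not> hyperbolic_type A \<and> \<not> elliptic_type A \<and> \<not> parabolic_type A"
  unfolding hyperbolic_type_def elliptic_type_def parabolic_type_def
  using space_like_not_time_like space_like_not_light_like time_like_not_light_like by blast+

text \<open>For this totally real vector the span is only a line. Its definiteness is the invariant
  that separates (1, 0, 0, 0) from the parabolic form, where \<open>kappa\<close> agrees.\<close>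

lemma space_like_axis: "space_like (real_plane (vector [1, 0, 0, 0]))"
proof -
  have "real_plane (vector [1, 0, 0, 0]) \<subseteq> {x. x $ 2 = 0 \<and> x $ 3 = 0 \<and> x $ 4 = 0}"
    unfolding real_plane_def
    by (rule span_minimal) (auto simp: subspace_def Re_vec_def Im_vec_def)
  then show ?thesis
    unfolding space_like_def
    by (auto simp: mink_def vec_eq_iff forall_4 simp flip: power2_eq_square)
qed

lemma Compl_insert_None: "- insert None (Some ` X) = Some ` (UNIV - X)"
proof (rule set_eqI)
  fix p show "p \<in> - insert None (Some ` X) \<longleftrightarrow> p \<in> Some ` (UNIV - X)" by (cases p) auto
qed

section \<open>Hyperplanes off the quadric, with any matrix S representing the graph\<close>

locale graph_hyperplane =
  fixes A :: "complex ^ 4" and S :: "complex ^ 2 ^ 2"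
  assumes nonzero: "mink A A \<noteq> 0" and SL: "S \<in> SL2"
    and graph: "Psi ` hyperplane A = graph_of_moebius S"
begin

abbreviation "E \<equiv> conj_eigenratios S"

lemma pt_A: "pt A = pt (Avec S)"
  by (rule pt_eq_pt_Avec[OF nonzero SL graph])

lemma E_card:
  assumes "S \<sim>\<^sub>c S'"
  shows "card E = card (conj_eigenratios S')" "finite E \<longleftrightarrow> finite (conj_eigenratios S')"
    "E = {} \<longleftrightarrow> conj_eigenratios S' = {}"
proof -
  obtain f where "bij_betw f E (conj_eigenratios S')"
    using conj_eigenratios_conj_similar[OF assms SL] .
  then show "card E = card (conj_eigenratios S')" "finite E \<longleftrightarrow> finite (conj_eigenratios S')"
    "E = {} \<longleftrightarrow> conj_eigenratios S' = {}"
    by (auto simp: bij_betw_same_card bij_betw_finite bij_betw_def)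
qed

lemma identity_class:
  assumes "S \<sim>\<^sub>c mat2 1 0 0 1"
  shows "infinite E" "pt A \<sim>\<^sub>L pt (vector [1, 0, 0, 0])" "totally_real A" "kappa A = 1"
    "conformally_equivalent (hyperplane_plus A) (Some ` (UNIV - \<real>))"
proof -
  have "infinite (range (\<lambda>x. Some (complex_of_real x)))"
    by (simp add: finite_image_iff inj_on_def infinite_UNIV_char_0)
  moreover have "range (\<lambda>x. Some (complex_of_real x)) = Some ` \<real>" by (auto simp: Reals_def)
  ultimately have "infinite (Some ` (\<real> :: complex set))" by simp
  then show "infinite E" using E_card(2)[OF assms] by (simp add: conj_eigenratios_identity)
  note equiv = lorentz_equiv_Avec[OF pt_A conj_similar_trans[OF assms conj_similar_identity(1)] conj_similar_identity(2)]
  show "pt A \<sim>\<^sub>L pt (vector [1, 0, 0, 0])" by (fact equiv)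
  show "totally_real A" using types_iff(1)[OF equiv] totally_real_normal_forms(1) by simp
  show "kappa A = 1" using kappa_lorentz_equiv[OF equiv(1)] by (simp add: kappa_normal_forms)
  show "conformally_equivalent (hyperplane_plus A) (Some ` (UNIV - \<real>))"
    using conformally_equivalent_conj_similar[OF SL graph assms]
    unfolding conj_eigenratios_identity Compl_insert_None .
qed

lemma hyperbolic_class:
  fixes u :: real
  assumes u: "u > 0" and "S \<sim>\<^sub>c mat2 (of_real (exp u)) 0 0 (of_real (exp (- u)))"
  shows "card E = 2" "hyperbolic_type A"
    "pt A \<sim>\<^sub>L pt (vector [of_real (sinh u), \<i> * of_real (cosh u), 0, 0])"
    "kappa A = 1 + 2 * (sinh u)\<^sup>2"
    "conformally_equivalent (hyperplane_plus A) (Some ` (UNIV - {0}))"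
proof -
  show "card E = 2" using E_card(1)[OF assms(2)] by (simp add: conj_eigenratios_hyperbolic u)
  note equiv = lorentz_equiv_Avec[OF pt_A assms(2) pt_Avec_hyperbolic]
  show "pt A \<sim>\<^sub>L pt (vector [of_real (sinh u), \<i> * of_real (cosh u), 0, 0])" by (fact equiv)
  show "hyperbolic_type A" using types_iff(2)[OF equiv] hyperbolic_type_normal_form[OF u] by simp
  show "kappa A = 1 + 2 * (sinh u)\<^sup>2" using kappa_lorentz_equiv[OF equiv(1)] by (simp add: kappa_normal_forms)
  have "conj_eigenratios (mat2 (of_real (exp u)) 0 0 (of_real (exp (- u)))) = insert None (Some ` {0})"
    using conj_eigenratios_hyperbolic[OF u] by simp
  then show "conformally_equivalent (hyperplane_plus A) (Some ` (UNIV - {0}))"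
    using conformally_equivalent_conj_similar[OF SL graph assms(2)] by (simp only: Compl_insert_None)
qed

lemma elliptic_class:
  fixes \<alpha> :: real
  assumes \<alpha>: "0 < \<alpha>" "\<alpha> \<le> pi / 2"
    and sim: "S \<sim>\<^sub>c mat2 0 (\<i> * exp (- (\<i> * of_real \<alpha>))) (\<i> * exp (\<i> * of_real \<alpha>)) 0"
  shows "E = {}"
    "pt A \<sim>\<^sub>L pt (vector [0, 0, of_real (cos \<alpha>), \<i> * of_real (sin \<alpha>)])"
    "\<alpha> < pi / 2 \<Longrightarrow> elliptic_type A"
    "\<alpha> = pi / 2 \<Longrightarrow> totally_real A \<and> pt A \<sim>\<^sub>L pt (vector [0, 0, 0, 1])"
    "kappa A = 1 - 2 * (sin \<alpha>)\<^sup>2"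
    "conformally_equivalent (hyperplane_plus A) UNIV"
proof -
  show "E = {}" using E_card(3)[OF sim] conj_eigenratios_elliptic(2)[OF \<alpha>] by simp
  note equiv = lorentz_equiv_Avec[OF pt_A sim pt_Avec_elliptic]
  show "pt A \<sim>\<^sub>L pt (vector [0, 0, of_real (cos \<alpha>), \<i> * of_real (sin \<alpha>)])" by (fact equiv)
  show "elliptic_type A" if "\<alpha> < pi / 2"
    using types_iff(3)[OF equiv] elliptic_type_normal_form[OF \<alpha>(1) that] by simp
  show "totally_real A \<and> pt A \<sim>\<^sub>L pt (vector [0, 0, 0, 1])" if "\<alpha> = pi / 2"
  proof -
    \<comment> \<open>At \<alpha> = pi/2 the third coordinate vanishes and the vector is i times a
      real one: the elliptic family ends in the totally real case.\<close>
    have "vector [0, 0, of_real (cos \<alpha>), \<i> * of_real (sin \<alpha>)] = \<i> *s (vector [0, 0, 0, 1] :: complex ^ 4)"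
      by (rule vec4_eqI) (simp_all add: that)
    then have eq: "pt (vector [0, 0, of_real (cos \<alpha>), \<i> * of_real (sin \<alpha>)]) = pt (vector [0, 0, 0, 1])"
      by (simp add: pt_scale)
    show ?thesis
      using equiv types_iff(1)[of A "vector [0, 0, 0, 1]"] totally_real_normal_forms(2) unfolding eq by simp
  qed
  show "kappa A = 1 - 2 * (sin \<alpha>)\<^sup>2" using kappa_lorentz_equiv[OF equiv(1)] by (simp add: kappa_normal_forms)
  show "conformally_equivalent (hyperplane_plus A) UNIV"
    using conformally_equivalent_conj_similar[OF SL graph sim] conj_eigenratios_elliptic(2)[OF \<alpha>] by simp
qed

lemma parabolic_class:
  assumes "S \<sim>\<^sub>c mat2 1 1 0 1"
  shows "card E = 1" "parabolic_type A" "pt A \<sim>\<^sub>L pt (vector [1, 0, \<i>, \<i>])" "kappa A = 1"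
    "conformally_equivalent (hyperplane_plus A) (range Some)"
proof -
  show "card E = 1" using E_card(1)[OF assms] by (simp add: conj_eigenratios_parabolic)
  note equiv = lorentz_equiv_Avec[OF pt_A conj_similar_trans[OF assms conj_similar_parabolic(1)] conj_similar_parabolic(2)]
  show "pt A \<sim>\<^sub>L pt (vector [1, 0, \<i>, \<i>])" by (fact equiv)
  show "parabolic_type A" using types_iff(4)[OF equiv] parabolic_type_normal_form by simp
  show "kappa A = 1" using kappa_lorentz_equiv[OF equiv(1)] by (simp add: kappa_normal_forms)
  have "conj_eigenratios (mat2 1 1 0 1) = insert None (Some ` {})"
    using conj_eigenratios_parabolic by simp
  then show "conformally_equivalent (hyperplane_plus A) (range Some)"
    using conformally_equivalent_conj_similar[OF SL graph assms] by (simp only: Compl_insert_None Diff_empty)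
qed

lemma class_cases:
  obtains
    (identity) "S \<sim>\<^sub>c mat2 1 0 0 1"
  | (hyperbolic) u :: real where "u > 0" "S \<sim>\<^sub>c mat2 (of_real (exp u)) 0 0 (of_real (exp (- u)))"
  | (elliptic) \<alpha> :: real where "0 < \<alpha>" "\<alpha> \<le> pi / 2"
      "S \<sim>\<^sub>c mat2 0 (\<i> * exp (- (\<i> * of_real \<alpha>))) (\<i> * exp (\<i> * of_real \<alpha>)) 0"
  | (parabolic) "S \<sim>\<^sub>c mat2 1 1 0 1"
proof (cases "E = {}")
  case True
  then obtain \<alpha> :: real where "0 < \<alpha> \<and> \<alpha> \<le> pi / 2 \<and>
      S \<sim>\<^sub>c mat2 0 (\<i> * exp (- (\<i> * of_real \<alpha>))) (\<i> * exp (\<i> * of_real \<alpha>)) 0"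
    by (rule exE[OF SL2_no_conj_eigenvector_classification[OF SL]])
  then show thesis by (elim conjE) (rule elliptic)
next
  case False
  show thesis
    by (rule disjE[OF SL2_conj_eigenvector_classification[OF SL False]])
      (auto intro: identity parabolic hyperbolic)
qed

lemma kappa_axis:
  "kappa A \<noteq> 1 \<Longrightarrow> \<not> pt A \<sim>\<^sub>L pt (vector [1, 0, 0, 0])"
  "kappa A \<noteq> -1 \<Longrightarrow> \<not> pt A \<sim>\<^sub>L pt (vector [0, 0, 0, 1])"
  using kappa_lorentz_equiv[of A] kappa_normal_forms(1,2) by metis+

text \<open>A light-like plane for A would make the real line of (1, 0, 0, 0) light-like, although
  it is space-like.\<close>

lemma not_parabolic: "pt A \<sim>\<^sub>L pt (vector [1, 0, 0, 0]) \<Longrightarrow> \<not> parabolic_type A"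
  using types_lorentz_equiv(4) space_like_axis space_like_not_light_like
  unfolding parabolic_type_def by blast

lemma hyperbolic_parameter:
  fixes u :: real
  assumes "u > 0" "v > 0" "1 + 2 * (sinh u)\<^sup>2 = 1 + 2 * (sinh v)\<^sup>2"
  shows "u = v"
proof -
  have "sinh u > 0" "sinh v > 0" using assms by simp_all
  moreover have "(sinh u)\<^sup>2 = (sinh v)\<^sup>2" using assms(3) by simp
  ultimately have "sinh u = sinh v" by (metis power2_eq_imp_eq less_imp_le)
  then show ?thesis by simp
qed

lemma elliptic_parameter:
  fixes \<alpha> :: real
  assumes "0 < \<alpha>" "\<alpha> \<le> pi / 2" "0 < \<beta>" "\<beta> \<le> pi / 2"
    "1 - 2 * (sin \<alpha>)\<^sup>2 = 1 - 2 * (sin \<beta>)\<^sup>2"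
  shows "\<alpha> = \<beta>"
proof -
  have "sin \<alpha> > 0" "sin \<beta> > 0" using assms by (auto intro: sin_gt_zero)
  moreover have "(sin \<alpha>)\<^sup>2 = (sin \<beta>)\<^sup>2" using assms(5) by simp
  ultimately have "sin \<alpha> = sin \<beta>" by (auto simp: power2_eq_iff)
  then show ?thesis using assms sin_inj_pi[of \<alpha> \<beta>] by simp
qed

lemma identity_part:
  "infinite E \<longleftrightarrow> pt A \<sim>\<^sub>L pt (vector [1, 0, 0, 0])"
  "infinite E \<Longrightarrow> S \<sim>\<^sub>c mat2 1 0 0 1 \<and>
     conformally_equivalent (hyperplane_plus A) (Some ` (UNIV - \<real>))"
proof -
  show "infinite E \<longleftrightarrow> pt A \<sim>\<^sub>L pt (vector [1, 0, 0, 0])"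
  proof (cases rule: class_cases)
    case identity
    show ?thesis using identity_class(1,2)[OF identity] by simp
  next
    case (hyperbolic u)
    have "finite E" using hyperbolic_class(1)[OF hyperbolic] by (intro card_ge_0_finite) simp
    moreover have "kappa A \<noteq> 1" using hyperbolic_class(4)[OF hyperbolic] hyperbolic(1) by simp
    ultimately show ?thesis using kappa_axis(1) by blast
  next
    case (elliptic \<alpha>)
    then have "sin \<alpha> > 0" by (intro sin_gt_zero) auto
    then have "kappa A \<noteq> 1" using elliptic_class(5)[OF elliptic] by simp
    moreover have "finite E" using elliptic_class(1)[OF elliptic] by simp
    ultimately show ?thesis using kappa_axis(1) by blast
  next
    case parabolic
    have "finite E" using parabolic_class(1)[OF parabolic] by (intro card_ge_0_finite) simp
    then show ?thesis using parabolic_class(2)[OF parabolic] not_parabolic by blast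
  qed
  assume inf: "infinite E"
  show "S \<sim>\<^sub>c mat2 1 0 0 1 \<and> conformally_equivalent (hyperplane_plus A) (Some ` (UNIV - \<real>))"
  proof (cases rule: class_cases)
    case identity
    show ?thesis using identity identity_class(5)[OF identity] by simp
  next
    case (hyperbolic u)
    then show ?thesis using hyperbolic_class(1)[OF hyperbolic] inf by simp
  next
    case (elliptic \<alpha>)
    then show ?thesis using elliptic_class(1)[OF elliptic] inf by simp
  next
    case parabolic
    then show ?thesis using parabolic_class(1) inf by simp
  qed
qed

lemma type_part:
  "card E = 2 \<longleftrightarrow> hyperbolic_type A"
  "card E = 1 \<longleftrightarrow> parabolic_type A"
  "E = {} \<longleftrightarrow> pt A \<sim>\<^sub>L pt (vector [0, 0, 0, 1]) \<or> elliptic_type A"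
  "pt A \<sim>\<^sub>L pt (vector [0, 0, 0, 1]) \<Longrightarrow> totally_real A"
proof -
  have parts: "(card E = 2 \<longleftrightarrow> hyperbolic_type A) \<and> (card E = 1 \<longleftrightarrow> parabolic_type A) \<and>
    (E = {} \<longleftrightarrow> pt A \<sim>\<^sub>L pt (vector [0, 0, 0, 1]) \<or> elliptic_type A) \<and>
    (pt A \<sim>\<^sub>L pt (vector [0, 0, 0, 1]) \<longrightarrow> totally_real A)"
  proof (cases rule: class_cases)
    case identity
    \<comment> \<open>\<open>card\<close> of an infinite set is 0, so the infinite case must be told
      from the empty one by E \<noteq> {}.\<close>
    have "card E = 0" "E \<noteq> {}" using identity_class(1)[OF identity] by auto
    moreover have "\<not> pt A \<sim>\<^sub>L pt (vector [0, 0, 0, 1])"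
      using identity_class(4)[OF identity] by (intro kappa_axis) simp
    ultimately show ?thesis using types_exclusive(4)[OF identity_class(3)[OF identity]] by simp
  next
    case (hyperbolic u)
    have "kappa A \<noteq> -1" using hyperbolic_class(4)[OF hyperbolic] zero_le_power2[of "sinh u"] by linarith
    then have "\<not> pt A \<sim>\<^sub>L pt (vector [0, 0, 0, 1])" by (rule kappa_axis)
    moreover have "card E = 2" "E \<noteq> {}" using hyperbolic_class(1)[OF hyperbolic] by auto
    moreover note type = hyperbolic_class(2)[OF hyperbolic]
    ultimately show ?thesis using types_exclusive(1)[OF type] by simp
  next
    case (elliptic \<alpha>)
    have E: "E = {}" "card E = 0" using elliptic_class(1)[OF elliptic] by simp_all
    have "\<alpha> < pi / 2 \<or> \<alpha> = pi / 2" using elliptic by linarith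
    then show ?thesis
    proof
      assume lt: "\<alpha> < pi / 2"
      \<comment> \<open>The invariant cos 2\<alpha> reaches -1 only at \<alpha> = pi/2.\<close>
      have "\<not> pt A \<sim>\<^sub>L pt (vector [0, 0, 0, 1])"
      proof (rule kappa_axis)
        show "kappa A \<noteq> -1"
        proof
          assume "kappa A = -1"
          then have "1 - 2 * (sin \<alpha>)\<^sup>2 = 1 - 2 * (sin (pi / 2))\<^sup>2"
            using elliptic_class(5)[OF elliptic] by simp
          from elliptic_parameter[OF elliptic(1,2) _ _ this] have "\<alpha> = pi / 2" by simp
          then show False using lt by simp
        qed
      qed
      then show ?thesis
        using E elliptic_class(3)[OF elliptic lt] types_exclusive(2)[OF elliptic_class(3)[OF elliptic lt]]
        by simp
    next
      assume "\<alpha> = pi / 2"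
      note A = elliptic_class(4)[OF elliptic this]
      show ?thesis using E A types_exclusive(4)[OF conjunct1[OF A]] by simp
    qed
  next
    case parabolic
    have "\<not> pt A \<sim>\<^sub>L pt (vector [0, 0, 0, 1])"
      using parabolic_class(4)[OF parabolic] by (intro kappa_axis) simp
    moreover have "card E = 1" "E \<noteq> {}" using parabolic_class(1)[OF parabolic] by auto
    moreover note type = parabolic_class(2)[OF parabolic]
    ultimately show ?thesis using types_exclusive(3)[OF type] by simp
  qed
  show "card E = 2 \<longleftrightarrow> hyperbolic_type A" using parts by (elim conjE)
  show "card E = 1 \<longleftrightarrow> parabolic_type A" using parts by (elim conjE)
  show "E = {} \<longleftrightarrow> pt A \<sim>\<^sub>L pt (vector [0, 0, 0, 1]) \<or> elliptic_type A"
    using parts by (elim conjE)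
  show "pt A \<sim>\<^sub>L pt (vector [0, 0, 0, 1]) \<Longrightarrow> totally_real A"
    using parts by (elim conjE) (rule mp)
qed

text \<open>S is already known to be similar to the form with some parameter u. If [A] is equivalent
  to the vector with parameter v, then \<open>kappa\<close> forces v = u, which yields the
  similarity for v without lifting a Lorentz transformation to SL(2,C). The same argument gives
  uniqueness, and the elliptic case runs alike.\<close>

lemma hyperbolic_part:
  assumes "card E = 2"
  shows "\<forall>u::real. u > 0 \<longrightarrow>
      (S \<sim>\<^sub>c mat2 (of_real (exp u)) 0 0 (of_real (exp (- u))) \<longleftrightarrow>
       pt A \<sim>\<^sub>L pt (vector [of_real (sinh u), \<i> * of_real (cosh u), 0, 0]))"
    "\<exists>!u::real. u > 0 \<and> S \<sim>\<^sub>c mat2 (of_real (exp u)) 0 0 (of_real (exp (- u)))"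
    "conformally_equivalent (hyperplane_plus A) (Some ` (UNIV - {0}))"
proof -
  obtain u :: real where u: "u > 0" "S \<sim>\<^sub>c mat2 (of_real (exp u)) 0 0 (of_real (exp (- u)))"
  proof (cases rule: class_cases)
    case identity
    then show ?thesis using identity_class(1) assms by simp
  next
    case (elliptic \<alpha>)
    then show ?thesis using elliptic_class(1)[OF elliptic] assms by simp
  next
    case parabolic
    then show ?thesis using parabolic_class(1) assms by simp
  qed
  note kappa = hyperbolic_class(4)[OF u]
  show "\<forall>v::real. v > 0 \<longrightarrow>
      (S \<sim>\<^sub>c mat2 (of_real (exp v)) 0 0 (of_real (exp (- v))) \<longleftrightarrow>
       pt A \<sim>\<^sub>L pt (vector [of_real (sinh v), \<i> * of_real (cosh v), 0, 0]))"
  proof (intro allI impI iffI)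
    fix v :: real
    assume v: "v > 0"
    show "pt A \<sim>\<^sub>L pt (vector [of_real (sinh v), \<i> * of_real (cosh v), 0, 0])"
      if "S \<sim>\<^sub>c mat2 (of_real (exp v)) 0 0 (of_real (exp (- v)))"
      using hyperbolic_class(3)[OF v that] .
    assume "pt A \<sim>\<^sub>L pt (vector [of_real (sinh v), \<i> * of_real (cosh v), 0, 0])"
    then have "1 + 2 * (sinh v)\<^sup>2 = 1 + 2 * (sinh u)\<^sup>2"
      using kappa_lorentz_equiv unfolding kappa[symmetric] kappa_normal_forms(4)[of v, symmetric] by metis
    then have "v = u" by (rule hyperbolic_parameter[OF v u(1)])
    then show "S \<sim>\<^sub>c mat2 (of_real (exp v)) 0 0 (of_real (exp (- v)))" using u by simp
  qed
  show "\<exists>!u::real. u > 0 \<and> S \<sim>\<^sub>c mat2 (of_real (exp u)) 0 0 (of_real (exp (- u)))"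
  proof (intro ex1I[of _ u] conjI u)
    fix v :: real
    assume v: "v > 0 \<and> S \<sim>\<^sub>c mat2 (of_real (exp v)) 0 0 (of_real (exp (- v)))"
    then have "1 + 2 * (sinh v)\<^sup>2 = 1 + 2 * (sinh u)\<^sup>2"
      using hyperbolic_class(4) unfolding kappa[symmetric] by metis
    with v show "v = u" using hyperbolic_parameter u(1) by blast
  qed
  show "conformally_equivalent (hyperplane_plus A) (Some ` (UNIV - {0}))"
    using hyperbolic_class(5)[OF u] .
qed

lemma elliptic_part:
  assumes "E = {}"
  shows "\<forall>\<alpha>::real. 0 < \<alpha> \<and> \<alpha> \<le> pi / 2 \<longrightarrow>
      (S \<sim>\<^sub>c mat2 0 (\<i> * exp (- (\<i> * of_real \<alpha>))) (\<i> * exp (\<i> * of_real \<alpha>)) 0 \<longleftrightarrow>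
       pt A \<sim>\<^sub>L pt (vector [0, 0, of_real (cos \<alpha>), \<i> * of_real (sin \<alpha>)]))"
    "\<exists>!\<alpha>::real. 0 < \<alpha> \<and> \<alpha> \<le> pi / 2 \<and>
      S \<sim>\<^sub>c mat2 0 (\<i> * exp (- (\<i> * of_real \<alpha>))) (\<i> * exp (\<i> * of_real \<alpha>)) 0"
    "conformally_equivalent (hyperplane_plus A) UNIV"
proof -
  obtain \<alpha> :: real where \<alpha>: "0 < \<alpha>" "\<alpha> \<le> pi / 2"
    "S \<sim>\<^sub>c mat2 0 (\<i> * exp (- (\<i> * of_real \<alpha>))) (\<i> * exp (\<i> * of_real \<alpha>)) 0"
    using SL2_no_conj_eigenvector_classification[OF SL assms] by blast
  note kappa = elliptic_class(5)[OF \<alpha>]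
  show "\<forall>\<beta>::real. 0 < \<beta> \<and> \<beta> \<le> pi / 2 \<longrightarrow>
      (S \<sim>\<^sub>c mat2 0 (\<i> * exp (- (\<i> * of_real \<beta>))) (\<i> * exp (\<i> * of_real \<beta>)) 0 \<longleftrightarrow>
       pt A \<sim>\<^sub>L pt (vector [0, 0, of_real (cos \<beta>), \<i> * of_real (sin \<beta>)]))"
  proof (intro allI impI iffI)
    fix \<beta> :: real
    assume \<beta>: "0 < \<beta> \<and> \<beta> \<le> pi / 2"
    show "pt A \<sim>\<^sub>L pt (vector [0, 0, of_real (cos \<beta>), \<i> * of_real (sin \<beta>)])"
      if "S \<sim>\<^sub>c mat2 0 (\<i> * exp (- (\<i> * of_real \<beta>))) (\<i> * exp (\<i> * of_real \<beta>)) 0"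
      using elliptic_class(2) \<beta> that by blast
    assume "pt A \<sim>\<^sub>L pt (vector [0, 0, of_real (cos \<beta>), \<i> * of_real (sin \<beta>)])"
    then have "1 - 2 * (sin \<beta>)\<^sup>2 = 1 - 2 * (sin \<alpha>)\<^sup>2"
      using kappa_lorentz_equiv unfolding kappa[symmetric] kappa_normal_forms(5)[of \<beta>, symmetric] by metis
    then have "\<beta> = \<alpha>" using \<beta> \<alpha>(1,2) elliptic_parameter by blast
    then show "S \<sim>\<^sub>c mat2 0 (\<i> * exp (- (\<i> * of_real \<beta>))) (\<i> * exp (\<i> * of_real \<beta>)) 0"
      using \<alpha> by simp
  qed
  show "\<exists>!\<alpha>::real. 0 < \<alpha> \<and> \<alpha> \<le> pi / 2 \<and>
      S \<sim>\<^sub>c mat2 0 (\<i> * exp (- (\<i> * of_real \<alpha>))) (\<i> * exp (\<i> * of_real \<alpha>)) 0"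
  proof (intro ex1I[of _ \<alpha>] conjI \<alpha>)
    fix \<beta> :: real
    assume \<beta>: "0 < \<beta> \<and> \<beta> \<le> pi / 2 \<and>
      S \<sim>\<^sub>c mat2 0 (\<i> * exp (- (\<i> * of_real \<beta>))) (\<i> * exp (\<i> * of_real \<beta>)) 0"
    then have "kappa A = 1 - 2 * (sin \<beta>)\<^sup>2" using elliptic_class(5) by blast
    then have "1 - 2 * (sin \<beta>)\<^sup>2 = 1 - 2 * (sin \<alpha>)\<^sup>2" unfolding kappa by (rule sym)
    with \<beta> show "\<beta> = \<alpha>" using \<alpha>(1,2) elliptic_parameter by blast
  qed
  show "conformally_equivalent (hyperplane_plus A) UNIV"
    using elliptic_class(6)[OF \<alpha>] .
qed

lemma parabolic_part:
  assumes "card E = 1"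
  shows "S \<sim>\<^sub>c mat2 1 1 0 1" "pt A \<sim>\<^sub>L pt (vector [1, 0, \<i>, \<i>])"
    "conformally_equivalent (hyperplane_plus A) (range Some)"
proof -
  show sim: "S \<sim>\<^sub>c mat2 1 1 0 1"
  proof (cases rule: class_cases)
    case identity
    then show ?thesis using identity_class(1) assms by simp
  next
    case (hyperbolic u)
    then show ?thesis using hyperbolic_class(1)[OF hyperbolic] assms by simp
  next
    case (elliptic \<alpha>)
    then show ?thesis using elliptic_class(1)[OF elliptic] assms by simp
  qed
  show "pt A \<sim>\<^sub>L pt (vector [1, 0, \<i>, \<i>])"
    "conformally_equivalent (hyperplane_plus A) (range Some)"
    using parabolic_class[OF sim] by blast+
qed

lemma class_E: "infinite E \<or> card E = 2 \<or> E = {} \<or> card E = 1"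
proof (cases rule: class_cases)
  case identity
  then show ?thesis using identity_class(1) by simp
next
  case (hyperbolic u)
  then show ?thesis using hyperbolic_class(1)[OF hyperbolic] by simp
next
  case (elliptic \<alpha>)
  then show ?thesis using elliptic_class(1)[OF elliptic] by simp
next
  case parabolic
  then show ?thesis using parabolic_class(1) by simp
qed

text \<open>The eigenratios depend only on the Moebius map, and this is determined by its
  graph.\<close>

lemma E_unique:
  assumes "S' \<in> SL2" "Psi ` hyperplane A = graph_of_moebius S'"
  shows "conj_eigenratios S' = E"
  using graph_of_moebius_inj[of S S'] assms graph
  by (simp add: conj_eigenratios_eq SL)

lemma in_class_iff:
  assumes "A \<noteq> 0"
  shows "in_class A k \<longleftrightarrow> k = Graph_Infinite \<and> infinite E \<or> k = Graph_Two \<and> card E = 2 \<or>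
    k = Graph_Empty \<and> E = {} \<or> k = Graph_One \<and> card E = 1"
proof -
  \<comment> \<open>Makes the existential quantifier of \<open>in_class\<close> a statement about
    the fixed S, so that exclusivity of the classes reduces to exclusivity of conditions on one
    set.\<close>
  have ex: "(\<exists>S'\<in>SL2. Psi ` hyperplane A = graph_of_moebius S' \<and> P (conj_eigenratios S')) \<longleftrightarrow> P E" for P
  proof
    assume "\<exists>S'\<in>SL2. Psi ` hyperplane A = graph_of_moebius S' \<and> P (conj_eigenratios S')"
    then obtain S' where S': "S' \<in> SL2" "Psi ` hyperplane A = graph_of_moebius S'" "P (conj_eigenratios S')"
      by blast
    then show "P E" using E_unique[OF S'(1,2)] by simp
  qed (use SL graph in blast)
  have "pt A \<notin> Q11" using nonzero by (simp add: pt_in_Q11 assms)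
  then show ?thesis
    using ex[of infinite] ex[of "\<lambda>X. card X = 2"] ex[of "\<lambda>X. X = {}"] ex[of "\<lambda>X. card X = 1"]
    by (cases k; simp only: in_class.simps; blast)
qed

lemma unique_class:
  assumes "A \<noteq> 0"
  shows "\<exists>!k. in_class A k"
proof -
  have ex1: "\<exists>!k. k = Graph_Infinite \<and> p \<or> k = Graph_Two \<and> q \<or> k = Graph_Empty \<and> r \<or> k = Graph_One \<and> s"
    if "p \<or> q \<or> r \<or> s" "p \<longrightarrow> \<not> q \<and> \<not> r \<and> \<not> s" "q \<longrightarrow> \<not> r \<and> \<not> s" "r \<longrightarrow> \<not> s" for p q r s
    using that by blast
  show ?thesis
    unfolding in_class_iff[OF assms]
  proof (rule ex1)
    show "infinite E \<longrightarrow> card E \<noteq> 2 \<and> E \<noteq> {} \<and> card E \<noteq> 1" by (intro impI conjI notI) simp_all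
    show "card E = 2 \<longrightarrow> E \<noteq> {} \<and> card E \<noteq> 1" by (intro impI conjI notI) simp_all
    show "E = {} \<longrightarrow> card E \<noteq> 1" by (intro impI notI) simp
  qed (rule class_E)
qed

end

lemma unique_class_Q11:
  assumes "A \<noteq> 0" "mink A A = 0"
  shows "\<exists>!k. in_class A k"
proof -
  obtain c1 c2 where c: "pt A = Psi_inv (c1, c2)" "Psi ` hyperplane A = cross c1 c2"
    using Psi_hyperplane_cross[OF assms] .
  have Q: "pt A \<in> Q11" using assms by (simp add: pt_in_Q11)
  have plus: "pt A \<in> Q11_plus \<longleftrightarrow> c2 \<noteq> cnj_sphere c1" unfolding c(1) by (rule Psi_inv_in_Q11_plus)
  \<comment> \<open>As for graphs, uniqueness of the centre replaces the quantified points by c1 and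
    c2.\<close>
  have ex: "(\<exists>d1 d2. Psi ` hyperplane A = cross d1 d2 \<and> P d1 d2) \<longleftrightarrow> P c1 c2" for P
    unfolding c(2) by (metis cross_inj)
  have "in_class A k \<longleftrightarrow> k = Cross_Positive \<and> c2 \<noteq> cnj_sphere c1 \<or> k = Cross_Nonpositive \<and> c2 = cnj_sphere c1" for k
    using Q plus ex[of "\<lambda>d1 d2. d2 \<noteq> cnj_sphere d1"] ex[of "\<lambda>d1 d2. d2 = cnj_sphere d1"]
    by (cases k; simp only: in_class.simps; blast)
  then show ?thesis by (cases "c2 = cnj_sphere c1") simp_all
qed

theorem theorem2p10:
  fixes A :: "complex ^ 4"
  assumes "A \<noteq> 0"
  shows
    "(\<exists>!k. in_class A k) \<and>
     (pt A \<in> Q11 \<longleftrightarrow> (\<exists>c1 c2. Psi ` hyperplane A = cross c1 c2)) \<and>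
     (\<forall>c1 c2. pt A \<in> Q11 \<and> Psi ` hyperplane A = cross c1 c2 \<longrightarrow>
        (pt A \<in> Q11_plus \<longleftrightarrow> c2 \<noteq> cnj_sphere c1) \<and>
        (pt A \<in> Q11_plus \<longrightarrow> pt A \<sim>\<^sub>L pt (vector [1, \<i>, 0, 0])) \<and>
        (pt A \<notin> Q11_plus \<longleftrightarrow> c2 = cnj_sphere c1) \<and>
        (pt A \<notin> Q11_plus \<longrightarrow> pt A \<sim>\<^sub>L pt (vector [0, 0, 1, 1]))) \<and>
     (pt A \<notin> Q11 \<longleftrightarrow> (\<exists>S\<in>SL2. Psi ` hyperplane A = graph_of_moebius S)) \<and>
     (\<forall>S\<in>SL2. pt A \<notin> Q11 \<and> Psi ` hyperplane A = graph_of_moebius S \<longrightarrow>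
        (infinite (conj_eigenratios S) \<longleftrightarrow> pt A \<sim>\<^sub>L pt (vector [1, 0, 0, 0])) \<and>
        (infinite (conj_eigenratios S) \<longrightarrow>
           S \<sim>\<^sub>c mat2 1 0 0 1 \<and>
           conformally_equivalent (hyperplane_plus A) (Some ` (UNIV - \<real>))) \<and>
        (card (conj_eigenratios S) = 2 \<longleftrightarrow> hyperbolic_type A) \<and>
        (card (conj_eigenratios S) = 2 \<longrightarrow>
           (\<forall>u::real. u > 0 \<longrightarrow>
              (S \<sim>\<^sub>c mat2 (of_real (exp u)) 0 0 (of_real (exp (- u))) \<longleftrightarrow>
               pt A \<sim>\<^sub>L pt (vector [of_real (sinh u), \<i> * of_real (cosh u), 0, 0]))) \<and>
           (\<exists>!u::real. u > 0 \<and> S \<sim>\<^sub>c mat2 (of_real (exp u)) 0 0 (of_real (exp (- u)))) \<and>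
           conformally_equivalent (hyperplane_plus A) (Some ` (UNIV - {0}))) \<and>
        (conj_eigenratios S = {} \<longleftrightarrow>
           pt A \<sim>\<^sub>L pt (vector [0, 0, 0, 1]) \<or> elliptic_type A) \<and>
        (pt A \<sim>\<^sub>L pt (vector [0, 0, 0, 1]) \<longrightarrow> totally_real A) \<and>
        (elliptic_type A \<longrightarrow> \<not> totally_real A) \<and>
        (conj_eigenratios S = {} \<longrightarrow>
           (\<forall>\<alpha>::real. 0 < \<alpha> \<and> \<alpha> \<le> pi / 2 \<longrightarrow>
              (S \<sim>\<^sub>c mat2 0 (\<i> * exp (- (\<i> * of_real \<alpha>))) (\<i> * exp (\<i> * of_real \<alpha>)) 0 \<longleftrightarrow>
               pt A \<sim>\<^sub>L pt (vector [0, 0, of_real (cos \<alpha>), \<i> * of_real (sin \<alpha>)]))) \<and>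
           (\<exists>!\<alpha>::real. 0 < \<alpha> \<and> \<alpha> \<le> pi / 2 \<and>
              S \<sim>\<^sub>c mat2 0 (\<i> * exp (- (\<i> * of_real \<alpha>))) (\<i> * exp (\<i> * of_real \<alpha>)) 0) \<and>
           conformally_equivalent (hyperplane_plus A) UNIV) \<and>
        (card (conj_eigenratios S) = 1 \<longleftrightarrow> parabolic_type A) \<and>
        (card (conj_eigenratios S) = 1 \<longrightarrow>
           S \<sim>\<^sub>c mat2 1 1 0 1 \<and>
           pt A \<sim>\<^sub>L pt (vector [1, 0, \<i>, \<i>]) \<and>
           conformally_equivalent (hyperplane_plus A) (range Some)))"
proof -
  have graph: "graph_hyperplane A S"
    if "S \<in> SL2" "pt A \<notin> Q11 \<and> Psi ` hyperplane A = graph_of_moebius S" for S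
    using that by unfold_locales (auto simp: pt_in_Q11[OF assms])
  note parts = graph_hyperplane.identity_part graph_hyperplane.type_part graph_hyperplane.hyperbolic_part
    graph_hyperplane.elliptic_part graph_hyperplane.parabolic_part
  \<comment> \<open>Splitting the goal by \<open>conjI\<close> breaks up the conclusion of
    \<open>identity_part(2)\<close>, so its halves are provided as separate rules.\<close>
  note identity = graph_hyperplane.identity_part(2)[OF graph, THEN conjunct1]
    graph_hyperplane.identity_part(2)[OF graph, THEN conjunct2]
  have elliptic: "elliptic_type A \<Longrightarrow> \<not> totally_real A" by (simp add: elliptic_type_def)
  show ?thesis
  proof (intro conjI)
    show "\<exists>!k. in_class A k"
    proof (cases "mink A A = 0")
      case True
      then show ?thesis by (rule unique_class_Q11[OF assms])
    next
      case False
      obtain S c where "S \<in> SL2" "Psi ` hyperplane A = graph_of_moebius S" "c \<noteq> 0" "A = c *s Avec S"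
        by (rule SL2_representative[OF False])
      with False interpret graph_hyperplane A S by unfold_locales
      show ?thesis by (rule unique_class[OF assms])
    qed
    show "pt A \<in> Q11 \<longleftrightarrow> (\<exists>c1 c2. Psi ` hyperplane A = cross c1 c2)"
      "pt A \<notin> Q11 \<longleftrightarrow> (\<exists>S\<in>SL2. Psi ` hyperplane A = graph_of_moebius S)"
    proof -
      have "\<exists>c1 c2. Psi ` hyperplane A = cross c1 c2" if "mink A A = 0"
        by (rule Psi_hyperplane_cross[OF assms that]) blast
      moreover have "\<exists>S\<in>SL2. Psi ` hyperplane A = graph_of_moebius S" if "mink A A \<noteq> 0"
        by (rule SL2_representative[OF that]) blast
      moreover have "\<not> ((\<exists>c1 c2. Psi ` hyperplane A = cross c1 c2) \<and>
          (\<exists>S\<in>SL2. Psi ` hyperplane A = graph_of_moebius S))"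
        using cross_neq_graph by force
      ultimately show "pt A \<in> Q11 \<longleftrightarrow> (\<exists>c1 c2. Psi ` hyperplane A = cross c1 c2)"
        "pt A \<notin> Q11 \<longleftrightarrow> (\<exists>S\<in>SL2. Psi ` hyperplane A = graph_of_moebius S)"
        unfolding pt_in_Q11[OF assms] by blast+
    qed
    show "\<forall>c1 c2. pt A \<in> Q11 \<and> Psi ` hyperplane A = cross c1 c2 \<longrightarrow>
          (pt A \<in> Q11_plus \<longleftrightarrow> c2 \<noteq> cnj_sphere c1) \<and>
          (pt A \<in> Q11_plus \<longrightarrow> pt A \<sim>\<^sub>L pt (vector [1, \<i>, 0, 0])) \<and>
          (pt A \<notin> Q11_plus \<longleftrightarrow> c2 = cnj_sphere c1) \<and>
          (pt A \<notin> Q11_plus \<longrightarrow> pt A \<sim>\<^sub>L pt (vector [0, 0, 1, 1]))"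
    proof (intro allI impI)
      fix c1 c2
      assume c: "pt A \<in> Q11 \<and> Psi ` hyperplane A = cross c1 c2"
      then obtain d1 d2 where d: "pt A = Psi_inv (d1, d2)" "Psi ` hyperplane A = cross d1 d2"
        using Psi_hyperplane_cross[OF assms] by (auto simp: pt_in_Q11[OF assms])
      then have A: "pt A = Psi_inv (c1, c2)" using c cross_inj by metis
      show "(pt A \<in> Q11_plus \<longleftrightarrow> c2 \<noteq> cnj_sphere c1) \<and>
          (pt A \<in> Q11_plus \<longrightarrow> pt A \<sim>\<^sub>L pt (vector [1, \<i>, 0, 0])) \<and>
          (pt A \<notin> Q11_plus \<longleftrightarrow> c2 = cnj_sphere c1) \<and>
          (pt A \<notin> Q11_plus \<longrightarrow> pt A \<sim>\<^sub>L pt (vector [0, 0, 1, 1]))"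
        using cross_lorentz_equiv[OF A] Psi_inv_in_Q11_plus[of c1 c2] unfolding A by blast
    qed
  qed (intro ballI impI conjI; (rule parts[OF graph] identity elliptic; assumption))
qed

end
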